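(* Let $n$ be a non-negative integer. For all $F\in\mathcal{E}_n$ and all $U\in\mathcal{J}_0$ there is a homotopy fibre sequence $$\mathrm{res}_n^{n+1}\mathrm{ind}_n^{n+1}F(U)\longrightarrow F(U)\longrightarrow \Omega^{2n}F(U\oplus\mathbb{C}).$$ In particular, for $F\in\mathcal{E}_0$ and $n\ge 1$, there is for all $U$ a homotopy fibre sequence $F^{(n)}(U)\to F^{(n-1)}(U)\to\Omega^{2(n-1)}F^{(n-1)}(U\oplus\mathbb{C})$.
   Context: $\mathsf{Top}_*$ is the category of based compactly generated weak Hausdorff spaces. $\mathcal{J}$ is the category of finite-dimensional complex inner product subspaces of $\mathbb{C}^\infty$ with $\mathcal{J}(U,V)$ the space of complex linear isometries. For $n\ge0$ let $\gamma_n(U,V)=\{(f,x): f\in\mathcal{J}(U,V),\ x\in\mathbb{C}^n\otimes f(U)^\perp\}$, a vector bundle over $\mathcal{J}(U,V)$. The $n$-th jet category $\mathcal{J}_n$ has the same objects as $\mathcal{J}$, and $\mathcal{J}_n(U,V)=\mathrm{Th}(\gamma_n(U,V))$ is the Thom space, with composition $(g,y)\circ(f,x)=(g\circ f,\ y+(\mathrm{id}_{\mathbb{C}^n}\otimes g)(x))$; so $\mathcal{J}_0(U,V)=\mathcal{J}(U,V)_+$. $\mathcal{E}_n$ is the category of $\mathsf{Top}_*$-enriched functors $\mathcal{J}_n\to\mathsf{Top}_*$. For $0\le m<n$, the inclusion $\mathbb{C}^m\subset\mathbb{C}^n$ onto the first $m$ coordinates induces $i_m^n:\mathcal{J}_m\to\mathcal{J}_n$;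 the restriction functor $\mathrm{res}_m^n:\mathcal{E}_n\to\mathcal{E}_m$ is precomposition with $i_m^n$, and the induction functor $\mathrm{ind}_m^n:\mathcal{E}_m\to\mathcal{E}_n$ is its right adjoint, the enriched right Kan extension along $i_m^n$; explicitly $\mathrm{ind}_m^nF(U)\cong\mathcal{E}_m(\mathcal{J}_n(U,-),F)$, the space of natural transformations. For $F\in\mathcal{E}_0$, $F^{(n)}=\mathrm{ind}_0^nF$ is the $n$-th derivative of $F$ ($F^{(0)}=F$). The second map in the sequence is the adjoint of the structure map $S^{2n}\wedge F(U)\to F(U\oplus\mathbb{C})$ given by the action of $\mathcal{J}_n(U,U\oplus\mathbb{C})$ on $F$ restricted to the fibre $S^{2n}=(\mathbb{C}^n\otimes\mathbb{C})^+$ over the standard inclusion; the first map is induced by $i_n^{n+1}:\mathcal{J}_n(U,-)\to\mathcal{J}_{n+1}(U,-)$. *)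

theory Defs
  imports "HOL-Analysis.Analysis" "HOL-Library.Function_Algebras"
begin

definition compact_Hausdorff_in :: "'a topology \<Rightarrow> 'a set \<Rightarrow> bool"
  where "compact_Hausdorff_in X K \<longleftrightarrow> compactin X K \<and> Hausdorff_space (subtopology X K)"

text \<open>Weak Hausdorff means that every continuous map from a compact Hausdorff space \<open>K\<close> to \<open>X\<close> has
  closed image.  It suffices to take the points of \<open>K\<close> in the type \<open>'a set set\<close>: given any \<open>u\<close> on
  any \<open>K\<close>, choose one preimage for each point of the image and let \<open>K'\<close> be the closure of the set
  of these preimages.  Then \<open>K'\<close> has the same image, and as a Hausdorff space with a dense subset
  of at most \<open>\<bar>'a\<bar>\<close> points it has at most \<open>2 ^ (2 ^ \<bar>'a\<bar>)\<close> points.\<close>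

definition weak_Hausdorff :: "'a topology \<Rightarrow> bool"
  where "weak_Hausdorff X \<longleftrightarrow>
    (\<forall>(K :: 'a set set topology) u. compact_space K \<and> Hausdorff_space K \<and> continuous_map K X u
        \<longrightarrow> closedin X (u ` topspace K))"

text \<open>The compactly generated topology on the points of \<open>X\<close>.  It is only used when \<open>X\<close> is weak
  Hausdorff; then the image of a compact Hausdorff space in \<open>X\<close> is a compact Hausdorff subspace, so
  it is enough to test on such subspaces.  The library predicate \<^const>\<open>k_space\<close> tests on all
  quasi-compact subsets, which is a different condition.\<close>

definition kify :: "'a topology \<Rightarrow> 'a topology"
  where "kify X = topology (\<lambda>S. S \<subseteq> topspace X \<and>
    (\<forall>K. compact_Hausdorff_in X K \<longrightarrow> openin (subtopology X K) (K \<inter> S)))"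

lemma openin_kify:
  "openin (kify X) S \<longleftrightarrow> S \<subseteq> topspace X \<and>
    (\<forall>K. compact_Hausdorff_in X K \<longrightarrow> openin (subtopology X K) (K \<inter> S))"
proof -
  have "istopology (\<lambda>S. S \<subseteq> topspace X \<and>
    (\<forall>K. compact_Hausdorff_in X K \<longrightarrow> openin (subtopology X K) (K \<inter> S)))"
    unfolding istopology_def
  proof (intro conjI allI impI)
    fix S T K
    assume S: "S \<subseteq> topspace X \<and> (\<forall>K. compact_Hausdorff_in X K \<longrightarrow> openin (subtopology X K) (K \<inter> S))"
      and T: "T \<subseteq> topspace X \<and> (\<forall>K. compact_Hausdorff_in X K \<longrightarrow> openin (subtopology X K) (K \<inter> T))"
    then show "S \<inter> T \<subseteq> topspace X" by blast
    assume "compact_Hausdorff_in X K"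
    then have "openin (subtopology X K) (K \<inter> S)" "openin (subtopology X K) (K \<inter> T)"
      using S T by simp_all
    then have "openin (subtopology X K) ((K \<inter> S) \<inter> (K \<inter> T))"
      by (rule openin_Int)
    moreover have "(K \<inter> S) \<inter> (K \<inter> T) = K \<inter> (S \<inter> T)" by blast
    ultimately show "openin (subtopology X K) (K \<inter> (S \<inter> T))" by simp
  next
    fix \<K> :: "'a set set"
    assume *: "\<forall>S\<in>\<K>. S \<subseteq> topspace X \<and>
      (\<forall>K. compact_Hausdorff_in X K \<longrightarrow> openin (subtopology X K) (K \<inter> S))"
    then show "\<Union>\<K> \<subseteq> topspace X" by blast
    fix K assume "compact_Hausdorff_in X K"
    then have "openin (subtopology X K) (K \<inter> S)" if "S \<in> \<K>" for S
      using * that by simp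
    then have "openin (subtopology X K) (\<Union>S\<in>\<K>. K \<inter> S)"
      by (intro openin_Union) (elim imageE, simp)
    then show "openin (subtopology X K) (K \<inter> \<Union>\<K>)"
      by (simp only: Int_Union)
  qed
  from topology_inverse'[OF this] show ?thesis
    unfolding kify_def by simp
qed

lemma topspace_kify [simp]: "topspace (kify X) = topspace X"
proof
  have "openin (kify X) (topspace (kify X))" by (rule openin_topspace)
  then show "topspace (kify X) \<subseteq> topspace X"
    unfolding openin_kify by (rule conjunct1)
  have "openin (subtopology X K) (K \<inter> topspace X)" for K
    by (metis inf_commute openin_topspace topspace_subtopology)
  then have "openin (kify X) (topspace X)"
    unfolding openin_kify by simp
  then show "topspace X \<subseteq> topspace (kify X)"
    by (rule openin_subset)
qed

definition compactly_generated :: "'a topology \<Rightarrow> bool"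
  where "compactly_generated X \<longleftrightarrow> kify X = X"

type_synonym 'a based = "'a topology \<times> 'a"

definition Top_based :: "'a based set"
  where "Top_based = {(X, x\<^sub>0). weak_Hausdorff X \<and> compactly_generated X \<and> x\<^sub>0 \<in> topspace X}"

definition based_map :: "'a based \<Rightarrow> 'b based \<Rightarrow> ('a \<Rightarrow> 'b) \<Rightarrow> bool"
  where "based_map X Y f \<longleftrightarrow> continuous_map (fst X) (fst Y) f \<and> f (snd X) = snd Y"

text \<open>As points of mapping spaces, maps are extensional, that is, \<^const>\<open>undefined\<close> off the source.\<close>

definition cmaps :: "'a topology \<Rightarrow> 'b topology \<Rightarrow> ('a \<Rightarrow> 'b) set"
  where "cmaps X Y = {f. continuous_map X Y f \<and> f \<in> extensional (topspace X)}"

definition compact_open :: "'a topology \<Rightarrow> 'b topology \<Rightarrow> ('a \<Rightarrow> 'b) topology"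
  where "compact_open X Y = topology_generated_by (insert (cmaps X Y)
    {{f \<in> cmaps X Y. f ` K \<subseteq> W} | K W. compact_Hausdorff_in X K \<and> openin Y W})"

definition Map :: "'a topology \<Rightarrow> 'b topology \<Rightarrow> ('a \<Rightarrow> 'b) topology"
  where "Map X Y = kify (compact_open X Y)"

definition const_map :: "'a based \<Rightarrow> 'b based \<Rightarrow> 'a \<Rightarrow> 'b"
  where "const_map X Y = (\<lambda>x\<in>topspace (fst X). snd Y)"

definition Map_based :: "'a based \<Rightarrow> 'b based \<Rightarrow> ('a \<Rightarrow> 'b) based"
  where "Map_based X Y =
    (kify (subtopology (compact_open (fst X) (fst Y)) {f. f (snd X) = snd Y}), const_map X Y)"

definition one_point_compactification :: "'a topology \<Rightarrow> 'a option topology"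
  where "one_point_compactification X = topology (\<lambda>S. S \<subseteq> insert None (Some ` topspace X) \<and>
    openin X (Some -` S) \<and> (None \<in> S \<longrightarrow> compactin X (topspace X - Some -` S)))"

lemma openin_one_point_compactification:
  "openin (one_point_compactification X) S \<longleftrightarrow> S \<subseteq> insert None (Some ` topspace X) \<and>
    openin X (Some -` S) \<and> (None \<in> S \<longrightarrow> compactin X (topspace X - Some -` S))"
proof -
  have "istopology (\<lambda>S. S \<subseteq> insert None (Some ` topspace X) \<and>
    openin X (Some -` S) \<and> (None \<in> S \<longrightarrow> compactin X (topspace X - Some -` S)))"
    (is "istopology ?P")
    unfolding istopology_def
  proof (intro conjI allI impI)
    fix S T assume S: "?P S" and T: "?P T"
    show "S \<inter> T \<subseteq> insert None (Some ` topspace X)" using S by blast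
    show "openin X (Some -` (S \<inter> T))" using S T by (simp add: openin_Int)
    assume "None \<in> S \<inter> T"
    then have "compactin X ((topspace X - Some -` S) \<union> (topspace X - Some -` T))"
      using S T by (intro compactin_Un) auto
    then show "compactin X (topspace X - Some -` (S \<inter> T))"
      by (simp add: Diff_Int)
  next
    fix \<K> assume *: "\<forall>S\<in>\<K>. ?P S"
    then show "\<Union>\<K> \<subseteq> insert None (Some ` topspace X)" by blast
    show op: "openin X (Some -` \<Union>\<K>)"
      using * by (auto simp: vimage_Union)
    assume "None \<in> \<Union>\<K>"
    then obtain S where "S \<in> \<K>" "None \<in> S" by blast
    then have "compactin X (topspace X - Some -` S)" using * by blast
    moreover have "closedin X (topspace X - Some -` \<Union>\<K>)" using op by blast
    moreover have "topspace X - Some -` \<Union>\<K> \<subseteq> topspace X - Some -` S"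
      using \<open>S \<in> \<K>\<close> by blast
    ultimately show "compactin X (topspace X - Some -` \<Union>\<K>)"
      using closed_compactin by blast
  qed
  from topology_inverse'[OF this] show ?thesis
    unfolding one_point_compactification_def by simp
qed

lemma topspace_one_point_compactification [simp]:
  "topspace (one_point_compactification X) = insert None (Some ` topspace X)"
proof
  have "openin (one_point_compactification X) (topspace (one_point_compactification X))"
    by (rule openin_topspace)
  then show "topspace (one_point_compactification X) \<subseteq> insert None (Some ` topspace X)"
    unfolding openin_one_point_compactification by (rule conjunct1)
  have "Some -` insert None (Some ` topspace X) = topspace X" by auto
  then have "openin (one_point_compactification X) (insert None (Some ` topspace X))"
    by (simp add: openin_one_point_compactification)
  then show "insert None (Some ` topspace X) \<subseteq> topspace (one_point_compactification X)"
    by (rule openin_subset)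
qed

text \<open>The \<open>k\<close>-th homotopy group (for \<open>k = 0\<close>: the set of path components) consists of the homotopy
  classes, relative to the boundary, of maps of pairs from the cube and its boundary to \<open>(X, x)\<close>.\<close>

definition cube :: "nat \<Rightarrow> (nat \<Rightarrow> real) set"
  where "cube k = {t. (\<forall>i<k. 0 \<le> t i \<and> t i \<le> 1) \<and> (\<forall>i\<ge>k. t i = 0)}"

definition cube_boundary :: "nat \<Rightarrow> (nat \<Rightarrow> real) set"
  where "cube_boundary k = {t \<in> cube k. \<exists>i<k. t i = 0 \<or> t i = 1}"

definition cube_maps :: "nat \<Rightarrow> 'a topology \<Rightarrow> 'a \<Rightarrow> ((nat \<Rightarrow> real) \<Rightarrow> 'a) set"
  where "cube_maps k X x =
    {g. continuous_map (top_of_set (cube k)) X g \<and> (\<forall>t\<in>cube_boundary k. g t = x)}"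

definition cube_homotopy :: "nat \<Rightarrow> 'a topology \<Rightarrow> 'a \<Rightarrow> (((nat \<Rightarrow> real) \<Rightarrow> 'a) \<times> ((nat \<Rightarrow> real) \<Rightarrow> 'a)) set"
  where "cube_homotopy k X x = {(g, h). g \<in> cube_maps k X x \<and> h \<in> cube_maps k X x \<and>
    homotopic_with (\<lambda>f. \<forall>t\<in>cube_boundary k. f t = x) (top_of_set (cube k)) X g h}"

definition homotopy_group :: "nat \<Rightarrow> 'a topology \<Rightarrow> 'a \<Rightarrow> ((nat \<Rightarrow> real) \<Rightarrow> 'a) set set"
  where "homotopy_group k X x = cube_maps k X x // cube_homotopy k X x"

definition homotopy_group_map ::
  "nat \<Rightarrow> 'b topology \<Rightarrow> ('a \<Rightarrow> 'b) \<Rightarrow> 'a \<Rightarrow> ((nat \<Rightarrow> real) \<Rightarrow> 'a) set \<Rightarrow> ((nat \<Rightarrow> real) \<Rightarrow> 'b) set"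
  where "homotopy_group_map k Y f x c = cube_homotopy k Y (f x) `` ((\<lambda>g. f \<circ> g) ` c)"

text \<open>The map induced on homotopy groups is always a homomorphism, so bijectivity is enough.  The
  second condition only matters for empty spaces.\<close>

definition weak_homotopy_equivalence :: "'a topology \<Rightarrow> 'b topology \<Rightarrow> ('a \<Rightarrow> 'b) \<Rightarrow> bool"
  where "weak_homotopy_equivalence X Y f \<longleftrightarrow> continuous_map X Y f \<and>
    (topspace X = {} \<longrightarrow> topspace Y = {}) \<and>
    (\<forall>k. \<forall>x\<in>topspace X.
      bij_betw (homotopy_group_map k Y f x) (homotopy_group k X x) (homotopy_group k Y (f x)))"

definition homotopy_fibre :: "'b based \<Rightarrow> 'c based \<Rightarrow> ('b \<Rightarrow> 'c) \<Rightarrow> ('b \<times> (real \<Rightarrow> 'c)) topology"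
  where "homotopy_fibre Y Z p =
    kify (subtopology (prod_topology (fst Y) (Map (top_of_set {0..1}) (fst Z)))
      {(y, \<gamma>). \<gamma> 0 = p y \<and> \<gamma> 1 = snd Z})"

text \<open>\<open>A \<rightarrow> B \<rightarrow> C\<close> is a homotopy fibre sequence if some based null-homotopy \<open>H\<close> of the composite
  makes the induced map from \<open>A\<close> to the homotopy fibre of \<open>B \<rightarrow> C\<close> a weak homotopy equivalence.\<close>

definition homotopy_fibre_sequence ::
  "'a based \<Rightarrow> 'b based \<Rightarrow> 'c based \<Rightarrow> ('a \<Rightarrow> 'b) \<Rightarrow> ('b \<Rightarrow> 'c) \<Rightarrow> bool"
  where "homotopy_fibre_sequence A B C i p \<longleftrightarrow> based_map A B i \<and> based_map B C p \<and>
    (\<exists>H. continuous_map (prod_topology (fst A) (top_of_set {0..1::real})) (fst C) H \<and>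
      (\<forall>a\<in>topspace (fst A). H (a, 0) = p (i a) \<and> H (a, 1) = snd C) \<and>
      (\<forall>t\<in>{0..1}. H (snd A, t) = snd C) \<and>
      weak_homotopy_equivalence (fst A) (homotopy_fibre B C p) (\<lambda>a. (i a, \<lambda>t\<in>{0..1}. H (a, t))))"

type_synonym cvec = "nat \<Rightarrow> complex"

definition cscale :: "complex \<Rightarrow> cvec \<Rightarrow> cvec"
  where "cscale c v = (\<lambda>i. c * v i)"

interpretation cvec: vector_space cscale
  by unfold_locales (auto simp: cscale_def fun_eq_iff algebra_simps)

definition C_infinity :: "cvec set"
  where "C_infinity = {v. finite {i. v i \<noteq> 0}}"

definition cinner :: "cvec \<Rightarrow> cvec \<Rightarrow> complex"
  where "cinner u v = (\<Sum>i | u i \<noteq> 0. u i * cnj (v i))"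

definition J_objects :: "cvec set set"
  where "J_objects = {U. cvec.subspace U \<and> U \<subseteq> C_infinity \<and> (\<exists>B. finite B \<and> U = cvec.span B)}"

text \<open>An isometry is extended by zero off its source, so that composition in the category is
  composition of functions.\<close>

definition isometries :: "cvec set \<Rightarrow> cvec set \<Rightarrow> (cvec \<Rightarrow> cvec) set"
  where "isometries U V = {f. (\<forall>u\<in>U. f u \<in> V) \<and>
    (\<forall>u\<in>U. \<forall>v\<in>U. f (u + v) = f u + f v) \<and> (\<forall>c. \<forall>u\<in>U. f (cscale c u) = cscale c (f u)) \<and>
    (\<forall>u\<in>U. \<forall>v\<in>U. cinner (f u) (f v) = cinner u v) \<and> (\<forall>u. u \<notin> U \<longrightarrow> f u = 0)}"

text \<open>\<open>(V, \<iota>, e)\<close> is a model inside \<open>\<complex>\<^sup>\<infinity>\<close> of the orthogonal direct sum of \<open>U\<close> and \<open>\<complex>\<close>: \<open>\<iota>\<close> is the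
  inclusion of the first summand and the unit vector \<open>e\<close> is the image of \<open>1 \<in> \<complex>\<close>.\<close>

definition is_plus_C :: "cvec set \<Rightarrow> cvec set \<Rightarrow> (cvec \<Rightarrow> cvec) \<Rightarrow> cvec \<Rightarrow> bool"
  where "is_plus_C U V \<iota> e \<longleftrightarrow> V \<in> J_objects \<and> \<iota> \<in> isometries U V \<and> e \<in> V \<and> cinner e e = 1 \<and>
    (\<forall>u\<in>U. cinner (\<iota> u) e = 0) \<and> V = {\<iota> u + cscale c e | u c. u \<in> U}"

lemma is_plus_C_exists:
  assumes U: "U \<in> J_objects"
  shows "\<exists>V \<iota> e. is_plus_C U V \<iota> e"
proof -
  define S :: "cvec \<Rightarrow> cvec" where "S = (\<lambda>u i. case i of 0 \<Rightarrow> 0 | Suc j \<Rightarrow> u j)"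
  define e :: cvec where "e = (\<lambda>i. if i = 0 then 1 else 0)"
  define V where "V = {S u + cscale c e | u c. u \<in> U}"
  define \<iota> where "\<iota> = (\<lambda>u. if u \<in> U then S u else 0)"
  interpret p: vector_space_pair cscale cscale ..
  have subU: "cvec.subspace U" and UC: "U \<subseteq> C_infinity"
    using U by (auto simp: J_objects_def)
  obtain B where B: "finite B" "U = cvec.span B"
    using U by (auto simp: J_objects_def)
  have add: "S (u + v) = S u + S v" for u v
    by (auto simp: S_def fun_eq_iff split: nat.splits)
  have scale: "S (cscale c u) = cscale c (S u)" for c u
    by (auto simp: S_def cscale_def fun_eq_iff split: nat.splits)
  have lin: "Vector_Spaces.linear cscale cscale S"
    using add scale cvec.vector_space_axioms by (simp add: Vector_Spaces.linear_iff)
  have supp: "{i. S u i \<noteq> 0} = Suc ` {i. u i \<noteq> 0}" for u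
  proof (rule set_eqI)
    show "i \<in> {i. S u i \<noteq> 0} \<longleftrightarrow> i \<in> Suc ` {i. u i \<noteq> 0}" for i
      by (cases i) (auto simp: S_def)
  qed
  have inner_S: "cinner (S u) (S v) = cinner u v" for u v
    unfolding cinner_def supp by (subst sum.reindex) (auto simp: S_def)
  have inner_Se: "cinner (S u) e = 0" for u
    unfolding cinner_def supp by (subst sum.reindex) (auto simp: e_def)
  have "{i. e i \<noteq> 0} = {0}" by (auto simp: e_def)
  then have inner_e: "cinner e e = 1" by (simp add: cinner_def e_def)
  have span: "V = cvec.span (insert e (S ` B))"
  proof -
    have "cvec.span (S ` B) = S ` U"
      using p.linear_span_image[OF lin] B by simp
    then show ?thesis
      unfolding V_def cvec.span_insert by (auto simp: image_iff diff_eq_eq)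
  qed
  have VC: "V \<subseteq> C_infinity"
  proof
    fix v assume "v \<in> V"
    then obtain u c where v: "u \<in> U" "v = S u + cscale c e" by (auto simp: V_def)
    have "{i. v i \<noteq> 0} \<subseteq> insert 0 (Suc ` {i. u i \<noteq> 0})"
      unfolding v supp[symmetric] by (auto simp: cscale_def e_def)
    moreover have "finite {i. u i \<noteq> 0}" using UC v by (auto simp: C_infinity_def)
    ultimately show "v \<in> C_infinity"
      by (auto simp: C_infinity_def intro: finite_subset)
  qed
  have "V \<in> J_objects"
    unfolding J_objects_def using span VC B(1) by (auto intro!: exI[of _ "insert e (S ` B)"])
  moreover have SV: "S u \<in> V" if "u \<in> U" for u
    unfolding V_def using that by (intro CollectI exI[of _ u] exI[of _ 0]) simp
  moreover have "e \<in> V" using span by (simp add: cvec.span_base)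
  moreover have "\<iota> \<in> isometries U V"
    using SV subU
    by (auto simp: isometries_def \<iota>_def add scale inner_S cvec.subspace_add cvec.subspace_scale)
  moreover have "V = {\<iota> u + cscale c e | u c. u \<in> U}"
    unfolding V_def \<iota>_def by (intro Collect_cong ex_cong1) auto
  ultimately have "is_plus_C U V \<iota> e"
    using inner_Se inner_e by (auto simp: is_plus_C_def \<iota>_def)
  then show ?thesis by blast
qed

text \<open>The tensor product of \<open>\<complex>\<^sup>n\<close> with a subspace \<open>W\<close> is the space of \<open>n\<close>-tuples in \<open>W\<close>: the sequence
  \<open>x\<close> (zero from index \<open>n\<close> on) stands for the sum of the \<open>b\<^sub>i \<otimes> x i\<close>, with \<open>b\<^sub>i\<close> the standard basis.  All
  vector spaces here are finite-dimensional, so the product topologies of the function types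
  induce the usual topology on \<open>gamma n U V\<close>.\<close>

definition gamma :: "nat \<Rightarrow> cvec set \<Rightarrow> cvec set \<Rightarrow> ((cvec \<Rightarrow> cvec) \<times> (nat \<Rightarrow> cvec)) set"
  where "gamma n U V = {(f, x). f \<in> isometries U V \<and>
    (\<forall>i<n. x i \<in> V \<and> (\<forall>u\<in>U. cinner (f u) (x i) = 0)) \<and> (\<forall>i\<ge>n. x i = 0)}"

text \<open>The space of isometries is compact, so the Thom space of the bundle is the one-point
  compactification of its total space; \<^const>\<open>None\<close> is the base point.\<close>

type_synonym jet = "((cvec \<Rightarrow> cvec) \<times> (nat \<Rightarrow> cvec)) option"

definition J :: "nat \<Rightarrow> cvec set \<Rightarrow> cvec set \<Rightarrow> jet based"
  where "J n U V = (one_point_compactification (top_of_set (gamma n U V)), None)"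

abbreviation jets :: "nat \<Rightarrow> cvec set \<Rightarrow> cvec set \<Rightarrow> jet set"
  where "jets n U V \<equiv> topspace (fst (J n U V))"

fun jet_comp :: "jet \<Rightarrow> jet \<Rightarrow> jet"
  where "jet_comp (Some (g, y)) (Some (f, x)) = Some (g \<circ> f, \<lambda>i. y i + g (x i))"
  | "jet_comp None _ = None"
  | "jet_comp _ None = None"

definition jet_id :: "cvec set \<Rightarrow> jet"
  where "jet_id U = Some (\<lambda>u. if u \<in> U then u else 0, \<lambda>i. 0)"

text \<open>The functor from the \<open>m\<close>-th to the \<open>n\<close>-th jet category (\<open>m \<le> n\<close>) pads an \<open>m\<close>-tuple by zeros.\<close>

definition jet_incl :: "nat \<Rightarrow> jet \<Rightarrow> jet"
  where "jet_incl m = map_option (\<lambda>(f, x). (f, \<lambda>i. if i < m then x i else 0))"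

record 'a jet_functor =
  ob :: "cvec set \<Rightarrow> 'a based"
  act :: "cvec set \<Rightarrow> cvec set \<Rightarrow> jet \<Rightarrow> 'a \<Rightarrow> 'a"

definition E :: "nat \<Rightarrow> 'a jet_functor set"
  where "E n = {F.
    (\<forall>U\<in>J_objects. ob F U \<in> Top_based) \<and>
    (\<forall>U\<in>J_objects. \<forall>V\<in>J_objects. based_map (J n U V) (Map_based (ob F U) (ob F V)) (act F U V)) \<and>
    (\<forall>U\<in>J_objects. \<forall>a\<in>topspace (fst (ob F U)). act F U U (jet_id U) a = a) \<and>
    (\<forall>U\<in>J_objects. \<forall>V\<in>J_objects. \<forall>W\<in>J_objects. \<forall>\<phi>\<in>jets n U V. \<forall>\<psi>\<in>jets n V W.
      \<forall>a\<in>topspace (fst (ob F U)). act F U W (jet_comp \<psi> \<phi>) a = act F V W \<psi> (act F U V \<phi> a))}"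

definition representable :: "nat \<Rightarrow> cvec set \<Rightarrow> jet jet_functor"
  where "representable n U = \<lparr>ob = J n U, act = \<lambda>V W \<phi>. \<lambda>\<psi>\<in>jets n U V. jet_comp \<phi> \<psi>\<rparr>"

definition res :: "nat \<Rightarrow> 'a jet_functor \<Rightarrow> 'a jet_functor"
  where "res m F = \<lparr>ob = ob F, act = \<lambda>U V \<phi>. act F U V (jet_incl m \<phi>)\<rparr>"

definition natural_transformations ::
  "nat \<Rightarrow> 'b jet_functor \<Rightarrow> 'a jet_functor \<Rightarrow> (cvec set \<Rightarrow> 'b \<Rightarrow> 'a) set"
  where "natural_transformations m G F =
    {\<alpha> \<in> (\<Pi>\<^sub>E V\<in>J_objects. topspace (fst (Map_based (ob G V) (ob F V)))).
      \<forall>V\<in>J_objects. \<forall>W\<in>J_objects. \<forall>\<phi>\<in>jets m V W. \<forall>b\<in>topspace (fst (ob G V)).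
        \<alpha> W (act G V W \<phi> b) = act F V W \<phi> (\<alpha> V b)}"

text \<open>The space of natural transformations is the enriched end: a subspace of the product, over all
  objects, of the based mapping spaces.\<close>

definition Nat :: "nat \<Rightarrow> 'b jet_functor \<Rightarrow> 'a jet_functor \<Rightarrow> (cvec set \<Rightarrow> 'b \<Rightarrow> 'a) based"
  where "Nat m G F =
    (kify (subtopology (product_topology (\<lambda>V. fst (Map_based (ob G V) (ob F V))) J_objects)
       (natural_transformations m G F)),
     \<lambda>V\<in>J_objects. const_map (ob G V) (ob F V))"

definition ind :: "nat \<Rightarrow> nat \<Rightarrow> 'a jet_functor \<Rightarrow> (cvec set \<Rightarrow> jet \<Rightarrow> 'a) jet_functor"
  where "ind m n F =
    \<lparr>ob = \<lambda>U. Nat m (res m (representable n U)) F,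
     act = \<lambda>U U' \<phi>. \<lambda>\<alpha>\<in>natural_transformations m (res m (representable n U)) F.
       \<lambda>V\<in>J_objects. \<lambda>\<psi>\<in>jets n U' V. \<alpha> V (jet_comp \<psi> \<phi>)\<rparr>"

text \<open>For \<open>n \<ge> 1\<close>; the zeroth derivative is the functor itself.\<close>

abbreviation derivative :: "nat \<Rightarrow> 'a jet_functor \<Rightarrow> (cvec set \<Rightarrow> jet \<Rightarrow> 'a) jet_functor"
  where "derivative n F \<equiv> ind 0 n F"

text \<open>Restriction of natural transformations along the map from \<open>J n U -\<close> to the representable functor
  of a higher jet category.\<close>

definition restrict_jets ::
  "nat \<Rightarrow> cvec set \<Rightarrow> (cvec set \<Rightarrow> jet \<Rightarrow> 'a) \<Rightarrow> (cvec set \<Rightarrow> jet \<Rightarrow> 'a)"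
  where "restrict_jets n U \<alpha> = (\<lambda>V\<in>J_objects. \<lambda>\<psi>\<in>jets n U V. \<alpha> V (jet_incl n \<psi>))"

text \<open>The Yoneda isomorphism from transformations \<open>J n U - \<rightarrow> F\<close> to \<open>ob F U\<close>.\<close>

definition yoneda :: "cvec set \<Rightarrow> (cvec set \<Rightarrow> jet \<Rightarrow> 'a) \<Rightarrow> 'a"
  where "yoneda U \<alpha> = \<alpha> U (jet_id U)"

text \<open>The sphere of dimension \<open>2n\<close> is the one-point compactification of \<open>\<complex>\<^sup>n\<close>.\<close>

definition even_sphere :: "nat \<Rightarrow> cvec option based"
  where "even_sphere n = (one_point_compactification (top_of_set {z. \<forall>i\<ge>n. z i = 0}), None)"

definition even_loops :: "nat \<Rightarrow> 'a based \<Rightarrow> (cvec option \<Rightarrow> 'a) based"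
  where "even_loops n X = Map_based (even_sphere n) X"

text \<open>The fibre inclusion sends \<open>z\<close> to the jet over \<open>\<iota>\<close> with vector \<open>z \<otimes> e\<close>.\<close>

definition fibre_incl :: "(cvec \<Rightarrow> cvec) \<Rightarrow> cvec \<Rightarrow> cvec option \<Rightarrow> jet"
  where "fibre_incl \<iota> e = map_option (\<lambda>z. (\<iota>, \<lambda>i. cscale (z i) e))"

definition adjoint_structure_map ::
  "nat \<Rightarrow> 'a jet_functor \<Rightarrow> cvec set \<Rightarrow> cvec set \<Rightarrow> (cvec \<Rightarrow> cvec) \<Rightarrow> cvec \<Rightarrow> 'a \<Rightarrow> (cvec option \<Rightarrow> 'a)"
  where "adjoint_structure_map n F U V \<iota> e a =
    (\<lambda>s\<in>topspace (fst (even_sphere n)). act F U V (fibre_incl \<iota> e s) a)"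

end

theory Submission
  imports Defs
begin

text \<open>Let \<open>(V, \<iota>, e)\<close> be a model of \<open>U \<oplus> \<complex>\<close>.  The Thom space \<open>J (n + 1) U W\<close> is not just equivalent but
  homeomorphic to the reduced mapping cone of the composition map
  \<open>J n V W \<and> S\<^sup>2\<^sup>n \<longrightarrow> J n U W\<close>: a jet \<open>(f, x)\<close> with last vector \<open>x n \<noteq> 0\<close> determines the extension of \<open>f\<close>
  to \<open>V\<close> that sends \<open>e\<close> to \<open>x n / \<bar>x n\<bar>\<close>, and \<open>\<bar>x n\<bar>\<close> is the cone coordinate.  These homeomorphisms are
  natural in \<open>W\<close>, so a transformation from \<open>J (n + 1) U -\<close> to \<open>F\<close> is the same as a point \<open>a\<close> of \<open>F U\<close>
  with a path in \<open>\<Omega>\<^sup>2\<^sup>n F V\<close> from the image of \<open>a\<close> to the base point, that is, a point of the homotopy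
  fibre.  Since the topologies are compactly generated, continuity of the two mutually inverse maps
  need only be tested on compact Hausdorff spaces.\<close>

subsection \<open>Compactly generated weak Hausdorff spaces\<close>

text \<open>The obstacle is point-set topology: evaluation of maps is only guaranteed to be
  continuous over compact Hausdorff parts of the source. The predicate
  \<open>hausdorff_images\<close> is what k-ification needs in order to accept maps from compact
  Hausdorff spaces; it follows from \<open>weak_Hausdorff\<close> and passes to subspaces, products,
  finer topologies and mapping spaces. Continuity at the base points of Thom spaces is handled by
  coordinates weighted with exp (-|x|^2). The cone coordinate is accordingly t = 1 - exp (-|x n|^2),
  which makes the weight of a cone point (1 - t) times the weight of its sphere point. The cone is
  never formed as a quotient space. The Thom space is covered by the images of two compact spaces,
  and closedness of these maps supplies the quotient property. There are two parameters k \<le> n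
  because both statements are instances of one argument: k = n gives the sequence for F in
  \<open>E n\<close>, and k = 0 gives the one for derivatives directly from transformations over the
  zeroth jet category, with no comparison of iterated Kan extensions.\<close>

definition hausdorff_images :: "'a topology \<Rightarrow> bool"
  where "hausdorff_images X \<longleftrightarrow>
    (\<forall>(K :: 'a set set topology) u. compact_space K \<and> Hausdorff_space K \<and> continuous_map K X u
        \<longrightarrow> Hausdorff_space (subtopology X (u ` topspace K)))"

text \<open>The points of the closure of a set of representatives of the fibres of \<open>u\<close> are separated by the sets
  of representatives that they adhere to, which embeds this closure into the type of sets of sets.\<close>

lemma compact_Hausdorff_retype:
  fixes K :: "'k topology" and X :: "'a topology"
  assumes K: "compact_space K" "Hausdorff_space K" and u: "continuous_map K X u"
  shows "\<exists>(K' :: 'a set set topology) u'. compact_space K' \<and> Hausdorff_space K' \<and>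
    continuous_map K' X u' \<and> u' ` topspace K' = u ` topspace K"
proof -
  define I where "I = u ` topspace K"
  define d where "d = inv_into (topspace K) u"
  have d: "d x \<in> topspace K" "u (d x) = x" if "x \<in> I" for x
    using that inv_into_into[of x u "topspace K"] f_inv_into_f[of x u "topspace K"]
    unfolding I_def d_def by simp_all
  define C where "C = K closure_of (d ` I)"
  define K0 where "K0 = subtopology K C"
  have top0: "topspace K0 = C"
    unfolding K0_def C_def using closure_of_subset_topspace[of K "d ` I"] by auto
  define emb where "emb p = {S. S \<subseteq> I \<and> p \<in> K closure_of (d ` S)}" for p
  have CK: "C \<subseteq> topspace K" unfolding C_def by (rule closure_of_subset_topspace)
  have inj: "inj_on emb C"
  proof (rule inj_onI, rule ccontr)
    fix p q assume p: "p \<in> C" and q: "q \<in> C" and eq: "emb p = emb q" and "p \<noteq> q"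
    have "p \<in> topspace K" "q \<in> topspace K" using p q CK by auto
    then obtain M N where MN: "openin K M" "openin K N" "p \<in> M" "q \<in> N" "disjnt M N"
      using K(2) \<open>p \<noteq> q\<close> unfolding Hausdorff_space_def by metis
    \<comment> \<open>The representatives inside the neighbourhood \<open>M\<close> of
      \<open>p\<close>: \<open>p\<close> adheres to them because it lies in \<open>C\<close>, while
      the disjoint neighbourhood \<open>N\<close> keeps \<open>q\<close> away from them.\<close>
    define S where "S = {x \<in> I. d x \<in> M}"
    have "p \<in> K closure_of (d ` S)"
      unfolding in_closure_of
    proof (intro conjI allI impI)
      show "p \<in> topspace K" using p CK by blast
      fix T assume "p \<in> T \<and> openin K T"
      then have "p \<in> T \<inter> M" "openin K (T \<inter> M)" using MN by auto
      then obtain y where "y \<in> d ` I" "y \<in> T \<inter> M"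
        using p unfolding C_def in_closure_of by metis
      then show "\<exists>y. y \<in> d ` S \<and> y \<in> T" unfolding S_def by auto
    qed
    then have "S \<in> emb q" using eq unfolding emb_def S_def by blast
    then have "q \<in> K closure_of (d ` S)" unfolding emb_def by blast
    then obtain y where "y \<in> d ` S" "y \<in> N"
      using MN unfolding in_closure_of by metis
    then show False using MN unfolding S_def disjnt_def by auto
  qed
  define g where "g = inv_into C emb"
  have ge: "g (emb p) = p" if "p \<in> C" for p
    using inj that by (simp add: g_def)
  define K' where "K' = pullback_topology (emb ` C) g K0"
  have top': "topspace K' = emb ` C"
    unfolding K'_def topspace_pullback_topology top0 using ge by auto
  have "continuous_map K' K0 (id \<circ> g)"
    unfolding K'_def by (intro continuous_map_pullback continuous_map_id)
  then have g: "continuous_map K' K0 g" by simp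
  have "continuous_map K0 K0 (g \<circ> emb)"
    by (rule continuous_map_eq[OF continuous_map_id]) (use ge top0 in simp)
  then have emb: "continuous_map K0 K' emb"
    unfolding K'_def by (intro continuous_map_pullback') (use top0 in auto)
  have hom: "K0 homeomorphic_space K'"
    unfolding homeomorphic_space_def homeomorphic_maps_def
    using g emb ge top0 top' by (intro exI[of _ emb] exI[of _ g]) auto
  have "compactin K C"
    by (simp add: C_def K(1) closedin_compact_space)
  then have "compact_space K0"
    unfolding K0_def by (simp add: compact_space_subtopology)
  moreover have "Hausdorff_space K0"
    unfolding K0_def by (simp add: Hausdorff_space_subtopology K(2))
  ultimately have "compact_space K'" "Hausdorff_space K'"
    using hom homeomorphic_compact_space homeomorphic_Hausdorff_space by blast+
  moreover have "continuous_map K' X (u \<circ> g)"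
    using g u unfolding K0_def
    by (meson continuous_map_compose continuous_map_into_fulltopology)
  moreover have "(u \<circ> g) ` topspace K' = u ` topspace K"
  proof
    show "(u \<circ> g) ` topspace K' \<subseteq> u ` topspace K"
      unfolding top' using ge CK by auto
    show "u ` topspace K \<subseteq> (u \<circ> g) ` topspace K'"
    proof
      fix x assume "x \<in> u ` topspace K"
      then have x: "x \<in> I" by (simp add: I_def)
      have "d ` I \<subseteq> C" unfolding C_def
        by (rule closure_of_subset) (use d in blast)
      then have "emb (d x) \<in> topspace K'" "g (emb (d x)) = d x"
        using x ge top' by blast+
      then show "x \<in> (u \<circ> g) ` topspace K'"
        using d(2)[OF x] by (metis comp_apply image_eqI)
    qed
  qed
  ultimately show ?thesis by blast
qed

text \<open>The definition can quantify over test spaces of one type only; retyping extends it to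
  compact Hausdorff spaces with points of any type.\<close>

lemma hausdorff_imagesD:
  assumes "hausdorff_images X" "compact_space K" "Hausdorff_space K" "continuous_map K X u"
  shows "Hausdorff_space (subtopology X (u ` topspace K))"
  using compact_Hausdorff_retype[OF assms(2-4)] assms(1) unfolding hausdorff_images_def by metis

lemma hausdorff_images_compact:
  assumes "hausdorff_images X" "compact_space K" "Hausdorff_space K" "continuous_map K X u"
  shows "compact_Hausdorff_in X (u ` topspace K)"
  unfolding compact_Hausdorff_in_def
  using hausdorff_imagesD[OF assms] image_compactin[OF _ assms(4)] assms(2)
  by (auto simp: compact_space_def)

text \<open>Closed subsets of a test space are test spaces again, so \<open>u\<close> is a closed
  map onto its image. Points of the image are closed for the same reason, and a T1 closed image of a
  normal space is Hausdorff.\<close>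

lemma weak_Hausdorff_hausdorff_images:
  fixes X :: "'a topology"
  assumes X: "weak_Hausdorff X"
  shows "hausdorff_images X"
  unfolding hausdorff_images_def
proof (intro allI impI, elim conjE)
  fix K :: "'a set set topology" and u
  assume K: "compact_space K" "Hausdorff_space K" and u: "continuous_map K X u"
  let ?Y = "subtopology X (u ` topspace K)"
  have sub: "u ` topspace K \<subseteq> topspace X" using u continuous_map_image_subset_topspace by blast
  have uY: "continuous_map K ?Y u" using u by (simp add: continuous_map_in_subtopology)
  have im: "closedin X (u ` C)" if C: "closedin K C" for C
  proof -
    have "compact_space (subtopology K C)" "Hausdorff_space (subtopology K C)"
      "continuous_map (subtopology K C) X u"
      using compact_space_subtopology[OF closedin_compact_space[OF K(1) C]]
        Hausdorff_space_subtopology[OF K(2)] continuous_map_from_subtopology[OF u] .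
    then have "closedin X (u ` topspace (subtopology K C))"
      using X unfolding weak_Hausdorff_def by blast
    then show ?thesis
      using closedin_subset[OF C] by (simp add: inf_absorb2)
  qed
  have "closed_map K ?Y u"
    unfolding closed_map_def
  proof (intro allI impI)
    fix C assume C: "closedin K C"
    then have "u ` C \<subseteq> u ` topspace K" using closedin_subset by blast
    then show "closedin ?Y (u ` C)" using im[OF C] closedin_subset_topspace by blast
  qed
  moreover have "u ` topspace K = topspace ?Y" using sub by auto
  moreover have "t1_space ?Y"
    unfolding t1_space_closedin_singleton
  proof
    fix x assume "x \<in> topspace ?Y"
    then obtain k where k: "k \<in> topspace K" "x = u k" using sub by auto
    then have "closedin X (u ` {k})"
      using im Hausdorff_imp_t1_space[OF K(2)] unfolding t1_space_closedin_singleton by blast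
    then have "closedin X {x}" using k by simp
    moreover have "{x} \<subseteq> u ` topspace K" using k by blast
    ultimately show "closedin ?Y {x}" by (rule closedin_subset_topspace)
  qed
  ultimately show "Hausdorff_space ?Y"
    using Hausdorff_normal_space_closed_continuous_map_image uY
      compact_Hausdorff_or_regular_imp_normal_space K by metis
qed

text \<open>The composite \<open>f \<circ> u\<close> has a Hausdorff image, and \<open>f\<close>
  maps the image of \<open>u\<close> injectively and continuously into it. With
  \<open>f = id\<close> this covers subspaces and finer topologies.\<close>

lemma hausdorff_images_injective:
  fixes X :: "'a topology" and Y :: "'b topology"
  assumes Y: "hausdorff_images Y" and f: "continuous_map X Y f" "inj_on f (topspace X)"
  shows "hausdorff_images X"
  unfolding hausdorff_images_def
proof (intro allI impI, elim conjE)
  fix K :: "'a set set topology" and u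
  assume K: "compact_space K" "Hausdorff_space K" and u: "continuous_map K X u"
  have sub: "u ` topspace K \<subseteq> topspace X" using u continuous_map_image_subset_topspace by blast
  have "Hausdorff_space (subtopology Y ((f \<circ> u) ` topspace K))"
    using Y K continuous_map_compose[OF u f(1)] hausdorff_imagesD by blast
  moreover have "continuous_map (subtopology X (u ` topspace K)) (subtopology Y ((f \<circ> u) ` topspace K)) f"
    using f(1) by (auto simp: continuous_map_in_subtopology continuous_map_from_subtopology)
  ultimately show "Hausdorff_space (subtopology X (u ` topspace K))"
    by (rule Hausdorff_space_injective_preimage)
      (use f(2) sub in \<open>auto intro: inj_on_subset\<close>)
qed

lemma hausdorff_images_subtopology:
  "hausdorff_images X \<Longrightarrow> hausdorff_images (subtopology X S)"
  by (rule hausdorff_images_injective[where f=id and Y=X]) auto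

section \<open>Properties of k-ification\<close>

lemma continuous_map_kify_id: "continuous_map (kify X) X id"
  unfolding continuous_map_def
proof (intro conjI allI impI)
  fix S assume S: "openin X S"
  then have "openin (kify X) S"
    unfolding openin_kify by (auto simp: openin_subset openin_subtopology)
  then show "openin (kify X) {x \<in> topspace (kify X). id x \<in> S}"
    using openin_subset[OF S] by (auto simp: Collect_conj_eq inf_absorb2)
qed auto

lemma continuous_map_kifyD: "continuous_map K (kify X) f \<Longrightarrow> continuous_map K X f"
  using continuous_map_compose[OF _ continuous_map_kify_id] by fastforce

lemma hausdorff_images_kify: "hausdorff_images X \<Longrightarrow> hausdorff_images (kify X)"
  by (rule hausdorff_images_injective[where f=id and Y=X]) (auto simp: continuous_map_kify_id)

text \<open>The image lies in the product of its projections, each of which is Hausdorff.\<close>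

lemma hausdorff_images_product:
  fixes X :: "'i \<Rightarrow> 'b topology"
  assumes "\<And>i. i \<in> I \<Longrightarrow> hausdorff_images (X i)"
  shows "hausdorff_images (product_topology X I)"
  unfolding hausdorff_images_def
proof (intro allI impI, elim conjE)
  fix K :: "('i \<Rightarrow> 'b) set set topology" and u
  assume K: "compact_space K" "Hausdorff_space K" and u: "continuous_map K (product_topology X I) u"
  let ?S = "\<lambda>i. (\<lambda>k. u k i) ` topspace K"
  have ui: "continuous_map K (X i) (\<lambda>k. u k i)" if "i \<in> I" for i
    using u that by (simp add: continuous_map_componentwise)
  have ext: "u ` topspace K \<subseteq> PiE I ?S"
    using u by (auto simp: continuous_map_componentwise)
  have "Hausdorff_space (product_topology (\<lambda>i. subtopology (X i) (?S i)) I)"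
    unfolding Hausdorff_space_product_topology
    using hausdorff_imagesD[OF assms K ui] by blast
  then have "Hausdorff_space (subtopology (product_topology X I) (PiE I ?S))"
    by (simp only: subtopology_product_topology)
  then show "Hausdorff_space (subtopology (product_topology X I) (u ` topspace K))"
    using Hausdorff_space_subtopology ext by (metis inf.absorb_iff2 subtopology_subtopology)
qed

lemma hausdorff_images_prod:
  fixes X :: "'a topology" and Y :: "'b topology"
  assumes "hausdorff_images X" "hausdorff_images Y"
  shows "hausdorff_images (prod_topology X Y)"
  unfolding hausdorff_images_def
proof (intro allI impI, elim conjE)
  fix K :: "('a \<times> 'b) set set topology" and u
  assume K: "compact_space K" "Hausdorff_space K" and u: "continuous_map K (prod_topology X Y) u"
  let ?S = "(\<lambda>k. fst (u k)) ` topspace K" and ?T = "(\<lambda>k. snd (u k)) ` topspace K"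
  have c: "continuous_map K X (\<lambda>k. fst (u k))" "continuous_map K Y (\<lambda>k. snd (u k))"
    using u continuous_map_fst_of continuous_map_snd_of by (fastforce simp: o_def)+
  have ext: "u ` topspace K \<subseteq> ?S \<times> ?T"
    by (intro image_subsetI) (simp add: mem_Times_iff)
  have "Hausdorff_space (prod_topology (subtopology X ?S) (subtopology Y ?T))"
    unfolding Hausdorff_space_prod_topology
    using hausdorff_imagesD[OF assms(1) K c(1)] hausdorff_imagesD[OF assms(2) K c(2)] by blast
  then have "Hausdorff_space (subtopology (prod_topology X Y) (?S \<times> ?T))"
    by (simp add: subtopology_Times)
  then show "Hausdorff_space (subtopology (prod_topology X Y) (u ` topspace K))"
    using Hausdorff_space_subtopology ext by (metis inf.absorb_iff2 subtopology_subtopology)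
qed

text \<open>The universal property of k-ification for compact test spaces: the image of
  \<open>u\<close> is itself one of the compact Hausdorff subspaces on which \<open>kify\<close>
  tests openness.\<close>

lemma continuous_map_into_kify:
  assumes X: "hausdorff_images X" and K: "compact_space K" "Hausdorff_space K"
    and u: "continuous_map K X u"
  shows "continuous_map K (kify X) u"
  unfolding continuous_map_def
proof (intro conjI allI impI)
  show "u \<in> topspace K \<rightarrow> topspace (kify X)"
    using u by (simp add: continuous_map_def)
  fix S assume S: "openin (kify X) S"
  let ?L = "u ` topspace K"
  have "openin (subtopology X ?L) (?L \<inter> S)"
    using S hausdorff_images_compact[OF X K u] unfolding openin_kify by blast
  moreover have "continuous_map K (subtopology X ?L) u"
    using u by (simp add: continuous_map_in_subtopology)
  ultimately have "openin K {x \<in> topspace K. u x \<in> ?L \<inter> S}"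
    by (intro openin_continuous_map_preimage)
  moreover have "{x \<in> topspace K. u x \<in> ?L \<inter> S} = {x \<in> topspace K. u x \<in> S}" by auto
  ultimately show "openin K {x \<in> topspace K. u x \<in> S}" by simp
qed

text \<open>The open sets added by k-ification are by construction already open on each compact
  Hausdorff subspace. Idempotence of \<open>kify\<close> rests on this.\<close>

lemma subtopology_kify:
  assumes "compact_Hausdorff_in X K"
  shows "subtopology (kify X) K = subtopology X K"
proof (rule topology_eq[THEN iffD2], intro allI iffI)
  fix S assume "openin (subtopology (kify X) K) S"
  then obtain T where "openin (kify X) T" "S = T \<inter> K" by (auto simp: openin_subtopology)
  then show "openin (subtopology X K) S"
    using assms by (simp add: openin_kify inf_commute)
next
  fix S assume "openin (subtopology X K) S"
  then obtain T where T: "openin X T" "S = T \<inter> K" by (auto simp: openin_subtopology)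
  have "openin (kify X) T"
    unfolding openin_kify using T by (auto simp: openin_subset openin_subtopology)
  then show "openin (subtopology (kify X) K) S"
    using T by (auto simp: openin_subtopology)
qed

lemma compact_Hausdorff_in_kify:
  "compact_Hausdorff_in X K \<Longrightarrow> compact_Hausdorff_in (kify X) K"
  using subtopology_kify[of X K] by (simp add: compact_Hausdorff_in_def compactin_subspace)

lemma compactly_generated_kify [simp]: "compactly_generated (kify X)"
  unfolding compactly_generated_def topology_eq
proof (intro allI iffI)
  fix S assume S: "openin (kify (kify X)) S"
  then have S': "S \<subseteq> topspace X"
    "\<And>K. compact_Hausdorff_in (kify X) K \<Longrightarrow> openin (subtopology (kify X) K) (K \<inter> S)"
    unfolding openin_kify[of "kify X"] by simp_all
  show "openin (kify X) S"
    unfolding openin_kify[of X]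
    using S' compact_Hausdorff_in_kify subtopology_kify by (metis topspace_kify)
next
  fix S assume "openin (kify X) S"
  then show "openin (kify (kify X)) S"
    unfolding openin_kify[of "kify X"] using openin_subset by (fastforce simp: openin_subtopology)
qed

lemma compact_Hausdorff_in_singleton:
  "x \<in> topspace X \<Longrightarrow> compact_Hausdorff_in X {x}"
  by (simp add: compact_Hausdorff_in_def)
    (metis Hausdorff_space_discrete_topology Hausdorff_space_def singletonD topspace_subtopology Int_iff)

text \<open>Together with \<open>continuous_map_into_kify\<close> this reduces continuity between
  k-ified spaces to maps out of compact Hausdorff spaces.\<close>

lemma continuous_map_compactly_generated:
  assumes X: "compactly_generated X"
    and f: "\<And>K. compact_Hausdorff_in X K \<Longrightarrow> continuous_map (subtopology X K) Y f"
  shows "continuous_map X Y f"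
  unfolding continuous_map_def
proof (intro conjI allI impI)
  show "f \<in> topspace X \<rightarrow> topspace Y"
  proof
    fix x assume "x \<in> topspace X"
    then show "f x \<in> topspace Y"
      using continuous_map_image_subset_topspace[OF f[OF compact_Hausdorff_in_singleton]] by auto
  qed
  fix S assume S: "openin Y S"
  let ?P = "{x \<in> topspace X. f x \<in> S}"
  have "openin (kify X) ?P"
    unfolding openin_kify
  proof (intro conjI allI impI)
    fix K assume K: "compact_Hausdorff_in X K"
    have "openin (subtopology X K) {x \<in> topspace (subtopology X K). f x \<in> S}"
      using f[OF K] S by (rule openin_continuous_map_preimage)
    moreover have "{x \<in> topspace (subtopology X K). f x \<in> S} = K \<inter> ?P"
      using K by (auto simp: compact_Hausdorff_in_def compactin_def)
    ultimately show "openin (subtopology X K) (K \<inter> ?P)" by simp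
  qed auto
  then show "openin X ?P" using X by (simp add: compactly_generated_def)
qed

lemma compact_Hausdorff_in_subtopology:
  assumes "compact_Hausdorff_in X K"
  shows "compact_space (subtopology X K)" "Hausdorff_space (subtopology X K)"
    "topspace (subtopology X K) = K"
  using assms by (auto simp: compact_Hausdorff_in_def compact_space_subtopology compactin_def)

section \<open>The compact-open topology and mapping spaces\<close>

lemma topspace_compact_open [simp]: "topspace (compact_open X Y) = cmaps X Y"
  by (auto simp: compact_open_def)

lemma openin_compact_open:
  assumes "compact_Hausdorff_in X K" "openin Y W"
  shows "openin (compact_open X Y) {f \<in> cmaps X Y. f ` K \<subseteq> W}"
  unfolding compact_open_def
  by (rule topology_generated_by_Basis) (use assms in blast)

text \<open>The tube lemma: an open set that contains \<open>{t} \<times> K\<close> with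
  \<open>K\<close> compact contains a tube around it, and the subbasic sets of the compact-open
  topology test just such \<open>K\<close>.\<close>

lemma continuous_map_curry:
  assumes f: "continuous_map (prod_topology T X) Y (\<lambda>(t, x). f t x)"
    and ext: "\<And>t. t \<in> topspace T \<Longrightarrow> f t \<in> extensional (topspace X)"
  shows "continuous_map T (compact_open X Y) f"
  unfolding compact_open_def
proof (rule continuous_on_generated_topo)
  have cm: "f t \<in> cmaps X Y" if t: "t \<in> topspace T" for t
  proof -
    have "continuous_map X (prod_topology T X) (\<lambda>x. (t, x))"
      by (intro continuous_map_pairedI) (use t in auto)
    then have "continuous_map X Y ((\<lambda>(t, x). f t x) \<circ> (\<lambda>x. (t, x)))"
      using f continuous_map_compose by blast
    then show ?thesis using ext[OF t] by (simp add: cmaps_def o_def)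
  qed
  then show "f ` topspace T \<subseteq> \<Union> (insert (cmaps X Y)
    {{f \<in> cmaps X Y. f ` K \<subseteq> W} | K W. compact_Hausdorff_in X K \<and> openin Y W})" by auto
  fix S assume "S \<in> insert (cmaps X Y)
    {{f \<in> cmaps X Y. f ` K \<subseteq> W} | K W. compact_Hausdorff_in X K \<and> openin Y W}"
  then consider "S = cmaps X Y"
    | K W where "compact_Hausdorff_in X K" "openin Y W" "S = {f \<in> cmaps X Y. f ` K \<subseteq> W}" by blast
  then show "openin T (f -` S \<inter> topspace T)"
  proof cases
    case 1
    then have "f -` S \<inter> topspace T = topspace T" using cm by auto
    then show ?thesis by simp
  next
    case 2
    let ?O = "{p \<in> topspace (prod_topology T X). (\<lambda>(t, x). f t x) p \<in> W}"
    have O: "openin (prod_topology T X) ?O"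
      using f 2(2) by (rule openin_continuous_map_preimage)
    have K: "compactin X K" using 2(1) by (simp add: compact_Hausdorff_in_def)
    show ?thesis
    proof (subst openin_subopen, intro ballI)
      fix t assume t: "t \<in> f -` S \<inter> topspace T"
      then have sub: "{t} \<times> K \<subseteq> ?O" and tT: "t \<in> topspace T"
        using 2(3) compactin_subset_topspace[OF K] by auto
      obtain A B where "openin T A \<and> openin X B \<and> t \<in> A \<and> K \<subseteq> B \<and> A \<times> B \<subseteq> ?O"
        using tube_lemma_right[OF O K tT sub] by (elim exE) (rule that)
      then have AB: "openin T A" "t \<in> A" "K \<subseteq> B" "A \<times> B \<subseteq> ?O" by simp_all
      have "A \<subseteq> f -` S \<inter> topspace T"
      proof
        fix a assume a: "a \<in> A"
        then have aT: "a \<in> topspace T" using openin_subset[OF AB(1)] by blast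
        have "f a x \<in> W" if "x \<in> K" for x
          using subsetD[OF AB(4), of "(a, x)"] AB(3) a that by auto
        then show "a \<in> f -` S \<inter> topspace T"
          using cm[OF aT] aT unfolding 2(3) by blast
      qed
      then show "\<exists>A. openin T A \<and> t \<in> A \<and> A \<subseteq> f -` S \<inter> topspace T"
        using AB by blast
    qed
  qed
qed

text \<open>The compact Hausdorff set \<open>L\<close> is regular, so the point \<open>u t\<close>
  has a closed neighbourhood \<open>N\<close> in \<open>L\<close> that \<open>h t\<close> maps into
  \<open>W\<close>. As \<open>N\<close> is compact Hausdorff, the maps that send \<open>N\<close>
  into \<open>W\<close> form an open set, and nearby arguments stay in \<open>N\<close>.\<close>

lemma continuous_map_eval:
  assumes h: "continuous_map T (compact_open X Y) h" and u: "continuous_map T X u"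
    and L: "compact_Hausdorff_in X L" "u ` topspace T \<subseteq> L"
  shows "continuous_map T Y (\<lambda>t. h t (u t))"
  unfolding continuous_map_def
proof (intro conjI allI impI)
  have hc: "h t \<in> cmaps X Y" if "t \<in> topspace T" for t
    using h that by (metis continuous_map_image_subset_topspace image_subset_iff topspace_compact_open)
  have uX: "u t \<in> topspace X" if "t \<in> topspace T" for t
    using u that by (metis continuous_map_image_subset_topspace image_subset_iff)
  show "(\<lambda>t. h t (u t)) \<in> topspace T \<rightarrow> topspace Y"
    using hc uX by (fastforce simp: cmaps_def continuous_map_def)
  fix W assume W: "openin Y W"
  let ?L = "subtopology X L"
  note LL = compact_Hausdorff_in_subtopology[OF L(1)]
  have LX: "L \<subseteq> topspace X" using LL(3) by auto
  show "openin T {t \<in> topspace T. h t (u t) \<in> W}"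
  proof (subst openin_subopen, intro ballI)
    fix t assume t: "t \<in> {t \<in> topspace T. h t (u t) \<in> W}"
    let ?P = "{x \<in> topspace ?L. h t x \<in> W}"
    have "continuous_map ?L Y (h t)"
      using hc t by (simp add: cmaps_def continuous_map_from_subtopology)
    then have "openin ?L ?P" using W by (rule openin_continuous_map_preimage)
    moreover have "u t \<in> ?P" using t L(2) LX by auto
    moreover have "neighbourhood_base_of (closedin ?L) ?L"
      using compact_Hausdorff_imp_regular_space LL neighbourhood_base_of_closedin by blast
    ultimately obtain M N where MN: "openin ?L M" "closedin ?L N" "u t \<in> M" "M \<subseteq> N" "N \<subseteq> ?P"
      unfolding neighbourhood_base_of by meson
    have NL: "N \<subseteq> L" using MN(5) by auto
    have "compactin ?L N" using LL(1) MN(2) closedin_compact_space by blast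
    then have "compactin X N" by (simp add: compactin_subtopology)
    moreover have "Hausdorff_space (subtopology X N)"
      using Hausdorff_space_subtopology[OF LL(2), of N] NL
      by (simp add: subtopology_subtopology inf.absorb2)
    ultimately have N: "compact_Hausdorff_in X N" by (simp add: compact_Hausdorff_in_def)
    let ?A = "{s \<in> topspace T. h s \<in> {f \<in> cmaps X Y. f ` N \<subseteq> W}}"
    let ?B = "{s \<in> topspace T. u s \<in> M}"
    have "openin T ?A"
      using h openin_compact_open[OF N W] by (rule openin_continuous_map_preimage)
    moreover have "continuous_map T ?L u"
      using u L(2) by (auto simp: continuous_map_in_subtopology)
    then have "openin T ?B" using MN(1) by (rule openin_continuous_map_preimage)
    ultimately have "openin T (?A \<inter> ?B)" by (rule openin_Int)
    moreover have "t \<in> ?A \<inter> ?B" using t MN hc by auto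
    moreover have "?A \<inter> ?B \<subseteq> {t \<in> topspace T. h t (u t) \<in> W}" using MN(4) by auto
    ultimately show "\<exists>A. openin T A \<and> t \<in> A \<and> A \<subseteq> {t \<in> topspace T. h t (u t) \<in> W}" by blast
  qed
qed

lemma continuous_map_eval_compact:
  assumes h: "continuous_map T (compact_open X Y) h" and u: "continuous_map T X u"
    and X: "compact_space X" "Hausdorff_space X"
  shows "continuous_map T Y (\<lambda>t. h t (u t))"
proof (rule continuous_map_eval[OF h u])
  show "compact_Hausdorff_in X (topspace X)"
    using X by (simp add: compact_Hausdorff_in_def compact_space_def)
  show "u ` topspace T \<subseteq> topspace X"
    using u by (rule continuous_map_image_subset_topspace)
qed

text \<open>Evaluation at a point is continuous, a point being compact Hausdorff. The compact-open
  topology is therefore finer than the one induced from a power of \<open>Y\<close>.\<close>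

lemma hausdorff_images_compact_open:
  assumes "hausdorff_images Y"
  shows "hausdorff_images (compact_open X Y)"
proof (rule hausdorff_images_injective[where f=id and Y="product_topology (\<lambda>_. Y) (topspace X)"])
  show "hausdorff_images (product_topology (\<lambda>_. Y) (topspace X))"
    using assms by (rule hausdorff_images_product)
  have "continuous_map (compact_open X Y) Y (\<lambda>f. f x)" if x: "x \<in> topspace X" for x
    by (rule continuous_map_eval[where h="\<lambda>f. f" and u="\<lambda>_. x" and X=X and L="{x}"])
      (use x in \<open>auto simp: compact_Hausdorff_in_singleton continuous_map_id[unfolded id_def]\<close>)
  then show "continuous_map (compact_open X Y) (product_topology (\<lambda>_. Y) (topspace X)) id"
    by (auto simp: continuous_map_componentwise cmaps_def)
qed auto

lemma hausdorff_images_Map: "hausdorff_images Y \<Longrightarrow> hausdorff_images (Map X Y)"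
  unfolding Map_def by (intro hausdorff_images_kify hausdorff_images_compact_open)

lemma hausdorff_images_Map_based:
  "hausdorff_images (fst Y) \<Longrightarrow> hausdorff_images (fst (Map_based X Y))"
  unfolding Map_based_def
  by (simp add: hausdorff_images_kify hausdorff_images_subtopology hausdorff_images_compact_open)

lemma topspace_Map [simp]: "topspace (Map X Y) = cmaps X Y"
  by (simp add: Map_def)

lemma topspace_Map_based:
  "topspace (fst (Map_based X Y)) = {f \<in> cmaps (fst X) (fst Y). f (snd X) = snd Y}"
  by (auto simp: Map_based_def)

lemma snd_Map_based: "snd (Map_based X Y) = const_map X Y"
  by (simp add: Map_based_def)

lemma continuous_map_into_Map:
  assumes "hausdorff_images Y" "compact_space K" "Hausdorff_space K"
    "continuous_map (prod_topology K X) Y (\<lambda>(t, x). f t x)"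
    "\<And>t. t \<in> topspace K \<Longrightarrow> f t \<in> extensional (topspace X)"
  shows "continuous_map K (Map X Y) f"
  unfolding Map_def
  by (intro continuous_map_into_kify continuous_map_curry hausdorff_images_compact_open assms)

lemma continuous_map_into_Map_based:
  assumes "hausdorff_images (fst Y)" "compact_space K" "Hausdorff_space K"
    "continuous_map (prod_topology K (fst X)) (fst Y) (\<lambda>(t, x). f t x)"
    "\<And>t. t \<in> topspace K \<Longrightarrow> f t \<in> extensional (topspace (fst X))"
    "\<And>t. t \<in> topspace K \<Longrightarrow> f t (snd X) = snd Y"
  shows "continuous_map K (fst (Map_based X Y)) f"
  unfolding Map_based_def fst_conv
proof (intro continuous_map_into_kify)
  show "continuous_map K (subtopology (compact_open (fst X) (fst Y)) {f. f (snd X) = snd Y}) f"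
    unfolding continuous_map_in_subtopology
    using continuous_map_curry[OF assms(4,5)] assms(6) by auto
qed (use assms in \<open>auto simp: hausdorff_images_subtopology hausdorff_images_compact_open\<close>)

lemma continuous_map_from_Map:
  "continuous_map T (Map X Y) h \<Longrightarrow> continuous_map T (compact_open X Y) h"
  unfolding Map_def by (rule continuous_map_kifyD)

lemma continuous_map_from_Map_based:
  assumes "continuous_map T (fst (Map_based X Y)) h"
  shows "continuous_map T (compact_open (fst X) (fst Y)) h"
  using assms continuous_map_kifyD continuous_map_into_fulltopology
  unfolding Map_based_def fst_conv by blast

subsection \<open>Homeomorphisms are weak equivalences\<close>

lemma equiv_cube_homotopy: "equiv (cube_maps k X x) (cube_homotopy k X x)"
proof (rule equivI)
  show "cube_homotopy k X x \<subseteq> cube_maps k X x \<times> cube_maps k X x"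
    by (auto simp: cube_homotopy_def)
  show "refl_on (cube_maps k X x) (cube_homotopy k X x)"
    by (auto simp: refl_on_def cube_homotopy_def cube_maps_def)
  show "sym (cube_homotopy k X x)"
    by (auto simp: sym_def cube_homotopy_def homotopic_with_symD)
  show "trans (cube_homotopy k X x)"
    unfolding trans_def cube_homotopy_def by (blast intro: homotopic_with_trans)
qed

lemma cube_maps_compose:
  "continuous_map X Y f \<Longrightarrow> g \<in> cube_maps k X x \<Longrightarrow> f \<circ> g \<in> cube_maps k Y (f x)"
  by (auto simp: cube_maps_def intro: continuous_map_compose)

lemma cube_homotopy_compose:
  assumes "continuous_map X Y f" "(g, h) \<in> cube_homotopy k X x"
  shows "(f \<circ> g, f \<circ> h) \<in> cube_homotopy k Y (f x)"
proof -
  have "homotopic_with (\<lambda>g. \<forall>t\<in>cube_boundary k. g t = f x) (top_of_set (cube k)) Y (f \<circ> g) (f \<circ> h)"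
    by (rule homotopic_with_compose_continuous_map_left[where p="\<lambda>g. \<forall>t\<in>cube_boundary k. g t = x" and ?X2.0=X])
      (use assms in \<open>auto simp: cube_homotopy_def\<close>)
  then show ?thesis
    using assms cube_maps_compose by (auto simp: cube_homotopy_def)
qed

lemma homotopy_group_map_class:
  assumes f: "continuous_map X Y f" and g: "g \<in> cube_maps k X x"
  shows "homotopy_group_map k Y f x (cube_homotopy k X x `` {g}) = cube_homotopy k Y (f x) `` {f \<circ> g}"
proof -
  let ?R = "cube_homotopy k X x" and ?S = "cube_homotopy k Y (f x)"
  have tr: "trans ?S" by (meson equivE equiv_cube_homotopy)
  have "(g, g) \<in> ?R" using g by (meson equivE equiv_cube_homotopy refl_onD)
  moreover have "(f \<circ> g, f \<circ> g') \<in> ?S" if "(g, g') \<in> ?R" for g'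
    using cube_homotopy_compose[OF f that] .
  ultimately show ?thesis
    unfolding homotopy_group_map_def using tr by (auto dest: transD)
qed

lemma homeomorphic_maps_weak_homotopy_equivalence:
  assumes f: "continuous_map X Y f" and g: "continuous_map Y X g"
    and gf: "\<And>x. x \<in> topspace X \<Longrightarrow> g (f x) = x" and fg: "\<And>y. y \<in> topspace Y \<Longrightarrow> f (g y) = y"
  shows "weak_homotopy_equivalence X Y f"
  unfolding weak_homotopy_equivalence_def
proof (intro conjI allI ballI impI f)
  show "topspace Y = {}" if "topspace X = {}"
    using continuous_map_image_subset_topspace[OF g] that by simp
  fix k x assume x: "x \<in> topspace X"
  \<comment> \<open>Stated for an arbitrary pair of spaces so that it serves in both
    directions.\<close>
  have inv: "homotopy_group_map k Z h' y' (homotopy_group_map k Z' h y c) = c"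
    "homotopy_group_map k Z' h y c \<in> homotopy_group k Z' (h y)"
    if c: "c \<in> homotopy_group k Z y" and h: "continuous_map Z Z' h" "continuous_map Z' Z h'"
      and hh: "\<And>z. z \<in> topspace Z \<Longrightarrow> h' (h z) = z" and y: "h y = y'" "y \<in> topspace Z"
    for Z :: "'z topology" and Z' :: "'w topology" and h h' y y' c
  proof -
    obtain u where u: "u \<in> cube_maps k Z y" "c = cube_homotopy k Z y `` {u}"
      using c unfolding homotopy_group_def by (rule quotientE)
    have hu: "h \<circ> u \<in> cube_maps k Z' y'" using cube_maps_compose[OF h(1) u(1)] y by simp
    have hc: "homotopy_group_map k Z' h y c = cube_homotopy k Z' y' `` {h \<circ> u}"
      using homotopy_group_map_class[OF h(1) u(1)] u(2) y by simp
    then show "homotopy_group_map k Z' h y c \<in> homotopy_group k Z' (h y)"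
      using hu y by (simp add: homotopy_group_def quotientI)
    have y'': "h' y' = y" using hh y by auto
    have huu: "h' \<circ> (h \<circ> u) \<in> cube_maps k Z y" using cube_maps_compose[OF h(2) hu] y'' by simp
    \<comment> \<open>The two maps agree on the cube, but cube maps are not extensional and may
      differ off it; their classes are identified by a homotopy instead of an equality of
      functions.\<close>
    have "homotopic_with (\<lambda>f. \<forall>t\<in>cube_boundary k. f t = y) (top_of_set (cube k)) Z u (h' \<circ> (h \<circ> u))"
    proof (rule homotopic_with_equal)
      show "continuous_map (top_of_set (cube k)) Z u" using u(1) by (simp add: cube_maps_def)
      then show "u t = (h' \<circ> (h \<circ> u)) t" if "t \<in> topspace (top_of_set (cube k))" for t
        using that hh[of "u t"] by (auto simp: continuous_map_def Pi_def)
    qed (use u(1) huu in \<open>auto simp: cube_maps_def\<close>)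
    then have "(u, h' \<circ> (h \<circ> u)) \<in> cube_homotopy k Z y"
      using u(1) huu by (simp add: cube_homotopy_def)
    then have "cube_homotopy k Z y `` {h' \<circ> (h \<circ> u)} = c"
      using equiv_class_eq[OF equiv_cube_homotopy] u(2) by metis
    then show "homotopy_group_map k Z h' y' (homotopy_group_map k Z' h y c) = c"
      unfolding hc using homotopy_group_map_class[OF h(2) hu] y'' by simp
  qed
  have fx: "f x \<in> topspace Y" using f x by (auto simp: continuous_map_def)
  show "bij_betw (homotopy_group_map k Y f x) (homotopy_group k X x) (homotopy_group k Y (f x))"
    by (rule bij_betw_byWitness[where f'="homotopy_group_map k X g (f x)"])
      (use inv[OF _ f g gf refl x] inv[OF _ g f fg gf[OF x] fx] gf[OF x] in auto)
qed

subsection \<open>Linear algebra in \<open>\<complex>\<^sup>\<infinity>\<close>\<close>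

lemma sum_fun_apply: "(\<Sum>b\<in>B. f b) i = (\<Sum>b\<in>B. f b i)" for f :: "'b \<Rightarrow> 'i \<Rightarrow> 'c::comm_monoid_add"
  by (induction B rule: infinite_finite_induct) auto

text \<open>The norm is kept squared because the square is additive on orthogonal sums, which makes
  the weights of jets multiplicative under composition.\<close>

definition nsq :: "cvec \<Rightarrow> real"
  where "nsq v = Re (cinner v v)"

text \<open>The definition sums over the support of \<open>u\<close>, which varies with
  \<open>u\<close>. A fixed range of summation is what linearity and, later, continuity in the
  coordinates require.\<close>

lemma cinner_eq_sum:
  assumes "\<And>i. i \<ge> N \<Longrightarrow> u i = 0"
  shows "cinner u v = (\<Sum>i<N. u i * cnj (v i))"
  unfolding cinner_def
proof (rule sum.mono_neutral_left)
  show "{i. u i \<noteq> 0} \<subseteq> {..<N}" using assms by (auto simp: not_less[symmetric])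
qed auto

lemma C_infinity_bound: "v \<in> C_infinity \<Longrightarrow> \<exists>N. \<forall>i\<ge>N. v i = 0"
  unfolding C_infinity_def mem_Collect_eq
  by (metis (mono_tags, lifting) finite_nat_set_iff_bounded mem_Collect_eq not_less)

lemma C_infinity_bound2:
  assumes "u \<in> C_infinity" "v \<in> C_infinity"
  obtains N where "\<And>i. i \<ge> N \<Longrightarrow> u i = 0" "\<And>i. i \<ge> N \<Longrightarrow> v i = 0"
proof -
  obtain M N where "\<forall>i\<ge>M. u i = 0" "\<forall>i\<ge>N. v i = 0"
    using C_infinity_bound assms by meson
  then show ?thesis using that[of "max M N"] by simp
qed

lemma C_infinity_add: "u \<in> C_infinity \<Longrightarrow> v \<in> C_infinity \<Longrightarrow> u + v \<in> C_infinity"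
  unfolding C_infinity_def mem_Collect_eq
  by (rule finite_subset[of _ "{i. u i \<noteq> 0} \<union> {i. v i \<noteq> 0}"]) auto

lemma C_infinity_scale: "u \<in> C_infinity \<Longrightarrow> cscale c u \<in> C_infinity"
  unfolding C_infinity_def mem_Collect_eq cscale_def
  by (rule finite_subset[of _ "{i. u i \<noteq> 0}"]) auto

lemma C_infinity_zero: "0 \<in> C_infinity"
  by (simp add: C_infinity_def)

lemma cinner_add_left:
  assumes "u \<in> C_infinity" "v \<in> C_infinity"
  shows "cinner (u + v) w = cinner u w + cinner v w"
proof -
  obtain N where N: "\<And>i. i \<ge> N \<Longrightarrow> u i = 0" "\<And>i. i \<ge> N \<Longrightarrow> v i = 0"
    using C_infinity_bound2[OF assms] by blast
  have "cinner (u + v) w = (\<Sum>i<N. (u + v) i * cnj (w i))"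
    by (rule cinner_eq_sum) (simp add: N)
  then show ?thesis
    using cinner_eq_sum[of N u w] cinner_eq_sum[of N v w] N by (simp add: algebra_simps sum.distrib)
qed

lemma cinner_scale_left: "u \<in> C_infinity \<Longrightarrow> cinner (cscale c u) w = c * cinner u w"
proof -
  assume "u \<in> C_infinity"
  then obtain N where N: "\<And>i. i \<ge> N \<Longrightarrow> u i = 0" using C_infinity_bound by blast
  have "cinner (cscale c u) w = (\<Sum>i<N. cscale c u i * cnj (w i))"
    by (rule cinner_eq_sum) (simp add: N cscale_def)
  then show ?thesis
    using cinner_eq_sum[of N u w] N by (simp add: cscale_def sum_distrib_left mult.assoc)
qed

lemma cinner_commute:
  assumes "u \<in> C_infinity" "v \<in> C_infinity"
  shows "cinner v u = cnj (cinner u v)"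
proof -
  obtain N where N: "\<And>i. i \<ge> N \<Longrightarrow> u i = 0" "\<And>i. i \<ge> N \<Longrightarrow> v i = 0"
    using C_infinity_bound2[OF assms] by blast
  show ?thesis
    using cinner_eq_sum[of N u v] cinner_eq_sum[of N v u] N by (simp add: mult.commute)
qed

lemma cinner_add_right:
  "u \<in> C_infinity \<Longrightarrow> v \<in> C_infinity \<Longrightarrow> w \<in> C_infinity \<Longrightarrow> cinner w (u + v) = cinner w u + cinner w v"
  using cinner_commute C_infinity_add cinner_add_left by (metis complex_cnj_add)

lemma cinner_scale_right:
  "u \<in> C_infinity \<Longrightarrow> w \<in> C_infinity \<Longrightarrow> cinner w (cscale c u) = cnj c * cinner w u"
  using cinner_commute C_infinity_scale cinner_scale_left by (metis complex_cnj_mult)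

lemmas cinner_linear = cinner_add_left cinner_add_right cinner_scale_left cinner_scale_right
  C_infinity_add C_infinity_scale

lemma cinner_zero [simp]: "cinner 0 w = 0" "cinner w 0 = 0"
  by (simp_all add: cinner_def)

lemma C_infinity_sum: "(\<And>b. b \<in> B \<Longrightarrow> f b \<in> C_infinity) \<Longrightarrow> (\<Sum>b\<in>B. f b) \<in> C_infinity"
  by (induction B rule: infinite_finite_induct) (auto simp: C_infinity_zero C_infinity_add)

lemma cinner_sum_left:
  assumes "\<And>b. b \<in> B \<Longrightarrow> f b \<in> C_infinity"
  shows "cinner (\<Sum>b\<in>B. f b) w = (\<Sum>b\<in>B. cinner (f b) w)"
  using assms
  by (induction B rule: infinite_finite_induct) (auto simp: C_infinity_sum cinner_add_left)

lemma nsq_eq_sum: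
  assumes "\<And>i. i \<ge> N \<Longrightarrow> u i = 0"
  shows "nsq u = (\<Sum>i<N. (cmod (u i))\<^sup>2)"
  unfolding nsq_def by (subst cinner_eq_sum[of N])
    (use assms in \<open>auto simp: complex_mult_cnj cmod_power2\<close>)

lemma nsq_nonneg: "0 \<le> nsq u"
  unfolding nsq_def cinner_def by (auto intro!: sum_nonneg)

lemma nsq_coordinate: "u \<in> C_infinity \<Longrightarrow> (cmod (u i))\<^sup>2 \<le> nsq u"
proof -
  assume "u \<in> C_infinity"
  then obtain N where "\<And>i. i \<ge> N \<Longrightarrow> u i = 0" using C_infinity_bound by blast
  then have "nsq u = (\<Sum>j<max N (Suc i). (cmod (u j))\<^sup>2)"
    by (intro nsq_eq_sum) auto
  then show ?thesis
    using member_le_sum[of i "{..<max N (Suc i)}" "\<lambda>j. (cmod (u j))\<^sup>2"] by auto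
qed

lemma cinner_self:
  assumes "u \<in> C_infinity"
  shows "cinner u u = of_real (nsq u)"
  using cinner_commute[OF assms assms] by (simp add: nsq_def complex_eq_iff)

lemma nsq_eq_0: "u \<in> C_infinity \<Longrightarrow> nsq u = 0 \<longleftrightarrow> u = 0"
  using nsq_coordinate[of u] by (auto simp: fun_eq_iff) (simp add: nsq_def cinner_def)

lemma nsq_zero [simp]: "nsq 0 = 0"
  by (simp add: nsq_def)

lemma nsq_add:
  assumes "u \<in> C_infinity" "v \<in> C_infinity" "cinner u v = 0"
  shows "nsq (u + v) = nsq u + nsq v"
  using assms cinner_commute[of u v]
  by (simp add: nsq_def cinner_add_left cinner_add_right C_infinity_add)

lemma nsq_scale: "u \<in> C_infinity \<Longrightarrow> nsq (cscale c u) = (cmod c)\<^sup>2 * nsq u"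
proof -
  assume u: "u \<in> C_infinity"
  then have "cinner (cscale c u) (cscale c u) = (c * cnj c) * cinner u u"
    by (simp add: cinner_scale_left cinner_scale_right C_infinity_scale)
  then show ?thesis
    unfolding nsq_def using cinner_self[OF u] by (simp add: complex_mult_cnj cmod_power2)
qed

section \<open>Objects of the category and isometries between them\<close>

lemma J_objectsD:
  assumes "U \<in> J_objects"
  shows "cvec.subspace U" "U \<subseteq> C_infinity"
  using assms by (auto simp: J_objects_def)

lemma J_objects_zero: "U \<in> J_objects \<Longrightarrow> 0 \<in> U"
  using J_objectsD cvec.subspace_0 by blast

lemma J_objects_add: "U \<in> J_objects \<Longrightarrow> u \<in> U \<Longrightarrow> v \<in> U \<Longrightarrow> u + v \<in> U"
  using J_objectsD cvec.subspace_add by blast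

lemma J_objects_scale: "U \<in> J_objects \<Longrightarrow> u \<in> U \<Longrightarrow> cscale c u \<in> U"
  using J_objectsD cvec.subspace_scale by blast

lemma J_objects_sum: "U \<in> J_objects \<Longrightarrow> (\<And>b. b \<in> B \<Longrightarrow> f b \<in> U) \<Longrightarrow> (\<Sum>b\<in>B. f b) \<in> U"
  using J_objectsD cvec.subspace_sum by blast

lemma J_objects_bound:
  assumes "U \<in> J_objects"
  obtains N where "\<And>u i. u \<in> U \<Longrightarrow> i \<ge> N \<Longrightarrow> u i = 0"
proof -
  obtain B where B: "finite B" "U = cvec.span B" using assms by (auto simp: J_objects_def)
  have "B \<subseteq> C_infinity" using B(2) J_objectsD(2)[OF assms] cvec.span_superset by blast
  then have "\<forall>b\<in>B. \<exists>N. \<forall>i\<ge>N. b i = 0" using C_infinity_bound by blast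
  then obtain N where N: "\<And>b i. b \<in> B \<Longrightarrow> i \<ge> N b \<Longrightarrow> b i = 0" by metis
  define M where "M = Max (insert 0 (N ` B))"
  have "B \<subseteq> {v. \<forall>i\<ge>M. v i = 0}"
  proof (intro subsetI CollectI allI impI)
    fix b i assume "b \<in> B" "M \<le> i"
    moreover from \<open>b \<in> B\<close> have "N b \<le> M" unfolding M_def using B(1) by (intro Max_ge) auto
    ultimately show "b i = 0" using N by simp
  qed
  moreover have "cvec.subspace {v. \<forall>i\<ge>M. v i = 0}"
    by (auto simp: cvec.subspace_def cscale_def)
  ultimately have "U \<subseteq> {v. \<forall>i\<ge>M. v i = 0}"
    unfolding B(2) by (rule cvec.span_minimal)
  then show ?thesis using that[of M] by blast
qed

text \<open>Gram-Schmidt, of which only the expansion formula is recorded. The formula expresses an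
  isometry through its values on finitely many vectors and exhibits the subspace as a closed
  set.\<close>

lemma J_objects_basis:
  assumes "U \<in> J_objects"
  obtains B where "finite B" "B \<subseteq> U" "\<And>u. u \<in> U \<Longrightarrow> u = (\<Sum>b\<in>B. cscale (cinner u b) b)"
proof -
  have "\<exists>B. finite B \<and> B \<subseteq> cvec.span S \<and> (\<forall>u\<in>cvec.span S. u = (\<Sum>b\<in>B. cscale (cinner u b) b))"
    if "finite S" "S \<subseteq> C_infinity" for S
    using that
  proof (induction S rule: finite_induct)
    case empty
    then show ?case by (intro exI[of _ "{}"]) auto
  next
    case (insert v S)
    have "cvec.subspace C_infinity"
      by (auto simp: cvec.subspace_def C_infinity_zero C_infinity_add C_infinity_scale)
    then have spanC: "cvec.span T \<subseteq> C_infinity" if "T \<subseteq> C_infinity" for T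
      using that cvec.span_minimal by blast
    obtain B where B: "finite B" "B \<subseteq> cvec.span S"
      "\<And>u. u \<in> cvec.span S \<Longrightarrow> u = (\<Sum>b\<in>B. cscale (cinner u b) b)"
      using insert by auto
    have SC: "cvec.span S \<subseteq> C_infinity" using spanC insert.prems by simp
    have BC: "b \<in> C_infinity" if "b \<in> B" for b using B(2) SC that by blast
    have vC: "v \<in> C_infinity" using insert.prems by simp
    define p where "p = (\<Sum>b\<in>B. cscale (cinner v b) b)"
    have p: "p \<in> cvec.span S"
      unfolding p_def using B(2) by (intro cvec.span_sum cvec.span_scale) auto
    then have pC: "p \<in> C_infinity" using SC by blast
    define r where "r = v - p"
    have v: "v = p + r" by (simp add: r_def)
    have "r = v + cscale (-1) p" by (simp add: r_def cscale_def fun_eq_iff)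
    then have rC: "r \<in> C_infinity" using C_infinity_add[OF vC C_infinity_scale[OF pC, of "-1"]] by simp
    \<comment> \<open>Orthonormality of \<open>B\<close> is not part of the induction hypothesis; in
      its place \<open>b\<close> itself is expanded in \<open>B\<close>, which yields that
      \<open>v\<close> and its projection \<open>p\<close> have the same inner product with
      \<open>b\<close>.\<close>
    have rb: "cinner r b = 0" if b: "b \<in> B" for b
    proof -
      have "cinner v b = cnj (cinner b v)" using cinner_commute vC BC[OF b] by blast
      also have "cinner b v = cinner (\<Sum>b'\<in>B. cscale (cinner b b') b') v"
        using B(2,3) b by (metis subsetD)
      also have "\<dots> = (\<Sum>b'\<in>B. cinner b b' * cinner b' v)"
        by (subst cinner_sum_left) (auto simp: C_infinity_scale BC cinner_scale_left)
      also have "cnj \<dots> = (\<Sum>b'\<in>B. cinner v b' * cinner b' b)"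
        by (auto simp: mult.commute cinner_commute[OF BC[OF b] BC] cinner_commute[OF BC vC]
            intro!: sum.cong)
      also have "\<dots> = cinner p b"
        unfolding p_def by (subst cinner_sum_left) (auto simp: C_infinity_scale BC cinner_scale_left)
      finally have "cinner v b = cinner p b" .
      moreover have "cinner v b = cinner p b + cinner r b"
        by (subst v) (rule cinner_add_left[OF pC rC])
      ultimately show ?thesis by simp
    qed
    have sr: "cinner s r = 0" if s: "s \<in> cvec.span S" for s
    proof -
      have "cinner s r = (\<Sum>b\<in>B. cinner s b * cinner b r)"
        by (subst B(3)[OF s], subst cinner_sum_left)
          (auto simp: C_infinity_scale BC cinner_scale_left)
      also have "\<dots> = 0"
        by (intro sum.neutral ballI) (simp add: cinner_commute[OF rC BC] rb)
      finally show ?thesis .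
    qed
    show ?case
    proof (cases "r = 0")
      case True
      then have "v \<in> cvec.span S" using v p by simp
      then have "cvec.span (insert v S) = cvec.span S" by (rule cvec.span_redundant)
      then show ?thesis using B by auto
    next
      case False
      define c where "c = complex_of_real (1 / sqrt (nsq r))"
      have pos: "nsq r > 0" using False nsq_eq_0[OF rC] nsq_nonneg[of r] by simp
      define e where "e = cscale c r"
      have eC: "e \<in> C_infinity" unfolding e_def using rC by (rule C_infinity_scale)
      have c0: "c \<noteq> 0" "cnj c = c" using pos by (auto simp: c_def)
      have "nsq e = 1" unfolding e_def nsq_scale[OF rC] using pos
        by (simp add: c_def norm_divide power_divide)
      then have ee: "cinner e e = 1" using cinner_self[OF eC] by simp
      have re: "r = cscale (1 / c) e" using c0 by (simp add: e_def)
      have eS: "e \<in> cvec.span (insert v S)"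
      proof -
        have "p \<in> cvec.span (insert v S)" using p cvec.span_mono by blast
        then have "r \<in> cvec.span (insert v S)"
          unfolding r_def by (intro cvec.span_diff) (auto intro: cvec.span_base)
        then show ?thesis unfolding e_def by (rule cvec.span_scale)
      qed
      have se: "cinner s e = 0" if "s \<in> cvec.span S" for s
        unfolding e_def using sr[OF that] that SC by (subst cinner_scale_right) (auto simp: rC)
      have eb: "cinner e b = 0" if "b \<in> B" for b
        unfolding e_def using rb[OF that] by (simp add: cinner_scale_left rC)
      have "e \<notin> B" using eb ee by auto
      show ?thesis
      proof (intro exI[of _ "insert e B"] conjI ballI)
        show "finite (insert e B)" using B(1) by simp
        show "insert e B \<subseteq> cvec.span (insert v S)"
          using eS B(2) cvec.span_mono[of S "insert v S"] by blast
        fix u assume "u \<in> cvec.span (insert v S)"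
        then obtain k where "u - cscale k v \<in> cvec.span S" unfolding cvec.span_insert by blast
        then have "u - cscale k v + cscale k p \<in> cvec.span S"
          using p by (intro cvec.span_add cvec.span_scale)
        moreover define s where "s = u - cscale k v + cscale k p"
        ultimately have s: "s \<in> cvec.span S" by simp
        define d where "d = k / c"
        have u: "u = s + cscale d e"
          unfolding s_def d_def e_def r_def using c0
          by (simp add: fun_eq_iff cscale_def algebra_simps)
        have sC: "s \<in> C_infinity" using s SC by blast
        have "cinner u e = d"
          unfolding u using se[OF s] ee by (simp add: cinner_linear sC eC)
        moreover have "cinner u b = cinner s b" if "b \<in> B" for b
          unfolding u using eb[OF that] by (simp add: cinner_linear sC eC)
        ultimately show "u = (\<Sum>b\<in>insert e B. cscale (cinner u b) b)"
          using B(1) \<open>e \<notin> B\<close> B(3)[OF s] u by (simp add: add.commute)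
      qed
    qed
  qed
  moreover obtain S where "finite S" "U = cvec.span S" using assms by (auto simp: J_objects_def)
  moreover from this have "S \<subseteq> C_infinity" using J_objectsD(2)[OF assms] cvec.span_superset by blast
  ultimately show ?thesis using that by metis
qed

context
  fixes U V f
  assumes U: "U \<in> J_objects" and V: "V \<in> J_objects" and f: "f \<in> isometries U V"
begin

lemma isometry_in: "u \<in> U \<Longrightarrow> f u \<in> V"
  using f by (simp add: isometries_def)

lemma isometry_C: "u \<in> U \<Longrightarrow> f u \<in> C_infinity"
  using isometry_in J_objectsD(2)[OF V] by blast

lemma isometry_add: "u \<in> U \<Longrightarrow> v \<in> U \<Longrightarrow> f (u + v) = f u + f v"
  using f by (simp add: isometries_def)

lemma isometry_scale: "u \<in> U \<Longrightarrow> f (cscale c u) = cscale c (f u)"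
  using f by (simp add: isometries_def)

lemma isometry_cinner: "u \<in> U \<Longrightarrow> v \<in> U \<Longrightarrow> cinner (f u) (f v) = cinner u v"
  using f by (simp add: isometries_def)

lemma isometry_nsq: "u \<in> U \<Longrightarrow> nsq (f u) = nsq u"
  by (simp add: nsq_def isometry_cinner)

lemma isometry_outside: "u \<notin> U \<Longrightarrow> f u = 0"
  using f by (simp add: isometries_def)

lemma isometry_zero: "f 0 = 0"
  using isometry_scale[of 0 0] J_objects_zero[OF U] by simp

lemma isometry_sum: "(\<And>b. b \<in> B \<Longrightarrow> g b \<in> U) \<Longrightarrow> f (\<Sum>b\<in>B. g b) = (\<Sum>b\<in>B. f (g b))"
  by (induction B rule: infinite_finite_induct)
    (auto simp: isometry_zero isometry_add J_objects_sum[OF U])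

lemma isometry_inj: "inj_on f U"
proof (rule inj_onI)
  fix u v assume uv: "u \<in> U" "v \<in> U" "f u = f v"
  define w where "w = u + cscale (-1) v"
  have w: "w \<in> U" unfolding w_def using uv by (intro J_objects_add J_objects_scale U)
  have "f w = f u + cscale (-1) (f v)"
    unfolding w_def
    using isometry_add[OF uv(1) J_objects_scale[OF U uv(2), of "-1"]] isometry_scale[OF uv(2), of "-1"]
    by simp
  also have "\<dots> = 0" using uv(3) by (simp add: cscale_def fun_eq_iff del: add_uminus_conv_diff)
  finally have "nsq w = 0" using isometry_nsq[OF w] by simp
  then have "w = 0" using nsq_eq_0 J_objectsD(2)[OF U] w by blast
  then show "u = v" by (simp add: w_def cscale_def fun_eq_iff)
qed

end

subsection \<open>The topology of the jet categories\<close>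

lemma compact_space_one_point_compactification:
  "compact_space (one_point_compactification X)"
  unfolding compact_space_def compactin_def
proof (intro conjI allI impI)
  let ?Z = "one_point_compactification X"
  fix \<U> assume \<U>: "Ball \<U> (openin ?Z) \<and> topspace ?Z \<subseteq> \<Union>\<U>"
  then obtain S where S: "S \<in> \<U>" "None \<in> S" by auto
  define C where "C = topspace X - Some -` S"
  have C: "compactin X C"
    using \<U> S unfolding C_def openin_one_point_compactification by blast
  have "\<forall>T\<in>(\<lambda>T. Some -` T) ` \<U>. openin X T"
    using \<U> unfolding openin_one_point_compactification by blast
  moreover have "C \<subseteq> \<Union>((\<lambda>T. Some -` T) ` \<U>)"
  proof
    fix x assume "x \<in> C"
    then have "Some x \<in> topspace ?Z" by (simp add: C_def)
    then have "Some x \<in> \<Union>\<U>" using \<U> by blast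
    then show "x \<in> \<Union>((\<lambda>T. Some -` T) ` \<U>)" by blast
  qed
  ultimately obtain \<F> where "finite \<F>" "\<F> \<subseteq> (\<lambda>T. Some -` T) ` \<U>" "C \<subseteq> \<Union>\<F>"
    using C unfolding compactin_def by meson
  then obtain \<G> where \<G>: "finite \<G>" "\<G> \<subseteq> \<U>" "C \<subseteq> \<Union>((\<lambda>T. Some -` T) ` \<G>)"
    by (metis finite_subset_image)
  have "topspace ?Z \<subseteq> \<Union>(insert S \<G>)"
  proof
    fix z assume z: "z \<in> topspace ?Z"
    show "z \<in> \<Union>(insert S \<G>)"
    proof (cases z)
      case None
      then show ?thesis using S by simp
    next
      case (Some x)
      then show ?thesis using z \<G>(3) C_def by (cases "Some x \<in> S") auto
    qed
  qed
  then show "\<exists>\<F>. finite \<F> \<and> \<F> \<subseteq> \<U> \<and> topspace ?Z \<subseteq> \<Union>\<F>"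
    using \<G> S by (intro exI[of _ "insert S \<G>"]) auto
qed auto

text \<open>Where \<open>c\<close> has norm at least \<epsilon>, the bound and
  \<open>\<sigma> p / 2 \<le> exp (\<sigma> p / 2)\<close> confine \<sigma> to a sublevel set, which
  is compact. The rate 1/2 is what is left of a weight \<open>exp (- \<sigma> p)\<close> after a
  coordinate of growth \<open>exp (\<sigma> p / 2)\<close> has used up the other half.\<close>

lemma continuous_map_from_one_point_compactification:
  fixes c :: "'p \<Rightarrow> 'b::real_normed_vector"
  assumes D: "\<And>R. compactin X {p \<in> topspace X. \<sigma> p \<le> R}"
    and c: "continuous_map X euclidean c"
    and bound: "\<And>p. p \<in> topspace X \<Longrightarrow> norm (c p) \<le> M * exp (- \<sigma> p / 2)"
  shows "continuous_map (one_point_compactification X) euclidean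
    (\<lambda>\<xi>. case \<xi> of None \<Rightarrow> 0 | Some p \<Rightarrow> c p)"
    (is "continuous_map ?Z _ ?h")
  unfolding continuous_map_def
proof (intro conjI allI impI)
  fix S :: "'b set" assume "openin euclidean S"
  then have S: "open S" by simp
  let ?P = "{\<xi> \<in> topspace ?Z. ?h \<xi> \<in> S}"
  have v: "Some -` ?P = {x \<in> topspace X. c x \<in> S}" by auto
  have op: "openin X {x \<in> topspace X. c x \<in> S}"
    using c \<open>openin euclidean S\<close> by (rule openin_continuous_map_preimage)
  have "compactin X (topspace X - Some -` ?P)" if "None \<in> ?P"
  proof -
    have "0 \<in> S" using that by simp
    then obtain \<epsilon> where \<epsilon>: "\<epsilon> > 0" "ball 0 \<epsilon> \<subseteq> S"
      using S open_contains_ball by blast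
    have "topspace X - Some -` ?P \<subseteq> {p \<in> topspace X. \<sigma> p \<le> 2 * \<bar>M\<bar> / \<epsilon>}"
    proof (intro subsetI CollectI conjI)
      fix p assume p: "p \<in> topspace X - Some -` ?P"
      then show "p \<in> topspace X" by simp
      have "c p \<notin> ball 0 \<epsilon>" using p v \<epsilon>(2) by auto
      then have "\<epsilon> \<le> norm (c p)" by simp
      also have "\<dots> \<le> \<bar>M\<bar> * exp (- \<sigma> p / 2)"
        using bound[of p] p by (smt (verit) Diff_iff exp_ge_zero mult_right_mono)
      also have "\<dots> = \<bar>M\<bar> / exp (\<sigma> p / 2)" by (simp add: exp_minus field_simps)
      finally have "\<epsilon> * exp (\<sigma> p / 2) \<le> \<bar>M\<bar>" by (simp add: field_simps)
      moreover have "\<epsilon> * (\<sigma> p / 2) \<le> \<epsilon> * exp (\<sigma> p / 2)"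
        using exp_ge_add_one_self[of "\<sigma> p / 2"] \<epsilon>(1) by (intro mult_left_mono) linarith+
      ultimately have "\<epsilon> * (\<sigma> p / 2) \<le> \<bar>M\<bar>" by linarith
      then show "\<sigma> p \<le> 2 * \<bar>M\<bar> / \<epsilon>" using \<epsilon>(1) by (simp add: field_simps)
    qed
    moreover have "closedin X (topspace X - Some -` ?P)" unfolding v using op by blast
    ultimately show ?thesis using closed_compactin[OF D] by blast
  qed
  then show "openin ?Z ?P"
    unfolding openin_one_point_compactification v using op v by auto
qed auto

section \<open>Closed and compact subsets of the bundles \<open>gamma n U V\<close>\<close>

lemma compact_PiE_UNIV:
  fixes S :: "'i \<Rightarrow> 'b::topological_space set"
  assumes "\<And>i. compact (S i)"
  shows "compact (PiE UNIV S)"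
proof -
  have "compactin (product_topology (\<lambda>i. euclidean) UNIV) (PiE UNIV S)"
    unfolding compactin_PiE using assms by simp
  then show ?thesis by (simp add: euclidean_product_topology)
qed

text \<open>The subspace is the fixed set of the projection given by its basis. With inner products
  truncated at \<open>N\<close>, being fixed is a family of closed equations in the
  coordinates.\<close>

lemma closed_J_object:
  assumes "W \<in> J_objects"
  shows "closed W"
proof -
  obtain N where N: "\<And>u i. u \<in> W \<Longrightarrow> i \<ge> N \<Longrightarrow> u i = 0" using J_objects_bound[OF assms] by blast
  obtain B where B: "finite B" "B \<subseteq> W" "\<And>u. u \<in> W \<Longrightarrow> u = (\<Sum>b\<in>B. cscale (cinner u b) b)"
    using J_objects_basis[OF assms] by blast
  have "W = {v. (\<forall>i. i \<ge> N \<longrightarrow> v i = 0) \<and> (\<forall>i. v i = (\<Sum>b\<in>B. (\<Sum>j<N. v j * cnj (b j)) * b i))}"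
    (is "W = ?R")
  proof (intro set_eqI iffI)
    fix v assume v: "v \<in> W"
    then have "cinner v b = (\<Sum>j<N. v j * cnj (b j))" for b
      by (intro cinner_eq_sum N)
    then have "v = (\<Sum>b\<in>B. cscale (\<Sum>j<N. v j * cnj (b j)) b)" using B(3)[OF v] by simp
    moreover have "(\<Sum>b\<in>B. cscale (\<Sum>j<N. v j * cnj (b j)) b) i =
      (\<Sum>b\<in>B. (\<Sum>j<N. v j * cnj (b j)) * b i)" for i
      by (simp only: sum_fun_apply cscale_def)
    ultimately have "v i = (\<Sum>b\<in>B. (\<Sum>j<N. v j * cnj (b j)) * b i)" for i
      by (rule fun_cong[THEN trans])
    then show "v \<in> ?R" using N[OF v] by blast
  next
    fix v assume v: "v \<in> ?R"
    then have "v i = (\<Sum>b\<in>B. (\<Sum>j<N. v j * cnj (b j)) * b i)" for i by blast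
    moreover have "(\<Sum>b\<in>B. cscale (\<Sum>j<N. v j * cnj (b j)) b) i =
      (\<Sum>b\<in>B. (\<Sum>j<N. v j * cnj (b j)) * b i)" for i
      by (simp only: sum_fun_apply cscale_def)
    ultimately have "v = (\<Sum>b\<in>B. cscale (\<Sum>j<N. v j * cnj (b j)) b)"
      by (intro ext) (rule trans[OF _ sym])
    moreover have "(\<Sum>b\<in>B. cscale (\<Sum>j<N. v j * cnj (b j)) b) \<in> W"
      using B(2) by (intro J_objects_sum J_objects_scale assms) auto
    ultimately show "v \<in> W" by simp
  qed
  moreover have "closed ?R"
    by (intro closed_Collect_conj closed_Collect_all closed_Collect_imp closed_Collect_eq
        continuous_intros continuous_on_product_coordinates) auto
  ultimately show ?thesis by simp
qed

text \<open>The squared norm of a tuple. Summation over the support keeps it independent of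
  \<open>n\<close>, so that it does not change under inclusions of jet categories.\<close>

definition jsize :: "(nat \<Rightarrow> cvec) \<Rightarrow> real"
  where "jsize x = (\<Sum>i | x i \<noteq> 0. nsq (x i))"

lemma jsize_eq_sum:
  assumes "\<And>i. i \<ge> n \<Longrightarrow> x i = 0"
  shows "jsize x = (\<Sum>i<n. nsq (x i))"
  unfolding jsize_def
proof (rule sum.mono_neutral_left)
  show "{i. x i \<noteq> 0} \<subseteq> {..<n}" using assms by (auto simp: not_less[symmetric])
qed auto

lemma jsize_nonneg: "0 \<le> jsize x"
  unfolding jsize_def by (intro sum_nonneg nsq_nonneg)

lemma gammaD:
  assumes "(f, x) \<in> gamma n U V"
  shows "f \<in> isometries U V" "\<And>i. V \<in> J_objects \<Longrightarrow> x i \<in> V"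
    "\<And>i u. u \<in> U \<Longrightarrow> cinner (f u) (x i) = 0"
    "\<And>i. i \<ge> n \<Longrightarrow> x i = 0" "jsize x = (\<Sum>i<n. nsq (x i))"
proof -
  show "f \<in> isometries U V" "\<And>i. i \<ge> n \<Longrightarrow> x i = 0" using assms by (auto simp: gamma_def)
  show "x i \<in> V" if "V \<in> J_objects" for i
    using assms J_objects_zero[OF that] by (cases "i < n") (auto simp: gamma_def not_less)
  show "cinner (f u) (x i) = 0" if "u \<in> U" for i u
    using assms that by (cases "i < n") (auto simp: gamma_def not_less)
  show "jsize x = (\<Sum>i<n. nsq (x i))"
    using assms by (intro jsize_eq_sum) (auto simp: gamma_def)
qed

lemma gamma_mono: "k \<le> n \<Longrightarrow> V \<in> J_objects \<Longrightarrow> gamma k U V \<subseteq> gamma n U V"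
proof safe
  fix f x assume kn: "k \<le> n" "V \<in> J_objects" and p: "(f, x) \<in> gamma k U V"
  then show "(f, x) \<in> gamma n U V"
    using gammaD[OF p] by (auto simp: gamma_def)
qed

lemma continuous_on_gamma_coordinates:
  fixes u :: cvec
  shows "continuous_on S (\<lambda>p :: (cvec \<Rightarrow> cvec) \<times> (nat \<Rightarrow> cvec). fst p u j)"
    "continuous_on S (\<lambda>p :: (cvec \<Rightarrow> cvec) \<times> (nat \<Rightarrow> cvec). snd p i j)"
  by (rule continuous_on_product_then_coordinatewise[OF continuous_on_product_then_coordinatewise[OF
        continuous_on_fst[OF continuous_on_id]]]
      continuous_on_product_then_coordinatewise[OF continuous_on_product_then_coordinatewise[OF
        continuous_on_snd[OF continuous_on_id]]])+

text \<open>Once inner products are truncated at \<open>N\<close>, each clause of the definition is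
  membership in the closed set \<open>W\<close> or an equation between continuous functions of the
  coordinates.\<close>

lemma closed_gamma:
  assumes U: "U \<in> J_objects" and W: "W \<in> J_objects"
  shows "closed (gamma n U W)"
proof -
  obtain N where N: "\<And>u i. u \<in> W \<Longrightarrow> i \<ge> N \<Longrightarrow> u i = 0" using J_objects_bound[OF W] by blast
  have ci: "cinner v b = (\<Sum>j<N. v j * cnj (b j))" if "v \<in> W" for v b
    by (intro cinner_eq_sum N that)
  have "gamma n U W = {p. (\<forall>u. u \<in> U \<longrightarrow> fst p u \<in> W) \<and>
    (\<forall>u v j. u \<in> U \<and> v \<in> U \<longrightarrow> fst p (u + v) j = fst p u j + fst p v j) \<and>
    (\<forall>c u j. u \<in> U \<longrightarrow> fst p (cscale c u) j = c * fst p u j) \<and>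
    (\<forall>u v. u \<in> U \<and> v \<in> U \<longrightarrow> (\<Sum>j<N. fst p u j * cnj (fst p v j)) = cinner u v) \<and>
    (\<forall>u j. u \<notin> U \<longrightarrow> fst p u j = 0) \<and>
    (\<forall>i. i < n \<longrightarrow> snd p i \<in> W) \<and>
    (\<forall>i u. i < n \<and> u \<in> U \<longrightarrow> (\<Sum>j<N. fst p u j * cnj (snd p i j)) = 0) \<and>
    (\<forall>i j. i \<ge> n \<longrightarrow> snd p i j = 0)}" (is "_ = ?R")
  proof (intro set_eqI iffI)
    fix p assume "p \<in> gamma n U W"
    then show "p \<in> ?R"
      by (cases p) (auto simp: gamma_def isometries_def ci cscale_def)
  next
    fix p assume p: "p \<in> ?R"
    obtain f x where fx: "p = (f, x)" by (cases p)
    have "f \<in> isometries U W"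
      using p unfolding fx by (auto simp: isometries_def ci cscale_def fun_eq_iff)
    then show "p \<in> gamma n U W"
      using p unfolding fx by (auto simp: gamma_def ci fun_eq_iff)
  qed
  moreover have W1: "closed {p :: (cvec \<Rightarrow> cvec) \<times> (nat \<Rightarrow> cvec). fst p u \<in> W}" for u
  proof -
    have "closed ((\<lambda>p :: (cvec \<Rightarrow> cvec) \<times> (nat \<Rightarrow> cvec). fst p u) -` W)"
      by (intro closed_vimage[OF closed_J_object[OF W]] continuous_on_coordinatewise_then_product
          continuous_on_gamma_coordinates)
    then show ?thesis by (simp add: vimage_def)
  qed
  moreover have W2: "closed {p :: (cvec \<Rightarrow> cvec) \<times> (nat \<Rightarrow> cvec). snd p i \<in> W}" for i
  proof -
    have "closed ((\<lambda>p :: (cvec \<Rightarrow> cvec) \<times> (nat \<Rightarrow> cvec). snd p i) -` W)"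
      by (intro closed_vimage[OF closed_J_object[OF W]] continuous_on_coordinatewise_then_product
          continuous_on_gamma_coordinates)
    then show ?thesis by (simp add: vimage_def)
  qed
  moreover have "closed ?R"
    by (intro closed_Collect_conj closed_Collect_all closed_Collect_imp W1 W2 closed_Collect_eq
        continuous_intros continuous_on_gamma_coordinates) auto
  ultimately show ?thesis by simp
qed

lemma jsize_gamma:
  assumes N: "\<forall>u\<in>W. \<forall>i\<ge>N. u i = 0" and W: "W \<in> J_objects" and p: "p \<in> gamma n U W"
  shows "jsize (snd p) = (\<Sum>i<n. \<Sum>j<N. (cmod (snd p i j))\<^sup>2)"
proof -
  obtain f x where fx: "p = (f, x)" by (cases p)
  then show ?thesis
    using gammaD[of f x n U W] W p by (auto intro!: sum.cong nsq_eq_sum simp: N)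
qed

lemma gamma_coordinate_bounds:
  assumes U: "U \<in> J_objects" and W: "W \<in> J_objects" and p: "p \<in> gamma n U W"
  shows "cmod (fst p u j) \<le> sqrt (nsq u)" "cmod (snd p i j) \<le> sqrt (jsize (snd p))"
proof -
  note g = gammaD[of "fst p" "snd p" n U W]
  have f: "fst p \<in> isometries U W" using g(1) p by simp
  show "cmod (fst p u j) \<le> sqrt (nsq u)"
  proof (cases "u \<in> U")
    case True
    then show ?thesis
      using nsq_coordinate[OF isometry_C[OF U W f True]] isometry_nsq[OF U W f]
      by (intro real_le_rsqrt) auto
  qed (auto simp: isometry_outside[OF U W f] nsq_nonneg)
  have "(cmod (snd p i j))\<^sup>2 \<le> nsq (snd p i)"
    using nsq_coordinate J_objectsD(2)[OF W] g(2)[OF _ W] p by (metis prod.collapse subsetD)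
  also have "\<dots> \<le> jsize (snd p)"
  proof (cases "i < n")
    case True
    then have "nsq (snd p i) \<le> (\<Sum>i<n. nsq (snd p i))"
      by (intro member_le_sum) (auto intro: nsq_nonneg)
    then show ?thesis using g(5) p by simp
  next
    case False
    then show ?thesis using g(4)[of i] p jsize_nonneg by simp
  qed
  finally show "cmod (snd p i j) \<le> sqrt (jsize (snd p))" by (rule real_le_rsqrt)
qed

text \<open>Isometries preserve norms, so each coordinate of the map is bounded by the norm of its
  argument and each coordinate of the tuple by \<open>sqrt R\<close>. The set is thus a closed
  subset of a product of discs, compact by Tychonoff.\<close>

lemma compact_gamma_jsize:
  assumes U: "U \<in> J_objects" and W: "W \<in> J_objects"
  shows "compact {p \<in> gamma n U W. jsize (snd p) \<le> R}"
proof -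
  obtain N where N: "\<forall>u\<in>W. \<forall>i\<ge>N. u i = 0" using J_objects_bound[OF W] by metis
  let ?S = "\<lambda>p :: (cvec \<Rightarrow> cvec) \<times> (nat \<Rightarrow> cvec). \<Sum>i<n. \<Sum>j<N. (cmod (snd p i j))\<^sup>2"
  let ?K = "(PiE UNIV (\<lambda>u. PiE UNIV (\<lambda>j. cball 0 (sqrt (nsq u))))) \<times>
    (PiE UNIV (\<lambda>i :: nat. PiE UNIV (\<lambda>j :: nat. cball 0 (sqrt R)))) :: ((cvec \<Rightarrow> cvec) \<times> (nat \<Rightarrow> cvec)) set"
  have "{p \<in> gamma n U W. jsize (snd p) \<le> R} = ?K \<inter> (gamma n U W \<inter> {p. ?S p \<le> R})"
  proof (intro set_eqI iffI)
    fix p assume p: "p \<in> {p \<in> gamma n U W. jsize (snd p) \<le> R}"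
    then have b: "cmod (fst p u j) \<le> sqrt (nsq u)" "cmod (snd p i j) \<le> sqrt (jsize (snd p))"
      "sqrt (jsize (snd p)) \<le> sqrt R" for u i j
      using gamma_coordinate_bounds[OF U W, of p n] by auto
    have "cmod (snd p i j) \<le> sqrt R" for i j
      using b(2,3) by (rule order_trans)
    with b(1) show "p \<in> ?K \<inter> (gamma n U W \<inter> {p. ?S p \<le> R})"
      using p jsize_gamma[OF N W, of p n U] by (cases p) auto
  next
    fix p assume "p \<in> ?K \<inter> (gamma n U W \<inter> {p. ?S p \<le> R})"
    then show "p \<in> {p \<in> gamma n U W. jsize (snd p) \<le> R}"
      using jsize_gamma[OF N W, of p n U] by auto
  qed
  moreover have "compact ?K"
    by (intro compact_Times compact_PiE_UNIV compact_cball)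
  moreover have "closed {p. ?S p \<le> R}"
    by (intro closed_Collect_le continuous_intros continuous_on_gamma_coordinates)
  ultimately show ?thesis
    using compact_Int_closed[OF _ closed_Int[OF closed_gamma[OF U W]]] by simp
qed

section \<open>Weighted coordinates on Thom spaces\<close>

datatype jet_index = Weight | Map_coord cvec nat | Vec_coord nat nat

text \<open>The weight \<open>exp (- \<bar>x\<bar>\<^sup>2)\<close> is multiplicative under composition of jets, and the weighted
  coordinates vanish at the base point, so they turn continuity questions about Thom spaces into
  polynomial identities.\<close>

fun jet_coord :: "jet_index \<Rightarrow> jet \<Rightarrow> complex"
  where "jet_coord k None = 0"
  | "jet_coord k (Some (f, x)) = of_real (exp (- jsize x)) *
      (case k of Weight \<Rightarrow> 1 | Map_coord u j \<Rightarrow> f u j | Vec_coord i j \<Rightarrow> x i j)"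

lemma jets_eq: "jets n U V = insert None (Some ` gamma n U V)"
  by (simp add: J_def)

lemma sqrt_le_exp: "sqrt s \<le> exp (s / 2)"
proof -
  have "s \<le> exp s" using exp_ge_add_one_self[of s] by linarith
  then have "sqrt s \<le> sqrt (exp s)" by simp
  also have "sqrt (exp s) = exp (s / 2)"
    by (rule real_sqrt_unique) (simp_all flip: exp_double)
  finally show ?thesis .
qed

lemma weighted_bound:
  assumes "cmod y \<le> M * exp (s / 2)"
  shows "cmod (of_real (exp (- s)) * y) \<le> M * exp (- s / 2)"
proof -
  have "cmod (of_real (exp (- s)) * y) = exp (- s) * cmod y" by (simp add: norm_mult)
  also have "\<dots> \<le> exp (- s) * (M * exp (s / 2))" using assms by (intro mult_left_mono) auto
  also have "\<dots> = M * exp (- s / 2)" by (simp add: exp_add[symmetric] mult.left_commute)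
  finally show ?thesis .
qed

text \<open>Entries of an isometry are bounded and entries of the tuple are at most
  \<open>sqrt (jsize x)\<close>, hence at most \<open>exp (jsize x / 2)\<close>. The weight outgrows
  both, and the weighted coordinate extends by zero to the base point.\<close>

lemma continuous_map_jet_coord:
  assumes U: "U \<in> J_objects" and W: "W \<in> J_objects"
  shows "continuous_map (fst (J n U W)) euclidean (jet_coord k)"
proof -
  obtain N where N: "\<forall>u\<in>W. \<forall>i\<ge>N. u i = 0" using J_objects_bound[OF W] by metis
  define y where "y = (\<lambda>p :: (cvec \<Rightarrow> cvec) \<times> (nat \<Rightarrow> cvec).
    (case k of Weight \<Rightarrow> 1 | Map_coord u j \<Rightarrow> fst p u j | Vec_coord i j \<Rightarrow> snd p i j))"
  define c where "c p = of_real (exp (- jsize (snd p))) * y p" for p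
  have "continuous_on (gamma n U W) y"
    unfolding y_def by (cases k) (auto intro: continuous_on_gamma_coordinates)
  then have "continuous_on (gamma n U W)
    (\<lambda>p. of_real (exp (- (\<Sum>i<n. \<Sum>j<N. (cmod (snd p i j))\<^sup>2))) * y p)"
    by (intro continuous_intros continuous_on_gamma_coordinates)
  then have cc: "continuous_on (gamma n U W) c"
    unfolding c_def by (subst continuous_on_cong[OF refl]) (auto simp: jsize_gamma[OF N W])
  have "\<exists>M. \<forall>p\<in>gamma n U W. cmod (y p) \<le> M * exp (jsize (snd p) / 2)"
  proof (cases k)
    case Weight
    then show ?thesis unfolding y_def using jsize_nonneg by (intro exI[of _ 1]) auto
  next
    case (Map_coord u j)
    have "cmod (fst p u j) \<le> sqrt (nsq u) * exp (jsize (snd p) / 2)" if p: "p \<in> gamma n U W" for p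
    proof -
      have "sqrt (nsq u) * 1 \<le> sqrt (nsq u) * exp (jsize (snd p) / 2)"
        using jsize_nonneg nsq_nonneg by (intro mult_left_mono) auto
      then show ?thesis using gamma_coordinate_bounds(1)[OF U W p, of u j] by linarith
    qed
    then show ?thesis unfolding y_def Map_coord jet_index.case by blast
  next
    case (Vec_coord i j)
    have "cmod (snd p i j) \<le> exp (jsize (snd p) / 2)" if "p \<in> gamma n U W" for p
      using gamma_coordinate_bounds(2)[OF U W that, of i j] sqrt_le_exp[of "jsize (snd p)"] by linarith
    then show ?thesis unfolding y_def Vec_coord by (intro exI[of _ 1]) auto
  qed
  then obtain M where M: "\<And>p. p \<in> gamma n U W \<Longrightarrow> cmod (y p) \<le> M * exp (jsize (snd p) / 2)"
    by blast
  have "continuous_map (one_point_compactification (top_of_set (gamma n U W))) euclidean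
    (\<lambda>\<xi>. case \<xi> of None \<Rightarrow> 0 | Some p \<Rightarrow> c p)"
  proof (rule continuous_map_from_one_point_compactification[where \<sigma>="\<lambda>p. jsize (snd p)" and M=M])
    show "compactin (top_of_set (gamma n U W)) {p \<in> topspace (top_of_set (gamma n U W)). jsize (snd p) \<le> R}" for R
      using compact_gamma_jsize[OF U W, of n R] by (auto simp: compactin_subtopology)
    show "norm (c p) \<le> M * exp (- jsize (snd p) / 2)" if "p \<in> topspace (top_of_set (gamma n U W))" for p
      unfolding c_def using M that by (intro weighted_bound) auto
  qed (use cc in simp)
  moreover have "jet_coord k = (\<lambda>\<xi>. case \<xi> of None \<Rightarrow> 0 | Some p \<Rightarrow> c p)"
    by (auto simp: fun_eq_iff c_def y_def split: option.splits jet_index.splits)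
  ultimately show ?thesis by (simp add: J_def)
qed

lemma compact_space_J: "compact_space (fst (J n U W))"
  by (simp add: J_def compact_space_one_point_compactification)

text \<open>The weight is nonzero exactly off the base point; once the weights are known to agree,
  they cancel from the other coordinates.\<close>

lemma jet_coord_inject:
  assumes "\<And>k. jet_coord k \<xi> = jet_coord k \<eta>"
  shows "\<xi> = \<eta>"
proof (cases \<xi>; cases \<eta>)
  fix p q assume pq: "\<xi> = Some p" "\<eta> = Some q"
  obtain f x g y where fg: "p = (f, x)" "q = (g, y)" by (cases p, cases q) blast
  have e: "exp (- jsize x) = exp (- jsize y)"
    using assms[of Weight] pq fg by simp
  have "f u j = g u j" for u j
    using assms[of "Map_coord u j"] pq fg e by simp
  moreover have "x u j = y u j" for u j
    using assms[of "Vec_coord u j"] pq fg e by simp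
  ultimately have "f = g" "x = y" by (auto simp: fun_eq_iff)
  then show ?thesis using pq fg by simp
qed (use assms[of Weight] in auto)

lemma jet_coords_continuous_inj:
  assumes "U \<in> J_objects" "W \<in> J_objects"
  shows "continuous_map (fst (J n U W)) (product_topology (\<lambda>_. euclidean) UNIV) (\<lambda>\<xi> k. jet_coord k \<xi>)"
    "inj_on (\<lambda>\<xi> k. jet_coord k \<xi>) (jets n U W)"
  using continuous_map_jet_coord[OF assms]
  by (simp add: continuous_map_componentwise_UNIV) (intro inj_onI jet_coord_inject, metis)

lemma Hausdorff_space_J: "U \<in> J_objects \<Longrightarrow> W \<in> J_objects \<Longrightarrow> Hausdorff_space (fst (J n U W))"
  by (rule Hausdorff_space_injective_preimage[OF _ jet_coords_continuous_inj])
    (auto simp: Hausdorff_space_product_topology)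

lemma jet_coord_embedding:
  "U \<in> J_objects \<Longrightarrow> W \<in> J_objects \<Longrightarrow>
    embedding_map (fst (J n U W)) (product_topology (\<lambda>_. euclidean) UNIV) (\<lambda>\<xi> k. jet_coord k \<xi>)"
  by (rule continuous_imp_embedding_map[OF jet_coords_continuous_inj(1) _ _ jet_coords_continuous_inj(2)])
    (auto simp: compact_space_J Hausdorff_space_product_topology)

text \<open>The coordinates embed the compact Thom space into a Hausdorff product, so continuity may
  be tested coordinatewise, at the base point as well.\<close>

lemma continuous_map_into_J:
  assumes UW: "U \<in> J_objects" "W \<in> J_objects" and h: "h \<in> topspace T \<rightarrow> jets n U W"
    and c: "\<And>k. continuous_map T euclidean (\<lambda>t. jet_coord k (h t))"
  shows "continuous_map T (fst (J n U W)) h"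
proof -
  let ?E = "\<lambda>\<xi> k. jet_coord k \<xi>" and ?P = "product_topology (\<lambda>_ :: jet_index. euclidean :: complex topology) UNIV"
  obtain g where g: "homeomorphic_maps (fst (J n U W)) (subtopology ?P (?E ` jets n U W)) ?E g"
    using jet_coord_embedding[OF UW] unfolding embedding_map_def homeomorphic_map_maps by blast
  have "continuous_map T ?P (\<lambda>t. ?E (h t))"
    using c by (simp add: continuous_map_componentwise_UNIV)
  then have "continuous_map T (subtopology ?P (?E ` jets n U W)) (\<lambda>t. ?E (h t))"
    using h by (auto simp: continuous_map_in_subtopology)
  then have "continuous_map T (fst (J n U W)) (g \<circ> (\<lambda>t. ?E (h t)))"
    using g unfolding homeomorphic_maps_def by (meson continuous_map_compose)
  then show ?thesis
    by (rule continuous_map_eq) (use g h in \<open>auto simp: homeomorphic_maps_def Pi_def\<close>)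
qed

lemma continuous_map_mult:
  fixes f g :: "'t \<Rightarrow> 'b::real_normed_algebra"
  assumes "continuous_map T euclidean f" "continuous_map T euclidean g"
  shows "continuous_map T euclidean (\<lambda>t. f t * g t)"
proof -
  have "continuous_map T (prod_topology euclidean euclidean) (\<lambda>t. (f t, g t))"
    using assms by (rule continuous_map_pairedI)
  moreover have "continuous_map (prod_topology euclidean euclidean) euclidean (\<lambda>p :: 'b \<times> 'b. fst p * snd p)"
    by (auto intro!: continuous_intros)
  ultimately have "continuous_map T euclidean ((\<lambda>p. fst p * snd p) \<circ> (\<lambda>t. (f t, g t)))"
    by (rule continuous_map_compose)
  then show ?thesis by (simp add: o_def)
qed

section \<open>Composition of jets\<close>

lemma None_in_jets [simp]: "None \<in> jets n U V"
  by (simp add: jets_eq)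

lemma Some_in_jets: "Some p \<in> jets n U V \<longleftrightarrow> p \<in> gamma n U V"
  by (auto simp: jets_eq)

lemma jets_mono: "k \<le> n \<Longrightarrow> V \<in> J_objects \<Longrightarrow> jets k U V \<subseteq> jets n U V"
  using gamma_mono[of k n V U] by (auto simp: jets_eq)

text \<open>Tuples vanish from index \<open>n\<close> on already, so padding changes nothing.
  Restriction along inclusions of jet categories can then be written without
  \<open>jet_incl\<close>.\<close>

lemma jet_incl_id:
  assumes "\<xi> \<in> jets n U V"
  shows "jet_incl n \<xi> = \<xi>"
proof (cases \<xi>)
  case (Some p)
  obtain f x where fx: "p = (f, x)" by (cases p)
  then have "(f, x) \<in> gamma n U V" using assms Some by (simp add: Some_in_jets)
  then have "(\<lambda>i. if i < n then x i else 0) = x" using gammaD(4) by (auto simp: fun_eq_iff)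
  then show ?thesis using Some fx by (simp add: jet_incl_def)
qed (simp add: jet_incl_def)

lemma jet_comp_None_right [simp]: "jet_comp \<psi> None = None"
  by (cases \<psi>) auto

lemma jet_id_in_jets: "U \<in> J_objects \<Longrightarrow> jet_id U \<in> jets n U U"
  unfolding jet_id_def Some_in_jets
  by (auto simp: gamma_def isometries_def J_objects_zero J_objects_add J_objects_scale)

context
  fixes U V W and n :: nat
  assumes U: "U \<in> J_objects" and V: "V \<in> J_objects" and W: "W \<in> J_objects"
begin

text \<open>The vectors \<open>y i\<close> are orthogonal to the image of \<open>g\<close>, and
  \<open>g\<close> preserves norms; squared norms therefore add up, which is the multiplicativity of
  the weights.\<close>

lemma jet_comp_gamma:
  assumes "(g, y) \<in> gamma n V W" "(f, x) \<in> gamma n U V"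
  shows "(g \<circ> f, \<lambda>i. y i + g (x i)) \<in> gamma n U W"
    "jsize (\<lambda>i. y i + g (x i)) = jsize y + jsize x"
proof -
  note g = gammaD[OF assms(1)] and f = gammaD[OF assms(2)]
  note gi = isometry_in[OF V W g(1)] isometry_add[OF V W g(1)] isometry_scale[OF V W g(1)]
    isometry_cinner[OF V W g(1)] isometry_zero[OF V W g(1)] isometry_nsq[OF V W g(1)]
  note fi = isometry_in[OF U V f(1)] isometry_add[OF U V f(1)] isometry_scale[OF U V f(1)]
    isometry_cinner[OF U V f(1)] isometry_outside[OF U V f(1)]
  have C: "y i \<in> C_infinity" "g (x i) \<in> C_infinity" for i
    using J_objectsD(2)[OF W] g(2)[OF W] f(2)[OF V] gi(1) by blast+
  have iso: "g \<circ> f \<in> isometries U W"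
    unfolding isometries_def using gi fi by auto
  have perp: "cinner (g (f u)) (y i + g (x i)) = 0" if "u \<in> U" for u i
  proof -
    have "g (f u) \<in> C_infinity" using J_objectsD(2)[OF W] fi(1) gi(1) that by blast
    then show ?thesis
      using g(3)[OF fi(1)[OF that]] f(3)[OF that] gi(4)[OF fi(1)[OF that] f(2)[OF V]]
      by (simp add: cinner_add_right C)
  qed
  show "(g \<circ> f, \<lambda>i. y i + g (x i)) \<in> gamma n U W"
    unfolding gamma_def using iso perp g(4) f(4) gi(5)
    by (auto intro!: J_objects_add[OF W] g(2)[OF W] gi(1) f(2)[OF V])
  have "jsize (\<lambda>i. y i + g (x i)) = (\<Sum>i<n. nsq (y i + g (x i)))"
    by (rule jsize_eq_sum) (simp add: g(4) f(4) gi(5))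
  also have "\<dots> = (\<Sum>i<n. nsq (y i) + nsq (x i))"
  proof (rule sum.cong)
    fix i
    have "nsq (g (x i) + y i) = nsq (g (x i)) + nsq (y i)"
      using C g(3) f(2)[OF V] by (intro nsq_add) auto
    then show "nsq (y i + g (x i)) = nsq (y i) + nsq (x i)"
      using gi(6)[OF f(2)[OF V]] by (simp add: add.commute)
  qed simp
  finally show "jsize (\<lambda>i. y i + g (x i)) = jsize y + jsize x"
    using g(5) f(5) by (simp add: sum.distrib)
qed

lemma jet_comp_in_jets:
  assumes "\<psi> \<in> jets n V W" "\<phi> \<in> jets n U V"
  shows "jet_comp \<psi> \<phi> \<in> jets n U W"
proof (cases \<psi>; cases \<phi>)
  fix p q assume pq: "\<psi> = Some p" "\<phi> = Some q"
  obtain g y f x where "p = (g, y)" "q = (f, x)" by (cases p, cases q) blast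
  then show ?thesis using jet_comp_gamma(1) assms pq by (simp add: Some_in_jets)
qed auto

text \<open>Expanding vectors of \<open>V\<close> in \<open>B\<close> makes each coordinate of the
  composite bilinear in the weighted coordinates of the factors. Every term carries one weight from
  each factor, so the formula also holds at the base points, where both sides vanish.\<close>

lemma jet_comp_coord:
  assumes N: "\<forall>u\<in>V. \<forall>i\<ge>N. u i = 0"
    and B: "B \<subseteq> V" "\<forall>u\<in>V. u = (\<Sum>b\<in>B. cscale (cinner u b) b)"
    and \<psi>: "\<psi> \<in> jets n V W" and \<phi>: "\<phi> \<in> jets n U V"
  shows "jet_coord k (jet_comp \<psi> \<phi>) = (case k of
      Weight \<Rightarrow> jet_coord Weight \<psi> * jet_coord Weight \<phi>
    | Map_coord u j \<Rightarrow> (\<Sum>b\<in>B. (\<Sum>l<N. jet_coord (Map_coord u l) \<phi> * cnj (b l)) * jet_coord (Map_coord b j) \<psi>)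
    | Vec_coord i j \<Rightarrow> jet_coord (Vec_coord i j) \<psi> * jet_coord Weight \<phi> +
        (\<Sum>b\<in>B. (\<Sum>l<N. jet_coord (Vec_coord i l) \<phi> * cnj (b l)) * jet_coord (Map_coord b j) \<psi>))"
proof (cases \<psi>)
  case None
  then show ?thesis by (cases k) auto
next
  case \<psi>s: (Some p)
  show ?thesis
  proof (cases \<phi>)
    case None
    then show ?thesis by (cases k) auto
  next
    case (Some q)
    obtain g y f x where pq: "p = (g, y)" "q = (f, x)" by (cases p, cases q) blast
    have gy: "(g, y) \<in> gamma n V W" and fx: "(f, x) \<in> gamma n U V"
      using \<psi> \<phi> \<psi>s Some pq by (auto simp: Some_in_jets)
    note f = gammaD[OF fx] and g = gammaD[OF gy]
    have expand: "g v j = (\<Sum>b\<in>B. (\<Sum>l<N. v l * cnj (b l)) * g b j)" if v: "v \<in> V" for v j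
    proof -
      have "g v = g (\<Sum>b\<in>B. cscale (cinner v b) b)" using B(2) v by metis
      also have "\<dots> = (\<Sum>b\<in>B. cscale (cinner v b) (g b))"
        using B(1) by (subst isometry_sum[OF V W g(1)])
          (auto intro!: J_objects_scale V sum.cong isometry_scale[OF V W g(1)])
      finally have "g v j = (\<Sum>b\<in>B. cinner v b * g b j)"
        by (simp add: sum_fun_apply cscale_def)
      moreover have "cinner v b = (\<Sum>l<N. v l * cnj (b l))" for b
        using N v by (intro cinner_eq_sum) blast
      ultimately show ?thesis by simp
    qed
    have fV: "f u \<in> V" for u
      using isometry_in[OF U V f(1)] isometry_outside[OF U V f(1)] J_objects_zero[OF V] by metis
    have e: "exp (- jsize (\<lambda>i. y i + g (x i))) = exp (- jsize y) * exp (- jsize x)"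
      unfolding jet_comp_gamma(2)[OF gy fx] by (simp add: exp_add[symmetric])
    show ?thesis
    proof (cases k)
      case Weight
      then show ?thesis using \<psi>s Some pq e by simp
    next
      case (Map_coord u j)
      then show ?thesis using \<psi>s Some pq e expand[OF fV, of u j]
        by (simp add: sum_distrib_left sum_distrib_right mult_ac)
    next
      case (Vec_coord i j)
      then show ?thesis using \<psi>s Some pq e expand[OF f(2)[OF V], of i j]
        by (simp add: sum_distrib_left sum_distrib_right algebra_simps)
    qed
  qed
qed

lemma continuous_map_jet_comp:
  assumes \<psi>: "continuous_map T (fst (J n V W)) \<psi>" and \<phi>: "continuous_map T (fst (J n U V)) \<phi>"
  shows "continuous_map T (fst (J n U W)) (\<lambda>t. jet_comp (\<psi> t) (\<phi> t))"
proof (rule continuous_map_into_J[OF U W])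
  have j: "\<psi> t \<in> jets n V W" "\<phi> t \<in> jets n U V" if "t \<in> topspace T" for t
    using \<psi> \<phi> that by (auto simp: continuous_map_def)
  then show "(\<lambda>t. jet_comp (\<psi> t) (\<phi> t)) \<in> topspace T \<rightarrow> jets n U W"
    using jet_comp_in_jets by blast
  obtain N where N: "\<forall>u\<in>V. \<forall>i\<ge>N. u i = 0" using J_objects_bound[OF V] by metis
  obtain B where B: "finite B" "B \<subseteq> V" "\<forall>u\<in>V. u = (\<Sum>b\<in>B. cscale (cinner u b) b)"
    using J_objects_basis[OF V] by metis
  have c: "continuous_map T euclidean (\<lambda>t. jet_coord k (\<psi> t))"
    "continuous_map T euclidean (\<lambda>t. jet_coord k (\<phi> t))" for k
    using continuous_map_compose[OF \<psi> continuous_map_jet_coord[OF V W]]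
      continuous_map_compose[OF \<phi> continuous_map_jet_coord[OF U V]] by (simp_all add: o_def)
  show "continuous_map T euclidean (\<lambda>t. jet_coord k (jet_comp (\<psi> t) (\<phi> t)))" for k
  proof (rule continuous_map_eq)
    show "continuous_map T euclidean (\<lambda>t. (case k of
      Weight \<Rightarrow> jet_coord Weight (\<psi> t) * jet_coord Weight (\<phi> t)
    | Map_coord u j \<Rightarrow> (\<Sum>b\<in>B. (\<Sum>l<N. jet_coord (Map_coord u l) (\<phi> t) * cnj (b l)) * jet_coord (Map_coord b j) (\<psi> t))
    | Vec_coord i j \<Rightarrow> jet_coord (Vec_coord i j) (\<psi> t) * jet_coord Weight (\<phi> t) +
        (\<Sum>b\<in>B. (\<Sum>l<N. jet_coord (Vec_coord i l) (\<phi> t) * cnj (b l)) * jet_coord (Map_coord b j) (\<psi> t))))"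
      using B(1)
      by (cases k) (auto intro!: continuous_map_mult continuous_map_sum continuous_map_add c)
  qed (rule jet_comp_coord[OF N B(2,3) j, symmetric])
qed

end

lemma jet_comp_assoc:
  assumes "U \<in> J_objects" "V \<in> J_objects" "W \<in> J_objects" "X \<in> J_objects"
    and "\<zeta> \<in> jets n W X" "\<psi> \<in> jets n V W" "\<phi> \<in> jets n U V"
  shows "jet_comp (jet_comp \<zeta> \<psi>) \<phi> = jet_comp \<zeta> (jet_comp \<psi> \<phi>)"
proof (cases \<zeta>; cases \<psi>; cases \<phi>)
  fix p q r assume *: "\<zeta> = Some p" "\<psi> = Some q" "\<phi> = Some r"
  obtain h z g y f x where pqr: "p = (h, z)" "q = (g, y)" "r = (f, x)"
    by (cases p, cases q, cases r) blast
  have h: "h \<in> isometries W X" and g: "g \<in> isometries V W" and y: "\<And>i. y i \<in> W" and x: "\<And>i. x i \<in> V"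
    using gammaD(1,2) assms * pqr by (auto simp: Some_in_jets)
  have "h (y i + g (x i)) = h (y i) + h (g (x i))" for i
    using isometry_add[OF assms(3,4) h y isometry_in[OF assms(2,3) g x]] .
  then show ?thesis using * pqr by (simp add: o_assoc add.assoc)
qed auto

lemma jet_comp_id_left:
  assumes "U \<in> J_objects" "V \<in> J_objects" "\<phi> \<in> jets n U V"
  shows "jet_comp (jet_id V) \<phi> = \<phi>"
proof (cases \<phi>)
  case (Some p)
  obtain f x where fx: "p = (f, x)" by (cases p)
  then have p: "(f, x) \<in> gamma n U V" using assms(3) Some by (simp add: Some_in_jets)
  note f = gammaD[OF p]
  have "f u \<in> V" for u
    using isometry_in[OF assms(1,2) f(1)] isometry_outside[OF assms(1,2) f(1)]
      J_objects_zero[OF assms(2)] by metis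
  then show ?thesis using Some fx f(2)[OF assms(2)] by (auto simp: jet_id_def fun_eq_iff)
qed simp

lemma jet_comp_id_right:
  assumes "U \<in> J_objects" "V \<in> J_objects" "\<phi> \<in> jets n U V"
  shows "jet_comp \<phi> (jet_id U) = \<phi>"
proof (cases \<phi>)
  case (Some p)
  obtain f x where fx: "p = (f, x)" by (cases p)
  then have p: "(f, x) \<in> gamma n U V" using assms(3) Some by (simp add: Some_in_jets)
  have z: "f 0 = 0" using isometry_zero[OF assms(1,2) gammaD(1)[OF p]] .
  have "f \<circ> (\<lambda>u. if u \<in> U then u else 0) = f"
    using z isometry_outside[OF assms(1,2) gammaD(1)[OF p]] by (auto simp: fun_eq_iff)
  then show ?thesis using Some fx z
    by (simp add: jet_id_def zero_fun_def[symmetric])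
qed (simp add: jet_id_def)

text \<open>The inclusion of jet categories is the identity on representatives, and the weighted
  coordinates do not depend on \<open>n\<close>.\<close>

lemma continuous_map_jets_mono:
  assumes "k \<le> n" "U \<in> J_objects" "V \<in> J_objects" "continuous_map T (fst (J k U V)) h"
  shows "continuous_map T (fst (J n U V)) h"
proof (rule continuous_map_into_J[OF assms(2,3)])
  show "h \<in> topspace T \<rightarrow> jets n U V"
    using assms(4) jets_mono[OF assms(1,3)] by (auto simp: continuous_map_def)
  show "continuous_map T euclidean (\<lambda>t. jet_coord c (h t))" for c
    using continuous_map_compose[OF assms(4) continuous_map_jet_coord[OF assms(2,3)]]
    by (simp add: o_def)
qed

section \<open>Even-dimensional spheres\<close>

abbreviation sphere_points :: "nat \<Rightarrow> cvec option set"
  where "sphere_points n \<equiv> topspace (fst (even_sphere n))"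

lemma topspace_even_sphere: "sphere_points n = insert None (Some ` {z. \<forall>i\<ge>n. z i = 0})"
  by (simp add: even_sphere_def)

lemma even_sphere_C_infinity: "\<forall>i\<ge>n. z i = 0 \<Longrightarrow> z \<in> C_infinity"
  unfolding C_infinity_def by (auto intro: finite_subset[of _ "{..<n}"] simp: not_less[symmetric])

text \<open>The analogue of \<open>jet_coord\<close> for spheres, with \<open>None\<close> as the
  index of the weight.\<close>

fun sphere_coord :: "nat option \<Rightarrow> cvec option \<Rightarrow> complex"
  where "sphere_coord k None = 0"
  | "sphere_coord k (Some z) = of_real (exp (- nsq z)) * (case k of None \<Rightarrow> 1 | Some i \<Rightarrow> z i)"

lemma continuous_map_sphere_coord:
  "continuous_map (fst (even_sphere n)) euclidean (sphere_coord k)"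
proof -
  let ?G = "{z :: cvec. \<forall>i\<ge>n. z i = 0}"
  have ns: "nsq z = (\<Sum>i<n. (cmod (z i))\<^sup>2)" if "z \<in> ?G" for z
    using that by (intro nsq_eq_sum) auto
  define y where "y = (\<lambda>z :: cvec. case k of None \<Rightarrow> 1 | Some i \<Rightarrow> z i)"
  define c where "c z = of_real (exp (- nsq z)) * y z" for z
  have coo: "continuous_on S (\<lambda>z :: cvec. z i)" for S i
    by (rule continuous_on_product_then_coordinatewise[OF continuous_on_id])
  have "continuous_on ?G y"
    unfolding y_def by (cases k) (auto intro: coo)
  then have "continuous_on ?G (\<lambda>z. of_real (exp (- (\<Sum>i<n. (cmod (z i))\<^sup>2))) * y z)"
    by (intro continuous_intros coo)
  then have cc: "continuous_on ?G c"
    unfolding c_def by (subst continuous_on_cong[OF refl]) (auto simp: ns)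
  have "continuous_map (one_point_compactification (top_of_set ?G)) euclidean
    (\<lambda>\<xi>. case \<xi> of None \<Rightarrow> 0 | Some z \<Rightarrow> c z)"
  proof (rule continuous_map_from_one_point_compactification[where \<sigma>=nsq and M=1])
    fix R
    let ?K = "PiE UNIV (\<lambda>i :: nat. cball 0 (sqrt R)) :: cvec set"
    have "{z \<in> ?G. nsq z \<le> R} = ?K \<inter> {z. (\<forall>i. i \<ge> n \<longrightarrow> z i = 0) \<and> (\<Sum>i<n. (cmod (z i))\<^sup>2) \<le> R}"
    proof (intro set_eqI iffI)
      fix z assume z: "z \<in> {z \<in> ?G. nsq z \<le> R}"
      then have "(cmod (z i))\<^sup>2 \<le> R" for i
        using nsq_coordinate[OF even_sphere_C_infinity, of n z i] by auto
      then have "cmod (z i) \<le> sqrt R" for i by (rule real_le_rsqrt)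
      then have "z \<in> ?K" by auto
      then show "z \<in> ?K \<inter> {z. (\<forall>i. i \<ge> n \<longrightarrow> z i = 0) \<and> (\<Sum>i<n. (cmod (z i))\<^sup>2) \<le> R}"
        using z ns[of z] by auto
    next
      fix z assume "z \<in> ?K \<inter> {z. (\<forall>i. i \<ge> n \<longrightarrow> z i = 0) \<and> (\<Sum>i<n. (cmod (z i))\<^sup>2) \<le> R}"
      then show "z \<in> {z \<in> ?G. nsq z \<le> R}" using ns[of z] by auto
    qed
    moreover have "compact ?K" by (intro compact_PiE_UNIV compact_cball)
    moreover have "closed {z :: cvec. (\<forall>i. i \<ge> n \<longrightarrow> z i = 0) \<and> (\<Sum>i<n. (cmod (z i))\<^sup>2) \<le> R}"
      by (intro closed_Collect_conj closed_Collect_all closed_Collect_imp closed_Collect_eq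
          closed_Collect_le continuous_intros coo) auto
    ultimately have "compact {z \<in> ?G. nsq z \<le> R}" by (simp only: compact_Int_closed)
    then show "compactin (top_of_set ?G) {p \<in> topspace (top_of_set ?G). nsq p \<le> R}"
      by (auto simp: compactin_subtopology)
  next
    fix z assume z: "z \<in> topspace (top_of_set ?G)"
    have "cmod (y z) \<le> exp (nsq z / 2)"
    proof (cases k)
      case None
      then show ?thesis by (simp add: y_def nsq_nonneg)
    next
      case (Some i)
      have "(cmod (z i))\<^sup>2 \<le> nsq z"
        using nsq_coordinate[OF even_sphere_C_infinity, of n z i] z by auto
      then have "cmod (z i) \<le> sqrt (nsq z)" by (rule real_le_rsqrt)
      then show ?thesis using sqrt_le_exp[of "nsq z"] Some by (simp add: y_def)
    qed
    then show "norm (c z) \<le> 1 * exp (- nsq z / 2)"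
      unfolding c_def by (intro weighted_bound) simp
  qed (use cc in simp)
  moreover have "sphere_coord k = (\<lambda>\<xi>. case \<xi> of None \<Rightarrow> 0 | Some p \<Rightarrow> c p)"
    by (auto simp: fun_eq_iff c_def y_def split: option.splits)
  ultimately show ?thesis by (simp add: even_sphere_def)
qed

lemma compact_space_even_sphere: "compact_space (fst (even_sphere n))"
  by (simp add: even_sphere_def compact_space_one_point_compactification)

lemma Hausdorff_space_even_sphere: "Hausdorff_space (fst (even_sphere n))"
proof (rule Hausdorff_space_injective_preimage)
  show "continuous_map (fst (even_sphere n)) (product_topology (\<lambda>_. euclidean) UNIV) (\<lambda>s k. sphere_coord k s)"
    using continuous_map_sphere_coord by (simp add: continuous_map_componentwise_UNIV)
  show "inj_on (\<lambda>s k. sphere_coord k s) (sphere_points n)"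
  proof (rule inj_onI)
    fix s s' assume "(\<lambda>k. sphere_coord k s) = (\<lambda>k. sphere_coord k s')"
    then have *: "sphere_coord k s = sphere_coord k s'" for k by metis
    show "s = s'"
    proof (cases s; cases s')
      fix z z' assume s: "s = Some z" "s' = Some z'"
      then have "z i = z' i" for i using *[of None] *[of "Some i"] by simp
      then show ?thesis using s by (simp add: fun_eq_iff)
    qed (use *[of None] in auto)
  qed
qed (auto simp: Hausdorff_space_product_topology)

subsection \<open>Jets as points of a mapping cone\<close>

text \<open>On [0, 1) the inverse of r \<mapsto> 1 - exp (-r^2) for r \<ge> 0, chosen so that a last
  vector of norm r contributes exactly the factor 1 - t to the weight.\<close>

definition cone_height :: "real \<Rightarrow> real"
  where "cone_height t = sqrt (- ln (1 - t))"

lemma cone_height_0 [simp]: "cone_height 0 = 0"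
  by (simp add: cone_height_def)

lemma exp_cone_height:
  assumes "0 \<le> t" "t < 1"
  shows "exp (- (cone_height t)\<^sup>2) = 1 - t"
proof -
  have "ln (1 - t) \<le> 0" using assms by simp
  then have "(cone_height t)\<^sup>2 = - ln (1 - t)" unfolding cone_height_def by simp
  then show ?thesis using assms by simp
qed

lemma cone_height_inverse:
  assumes "0 \<le> r"
  shows "cone_height (1 - exp (- r\<^sup>2)) = r"
  unfolding cone_height_def using assms by simp

text \<open>The height tends to infinity as t tends to 1, but the weighted height tends to 0: with x
  = 1 - t, the estimate - ln x \<le> 1 / x - 1 gives x sqrt (- ln x) \<le> sqrt x.\<close>

lemma continuous_on_cone_height: "continuous_on {0..1} (\<lambda>t. (1 - t) * cone_height t)"
  unfolding continuous_on_def
proof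
  fix t :: real assume t: "t \<in> {0..1}"
  show "((\<lambda>t. (1 - t) * cone_height t) \<longlongrightarrow> (1 - t) * cone_height t) (at t within {0..1})"
  proof (cases "t = 1")
    case True
    have bound: "norm ((1 - s) * cone_height s) \<le> sqrt (1 - s)" if "s \<in> {0..1}" for s
    proof (cases "s = 1")
      case False
      define x where "x = 1 - s"
      have x: "0 < x" "x \<le> 1" using that False by (auto simp: x_def)
      have "- ln x = ln (1 / x)" using x by (simp add: ln_div)
      also have "\<dots> \<le> 1 / x - 1" using x by (intro ln_le_minus_one) simp
      finally have "x * (- ln x) \<le> 1" using x by (simp add: field_simps)
      then have "x * (x * (- ln x)) \<le> x * 1" using x by (intro mult_left_mono) auto
      then have "sqrt (x\<^sup>2 * (- ln x)) \<le> sqrt x" by (simp add: power2_eq_square mult_ac)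
      moreover have "sqrt (x\<^sup>2 * (- ln x)) = x * sqrt (- ln x)"
        using x real_sqrt_mult[of "x\<^sup>2" "- ln x"] by simp
      moreover have "0 \<le> x * sqrt (- ln x)" using x by simp
      ultimately have "norm (x * sqrt (- ln x)) \<le> sqrt x" unfolding real_norm_def by linarith
      then show ?thesis unfolding cone_height_def x_def[symmetric] .
    qed simp
    have "((\<lambda>s. sqrt (1 - s)) \<longlongrightarrow> sqrt (1 - 1)) (at 1 within {0..1})"
      by (intro tendsto_intros)
    then have "((\<lambda>s. sqrt (1 - s)) \<longlongrightarrow> 0) (at 1 within {0..1})" by simp
    then have "((\<lambda>s. (1 - s) * cone_height s) \<longlongrightarrow> 0) (at 1 within {0..1})"
      by (rule Lim_null_comparison[rotated])
        (use bound in \<open>auto simp: eventually_at_filter\<close>)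
    then show ?thesis using True by simp
  next
    case False
    then show ?thesis unfolding cone_height_def using t by (intro tendsto_intros) auto
  qed
qed

text \<open>The height enters as the coordinate with index \<open>n\<close>, so only nonnegative
  real values occur there. The direction of the last vector of a general jet is carried by the image
  of \<open>e\<close> under the isometry that is composed with the cone jet.\<close>

definition cone_jet :: "nat \<Rightarrow> (cvec \<Rightarrow> cvec) \<Rightarrow> cvec \<Rightarrow> real \<Rightarrow> cvec option \<Rightarrow> jet"
  where "cone_jet n \<iota> e t s = (if t < 1
    then fibre_incl \<iota> e (map_option (\<lambda>z. z(n := of_real (cone_height t))) s) else None)"

lemma cone_jet_None [simp]: "cone_jet n \<iota> e t None = None" "cone_jet n \<iota> e 1 s = None"
  by (auto simp: cone_jet_def fibre_incl_def)

lemma cone_jet_0: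
  assumes "s \<in> sphere_points n"
  shows "cone_jet n \<iota> e 0 s = fibre_incl \<iota> e s"
proof -
  have "map_option (\<lambda>z. z(n := 0)) s = s"
    using assms by (cases s) (auto simp: topspace_even_sphere fun_eq_iff)
  then show ?thesis by (simp add: cone_jet_def)
qed

lemma nsq_upd:
  assumes "\<forall>i\<ge>n. z i = 0"
  shows "nsq (z(n := c)) = nsq z + (cmod c)\<^sup>2"
proof -
  have "nsq (z(n := c)) = (\<Sum>i<Suc n. (cmod ((z(n := c)) i))\<^sup>2)"
    using assms by (intro nsq_eq_sum) auto
  moreover have "nsq z = (\<Sum>i<n. (cmod (z i))\<^sup>2)"
    using assms by (intro nsq_eq_sum) auto
  ultimately show ?thesis by simp
qed

lemma sphere_coord_upd:
  assumes "s \<in> sphere_points n"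
  shows "sphere_coord k (map_option (\<lambda>z. z(n := of_real r)) s) =
    of_real (exp (- r\<^sup>2)) * (if k = Some n then sphere_coord None s * of_real r else sphere_coord k s)"
proof (cases s)
  case (Some z)
  then have "nsq (z(n := complex_of_real r)) = nsq z + r\<^sup>2"
    using assms by (subst nsq_upd) (auto simp: topspace_even_sphere)
  then have "exp (- nsq (z(n := complex_of_real r))) = exp (- nsq z) * exp (- r\<^sup>2)"
    by (simp add: exp_add[symmetric])
  then show ?thesis using Some by (auto simp: mult_ac split: option.splits)
qed simp

context
  fixes U V \<iota> e
  assumes U: "U \<in> J_objects" and VU: "is_plus_C U V \<iota> e"
begin

lemma plus_C_facts:
  "V \<in> J_objects" "\<iota> \<in> isometries U V" "e \<in> V" "cinner e e = 1" "nsq e = 1" "e \<in> C_infinity"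
  "\<And>u. u \<in> U \<Longrightarrow> cinner (\<iota> u) e = 0"
  "\<And>u. u \<in> U \<Longrightarrow> \<iota> u \<in> V"  "\<And>u. u \<in> U \<Longrightarrow> \<iota> u \<in> C_infinity"
proof -
  show V: "V \<in> J_objects" and i: "\<iota> \<in> isometries U V" and e: "e \<in> V" and ee: "cinner e e = 1"
    and "\<And>u. u \<in> U \<Longrightarrow> cinner (\<iota> u) e = 0"
    using VU by (auto simp: is_plus_C_def)
  show "e \<in> C_infinity" using e J_objectsD(2)[OF V] by blast
  show "nsq e = 1" using ee by (simp add: nsq_def)
  show "\<And>u. u \<in> U \<Longrightarrow> \<iota> u \<in> V" "\<And>u. u \<in> U \<Longrightarrow> \<iota> u \<in> C_infinity"
    using isometry_in[OF U V i] isometry_C[OF U V i] by blast+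
qed

lemma plus_C_decompose:
  assumes "v \<in> V"
  obtains u c where "u \<in> U" "v = \<iota> u + cscale c e" "c = cinner v e"
proof -
  have "V = {\<iota> u + cscale c e | u c. u \<in> U}" using VU by (simp add: is_plus_C_def)
  then obtain u c where u: "u \<in> U" "v = \<iota> u + cscale c e" using assms by blast
  then have "cinner v e = c"
    using plus_C_facts by (simp add: cinner_linear)
  then show ?thesis using that u by blast
qed

lemma fibre_incl_gamma:
  assumes z: "\<forall>i\<ge>m. z i = 0"
  shows "(\<iota>, \<lambda>i. cscale (z i) e) \<in> gamma m U V" "jsize (\<lambda>i. cscale (z i) e) = nsq z"
proof -
  note p = plus_C_facts
  show "(\<iota>, \<lambda>i. cscale (z i) e) \<in> gamma m U V"
    unfolding gamma_def using p z
    by (auto simp: cinner_scale_right J_objects_scale)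
  have "jsize (\<lambda>i. cscale (z i) e) = (\<Sum>i<m. nsq (cscale (z i) e))"
    using z by (intro jsize_eq_sum) auto
  also have "\<dots> = (\<Sum>i<m. (cmod (z i))\<^sup>2)"
    using p by (simp add: nsq_scale)
  also have "\<dots> = nsq z" using z by (intro nsq_eq_sum[symmetric]) auto
  finally show "jsize (\<lambda>i. cscale (z i) e) = nsq z" .
qed

lemma fibre_incl_in_jets:
  "s \<in> sphere_points m \<Longrightarrow> fibre_incl \<iota> e s \<in> jets m U V"
  using fibre_incl_gamma(1) by (auto simp: topspace_even_sphere fibre_incl_def Some_in_jets)

lemma fibre_incl_coord:
  assumes "s \<in> sphere_points m"
  shows "jet_coord k (fibre_incl \<iota> e s) = (case k of
      Weight \<Rightarrow> sphere_coord None s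
    | Map_coord u j \<Rightarrow> sphere_coord None s * \<iota> u j
    | Vec_coord i j \<Rightarrow> sphere_coord (Some i) s * e j)"
proof (cases s)
  case None
  then show ?thesis by (cases k) (auto simp: fibre_incl_def)
next
  case (Some z)
  then have "\<forall>i\<ge>m. z i = 0" using assms by (auto simp: topspace_even_sphere)
  then show ?thesis using Some fibre_incl_gamma(2)[of m z]
    by (cases k) (auto simp: fibre_incl_def cscale_def)
qed

lemma continuous_map_fibre_incl:
  "continuous_map (fst (even_sphere n)) (fst (J n U V)) (fibre_incl \<iota> e)"
proof (rule continuous_map_into_J[OF U plus_C_facts(1)])
  show "fibre_incl \<iota> e \<in> sphere_points n \<rightarrow> jets n U V"
    using fibre_incl_in_jets by blast
  show "continuous_map (fst (even_sphere n)) euclidean (\<lambda>s. jet_coord k (fibre_incl \<iota> e s))" for k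
    by (rule continuous_map_eq[OF _ fibre_incl_coord[symmetric]])
      (cases k; auto intro!: continuous_map_mult continuous_map_sphere_coord)
qed

lemma sphere_upd_in:
  "s \<in> sphere_points n \<Longrightarrow>
    map_option (\<lambda>z. z(n := c)) s \<in> sphere_points (n + 1)"
  by (auto simp: topspace_even_sphere)

lemma cone_jet_in_jets:
  "s \<in> sphere_points n \<Longrightarrow> cone_jet n \<iota> e t s \<in> jets (n + 1) U V"
  using fibre_incl_in_jets[OF sphere_upd_in] by (simp add: cone_jet_def)

text \<open>The choice of \<open>cone_height\<close> turns the additional weight into 1 - t. This
  factor makes the formulas valid at t = 1 too, where the cone jet is the base point.\<close>

lemma cone_jet_coord:
  assumes s: "s \<in> sphere_points n" and t: "t \<in> {0..1}"
  shows "jet_coord k (cone_jet n \<iota> e t s) = (case k of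
      Weight \<Rightarrow> of_real (1 - t) * sphere_coord None s
    | Map_coord u j \<Rightarrow> of_real (1 - t) * sphere_coord None s * \<iota> u j
    | Vec_coord i j \<Rightarrow> (if i = n then of_real ((1 - t) * cone_height t) * sphere_coord None s
        else of_real (1 - t) * sphere_coord (Some i) s) * e j)"
proof (cases "t < 1")
  case True
  show ?thesis
    using True t exp_cone_height[of t]
    by (cases k) (simp_all add: cone_jet_def fibre_incl_coord[OF sphere_upd_in[OF s]] sphere_coord_upd[OF s])
next
  case False
  then show ?thesis using t by (cases k) (simp_all add: cone_jet_def)
qed

lemma continuous_map_cone_jet:
  assumes t: "continuous_map T (top_of_set {0..1}) t" and s: "continuous_map T (fst (even_sphere n)) s"
  shows "continuous_map T (fst (J (n + 1) U V)) (\<lambda>x. cone_jet n \<iota> e (t x) (s x))"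
proof (rule continuous_map_into_J[OF U plus_C_facts(1)])
  have in_T: "s x \<in> sphere_points n" "t x \<in> {0..1}" if "x \<in> topspace T" for x
    using s t that by (auto simp: continuous_map_def)
  then show "(\<lambda>x. cone_jet n \<iota> e (t x) (s x)) \<in> topspace T \<rightarrow> jets (n + 1) U V"
    using cone_jet_in_jets by blast
  have cs: "continuous_map T euclidean (\<lambda>x. sphere_coord k (s x))" for k
    using continuous_map_compose[OF s continuous_map_sphere_coord] by (simp add: o_def)
  have ct: "continuous_map T euclidean (\<lambda>x. complex_of_real (h (t x)))" if "continuous_on {0..1} h" for h
  proof -
    have "continuous_map (top_of_set {0..1}) euclidean (\<lambda>x. complex_of_real (h x))"
      using that by (simp add: continuous_on_of_real)
    from continuous_map_compose[OF t this] show ?thesis by (simp add: o_def)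
  qed
  have c1: "continuous_map T euclidean (\<lambda>x. complex_of_real (1 - t x))"
    by (rule ct) (intro continuous_intros)
  note c2 = ct[OF continuous_on_cone_height]
  have cc: "continuous_map T euclidean (\<lambda>x. c)" for c :: complex by simp
  show "continuous_map T euclidean (\<lambda>x. jet_coord k (cone_jet n \<iota> e (t x) (s x)))" for k
  proof (rule continuous_map_eq[OF _ cone_jet_coord[OF in_T, symmetric]])
    show "continuous_map T euclidean (\<lambda>x. case k of
      Weight \<Rightarrow> of_real (1 - t x) * sphere_coord None (s x)
    | Map_coord u j \<Rightarrow> of_real (1 - t x) * sphere_coord None (s x) * \<iota> u j
    | Vec_coord i j \<Rightarrow> (if i = n then of_real ((1 - t x) * cone_height (t x)) * sphere_coord None (s x)
        else of_real (1 - t x) * sphere_coord (Some i) (s x)) * e j)"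
    proof (cases k)
      case (Vec_coord i j)
      then show ?thesis
        by (cases "i = n"; simp only: jet_index.case if_True if_False simp_thms)
          (intro continuous_map_mult c1 c2 cs cc)+
    qed (simp only: jet_index.case, intro continuous_map_mult c1 c2 cs cc)+
  qed
qed

lemma jet_comp_cone_jet:
  assumes \<psi>: "(g, y) \<in> gamma n V W" and W: "W \<in> J_objects" and t: "t < 1"
  shows "jet_comp (Some (g, y)) (cone_jet n \<iota> e t (Some z)) =
    Some (g \<circ> \<iota>, \<lambda>i. y i + cscale ((z(n := of_real (cone_height t))) i) (g e))"
  using t isometry_scale[OF plus_C_facts(1) W gammaD(1)[OF \<psi>] plus_C_facts(3)]
  by (simp add: cone_jet_def fibre_incl_def)

text \<open>The last vector of the composite is \<open>cone_height t\<close> times a unit vector,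
  and it vanishes for a jet of \<open>jets n U W\<close>. So the cone meets its base only at height
  zero and in the collapsed points.\<close>

lemma jet_comp_cone_jet_in_jets:
  assumes W: "W \<in> J_objects" and \<psi>: "\<psi> \<in> jets n V W" and t: "t \<in> {0..1}"
    and s: "s \<in> sphere_points n"
    and c: "jet_comp \<psi> (cone_jet n \<iota> e t s) \<in> jets n U W"
  shows "\<psi> = None \<or> s = None \<or> t = 1 \<or> t = 0"
proof (rule ccontr)
  assume n: "\<not> ?thesis"
  then obtain g y z where gz: "\<psi> = Some (g, y)" "s = Some z" by auto
  have gy: "(g, y) \<in> gamma n V W" using \<psi> gz by (simp add: Some_in_jets)
  have t: "0 < t" "t < 1" using n t by auto
  have "(g \<circ> \<iota>, \<lambda>i. y i + cscale ((z(n := of_real (cone_height t))) i) (g e)) \<in> gamma n U W"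
    using c jet_comp_cone_jet[OF gy W t(2)] gz by (simp add: Some_in_jets)
  then have "cscale (of_real (cone_height t)) (g e) = 0"
    using gammaD(4)[of _ _ n U W n] gammaD(4)[OF gy, of n] by fastforce
  moreover have "nsq (g e) = 1"
    using isometry_nsq[OF plus_C_facts(1) W gammaD(1)[OF gy] plus_C_facts(3)] plus_C_facts(5) by simp
  moreover have "g e \<in> C_infinity"
    using isometry_C[OF plus_C_facts(1) W gammaD(1)[OF gy] plus_C_facts(3)] .
  ultimately have "cone_height t = 0"
    using nsq_scale[of "g e" "of_real (cone_height t)"] by auto
  then show False using exp_cone_height[of t] t by simp
qed

text \<open>All data can be read off from the composite: the norm of the last vector determines
  \<open>t\<close>, and its direction is \<open>g e\<close>. As \<open>V\<close> is spanned by the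
  image of \<iota> and \<open>e\<close>, this and the restriction along \<iota> determine
  \<open>g\<close>. Each \<open>y i\<close> is orthogonal to \<open>g e\<close>, so pairing with
  \<open>g e\<close> isolates \<open>z i\<close>, and \<open>y\<close> is the remainder.\<close>

lemma jet_comp_cone_jet_inject:
  assumes W: "W \<in> J_objects" and \<psi>: "\<psi> \<in> jets n V W" "\<psi>' \<in> jets n V W" and t: "t \<in> {0..1}" "t' \<in> {0..1}"
    and s: "s \<in> sphere_points n" "s' \<in> sphere_points n"
    and c: "jet_comp \<psi> (cone_jet n \<iota> e t s) \<notin> jets n U W"
    and eq: "jet_comp \<psi> (cone_jet n \<iota> e t s) = jet_comp \<psi>' (cone_jet n \<iota> e t' s')"
  shows "\<psi> = \<psi>' \<and> t = t' \<and> s = s'"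
proof -
  note V = plus_C_facts(1)
  have some: "\<exists>g y z. \<psi> = Some (g, y) \<and> s = Some z \<and> 0 < t \<and> t < 1"
    if n: "jet_comp \<psi> (cone_jet n \<iota> e t s) \<notin> jets n U W" and \<psi>: "\<psi> \<in> jets n V W"
      and s: "s \<in> sphere_points n" and t: "t \<in> {0..1}" for \<psi> s t
  proof -
    have "\<psi> \<noteq> None" "s \<noteq> None" "t \<noteq> 1"
      using n by (metis jet_comp.simps(2) None_in_jets, metis cone_jet_None(1) jet_comp_None_right None_in_jets,
        metis cone_jet_None(2) jet_comp_None_right None_in_jets)
    then obtain p z where "\<psi> = Some p" "s = Some z" "t \<noteq> 1" by auto
    moreover have "t \<noteq> 0"
      using n jet_comp_in_jets[OF U V W \<psi> fibre_incl_in_jets[OF s]] cone_jet_0[OF s] by auto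
    ultimately show ?thesis using t by (cases p) auto
  qed
  obtain g y z where gz: "\<psi> = Some (g, y)" "s = Some z" "0 < t" "t < 1"
    using some[OF c \<psi>(1) s(1) t(1)] by blast
  obtain g' y' z' where gz': "\<psi>' = Some (g', y')" "s' = Some z'" "0 < t'" "t' < 1"
    using some[OF _ \<psi>(2) s(2) t(2)] c eq by metis
  have gy: "(g, y) \<in> gamma n V W" and gy': "(g', y') \<in> gamma n V W"
    using \<psi> gz gz' by (auto simp: Some_in_jets)
  note g = gammaD[OF gy] and g' = gammaD[OF gy']
  define r r' where "r = cone_height t" and "r' = cone_height t'"
  have e1: "g \<circ> \<iota> = g' \<circ> \<iota>"
    and "(\<lambda>i. y i + cscale ((z(n := of_real r)) i) (g e)) = (\<lambda>i. y' i + cscale ((z'(n := of_real r')) i) (g' e))"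
    using eq jet_comp_cone_jet[OF gy W gz(4)] jet_comp_cone_jet[OF gy' W gz'(4)] gz gz'
    by (auto simp: r_def r'_def)
  then have e2: "y i + cscale ((z(n := of_real r)) i) (g e) = y' i + cscale ((z'(n := of_real r')) i) (g' e)" for i
    by meson
  have C: "g e \<in> C_infinity" "g' e \<in> C_infinity" and n1: "nsq (g e) = 1" "nsq (g' e) = 1"
    using isometry_C[OF V W g(1) plus_C_facts(3)] isometry_C[OF V W g'(1) plus_C_facts(3)]
      isometry_nsq[OF V W g(1) plus_C_facts(3)] isometry_nsq[OF V W g'(1) plus_C_facts(3)]
      plus_C_facts(5) by auto
  have e3: "cscale (of_real r) (g e) = cscale (of_real r') (g' e)"
    using e2[of n] g(4)[of n] g'(4)[of n] by simp
  have "(cmod (of_real r))\<^sup>2 = (cmod (of_real r'))\<^sup>2"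
    using nsq_scale[OF C(1), of "of_real r"] nsq_scale[OF C(2), of "of_real r'"] e3 n1 by simp
  then have "exp (- r\<^sup>2) = exp (- r'\<^sup>2)" by simp
  then have tt: "t = t'"
    using exp_cone_height[of t] exp_cone_height[of t'] gz gz' by (simp add: r_def r'_def)
  have r0: "r \<noteq> 0"
    using exp_cone_height[of t] gz by (auto simp: r_def)
  have "r' = r" using tt by (simp add: r_def r'_def)
  then have ge: "g e = g' e" using e3 r0 by simp
  have gg: "g = g'"
  proof
    fix v show "g v = g' v"
    proof (cases "v \<in> V")
      case True
      then obtain u c where u: "u \<in> U" "v = \<iota> u + cscale c e" using plus_C_decompose by metis
      have "h v = h (\<iota> u) + cscale c (h e)" if "h \<in> isometries V W" for h
        unfolding u using isometry_add[OF V W that] isometry_scale[OF V W that] plus_C_facts u(1)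
        by (simp add: J_objects_scale)
      moreover have "g (\<iota> u) = g' (\<iota> u)" using e1 by (metis comp_apply)
      ultimately show ?thesis using g(1) g'(1) ge by simp
    next
      case False
      then show ?thesis using isometry_outside[OF V W g(1)] isometry_outside[OF V W g'(1)] by simp
    qed
  qed
  have z: "\<forall>i\<ge>n. z i = 0" "\<forall>i\<ge>n. z' i = 0"
    using s gz gz' by (auto simp: topspace_even_sphere)
  have zz: "z i = z' i" for i
  proof (cases "i < n")
    case True
    have yc: "y i \<in> C_infinity" "y' i \<in> C_infinity"
      using g(2)[OF W] g'(2)[OF W] J_objectsD(2)[OF W] by blast+
    have perp: "cinner (y i) (g e) = 0" "cinner (y' i) (g e) = 0"
      using cinner_commute[OF C(1) yc(1)] cinner_commute[OF C(1) yc(2)]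
        g(3)[OF plus_C_facts(3)] g'(3)[OF plus_C_facts(3)] ge by simp_all
    have "cinner (y i + cscale (z i) (g e)) (g e) = cinner (y' i + cscale (z' i) (g e)) (g e)"
      using e2[of i] True ge by simp
    then show ?thesis
      using perp yc C n1 by (simp add: cinner_linear cinner_self)
  qed (use z in \<open>simp add: not_less\<close>)
  have "y i = y' i" for i
    using e2[of i] zz[of i] ge tt by (simp add: r_def r'_def split: if_splits)
  then show ?thesis using gg zz tt gz gz' by (simp add: fun_eq_iff)
qed

text \<open>The extension of \<open>f\<close> is isometric because \<open>x n\<close> is orthogonal
  to the image of \<open>f\<close>. Splitting the other vectors \<open>x i\<close> along the unit
  vector \<open>E\<close> and its complement gives the sphere point \<open>z\<close> and the tuple
  \<open>y\<close>.\<close>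

lemma jet_comp_cone_jet_surj:
  assumes W: "W \<in> J_objects" and \<xi>: "\<xi> \<in> jets (n + 1) U W" "\<xi> \<notin> jets n U W"
  obtains \<psi> t s where "\<psi> \<in> jets n V W" "t \<in> {0..1}" "s \<in> sphere_points n"
    "\<xi> = jet_comp \<psi> (cone_jet n \<iota> e t s)"
proof -
  note V = plus_C_facts(1) and p = plus_C_facts
  obtain f x where fx: "\<xi> = Some (f, x)" using \<xi>(2) by (cases \<xi>) auto
  have g1: "(f, x) \<in> gamma (n + 1) U W" and g0: "(f, x) \<notin> gamma n U W"
    using \<xi> fx by (auto simp: Some_in_jets)
  note f = gammaD[OF g1]
  have xC: "x i \<in> C_infinity" for i using f(2)[OF W] J_objectsD(2)[OF W] by blast
  have "x n \<noteq> 0"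
  proof
    assume "x n = 0"
    then have "x i = 0" if "i \<ge> n" for i using that f(4)[of i] by (cases "i = n") auto
    then show False using g0 g1 by (auto simp: gamma_def)
  qed
  then have pos: "nsq (x n) > 0" using nsq_eq_0[OF xC] nsq_nonneg[of "x n"] by (simp add: less_le)
  define r where "r = sqrt (nsq (x n))"
  have r: "r > 0" "r\<^sup>2 = nsq (x n)" using pos by (auto simp: r_def)
  define E where "E = cscale (of_real (1 / r)) (x n)"
  have EW: "E \<in> W" unfolding E_def using W f(2)[OF W] by (rule J_objects_scale)
  then have EC: "E \<in> C_infinity" using J_objectsD(2)[OF W] by blast
  have "nsq E = 1"
    unfolding E_def nsq_scale[OF xC] using r pos by (simp add: power_divide norm_divide)
  then have EE: "cinner E E = 1" using cinner_self[OF EC] by simp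
  have fC: "f u \<in> C_infinity" if "u \<in> U" for u using isometry_C[OF U W f(1) that] .
  have fE: "cinner (f u) E = 0" if "u \<in> U" for u
    unfolding E_def using f(3)[OF that] by (simp add: cinner_scale_right xC fC that)
  have Ef: "cinner E (f u) = 0" if "u \<in> U" for u
    using cinner_commute[OF fC[OF that] EC] fE[OF that] by simp
  \<comment> \<open>The coefficient of \<open>e\<close> in \<open>v\<close> is
    \<open>cinner v e\<close>; what remains after removing that component is in the image of
    \<iota>.\<close>
  define g where "g v = (if v \<in> V then f (inv_into U \<iota> (v - cscale (cinner v e) e)) + cscale (cinner v e) E
    else 0)" for v
  have gv: "g (\<iota> u + cscale c e) = f u + cscale c E" if u: "u \<in> U" for u c
  proof -
    have "\<iota> u + cscale c e \<in> V" using p u by (intro J_objects_add J_objects_scale)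
    moreover have "cinner (\<iota> u + cscale c e) e = c"
      using p u by (simp add: cinner_linear)
    moreover have "inv_into U \<iota> (\<iota> u) = u" using isometry_inj[OF U V p(2)] u by simp
    ultimately show ?thesis unfolding g_def by simp
  qed
  have g: "g \<in> isometries V W"
    unfolding isometries_def
  proof (intro CollectI conjI ballI allI impI)
    fix v assume v: "v \<in> V"
    then obtain u c where u: "u \<in> U" "v = \<iota> u + cscale c e" using plus_C_decompose by metis
    show "g v \<in> W" unfolding u gv[OF u(1)]
      using isometry_in[OF U W f(1) u(1)] EW by (intro J_objects_add J_objects_scale W)
    show "g (cscale k v) = cscale k (g v)" for k
    proof -
      have "cscale k v = \<iota> (cscale k u) + cscale (k * c) e"
        unfolding u isometry_scale[OF U V p(2) u(1)] by (simp add: cscale_def fun_eq_iff algebra_simps)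
      then have "g (cscale k v) = f (cscale k u) + cscale (k * c) E"
        using gv J_objects_scale[OF U u(1)] by simp
      also have "\<dots> = cscale k (f u + cscale c E)"
        unfolding isometry_scale[OF U W f(1) u(1)] by (simp add: cscale_def fun_eq_iff algebra_simps)
      finally show ?thesis using gv[OF u(1)] u(2) by simp
    qed
    fix v' assume "v' \<in> V"
    then obtain u' c' where u': "u' \<in> U" "v' = \<iota> u' + cscale c' e" using plus_C_decompose by metis
    have "v + v' = \<iota> (u + u') + cscale (c + c') e"
      unfolding u u' isometry_add[OF U V p(2) u(1) u'(1)] by (simp add: cscale_def fun_eq_iff algebra_simps)
    then have "g (v + v') = f (u + u') + cscale (c + c') E"
      using gv J_objects_add[OF U u(1) u'(1)] by simp
    also have "\<dots> = g v + g v'"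
      unfolding u u' gv[OF u(1)] gv[OF u'(1)] isometry_add[OF U W f(1) u(1) u'(1)]
      by (simp add: cscale_def fun_eq_iff algebra_simps)
    finally show "g (v + v') = g v + g v'" .
    have ie: "cinner e (\<iota> u') = 0"
      using cinner_commute[OF p(9)[OF u'(1)] p(6)] p(7)[OF u'(1)] by simp
    have "cinner (g v) (g v') = cinner u u' + c * cnj c'"
      unfolding u u' gv[OF u(1)] gv[OF u'(1)]
      using isometry_cinner[OF U W f(1) u(1) u'(1)] fE[OF u(1)] Ef[OF u'(1)] EE fC u(1) u'(1) EC
      by (simp add: cinner_linear)
    moreover have "cinner v v' = cinner u u' + c * cnj c'"
      unfolding u u'
      using isometry_cinner[OF U V p(2) u(1) u'(1)] ie p u(1) u'(1)
      by (simp add: cinner_linear)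
    ultimately show "cinner (g v) (g v') = cinner v v'" by simp
  qed (simp add: g_def)
  define z where "z i = (if i < n then cinner (x i) E else 0)" for i
  define y where "y i = (if i < n then x i - cscale (z i) E else 0)" for i
  have y: "(g, y) \<in> gamma n V W"
    unfolding gamma_def
  proof (intro CollectI case_prodI conjI g allI impI ballI)
    fix i assume i: "i < n"
    have y': "y i = x i + cscale (- z i) E" using i by (simp add: y_def cscale_def fun_eq_iff)
    show "y i \<in> W" unfolding y' by (intro J_objects_add J_objects_scale W f(2) EW)
    fix v assume "v \<in> V"
    then obtain u c where u: "u \<in> U" "v = \<iota> u + cscale c e" using plus_C_decompose by metis
    have "cinner E (x i) = cnj (z i)" using cinner_commute[OF xC EC] i by (simp add: z_def)
    then show "cinner (g v) (y i) = 0"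
      unfolding y' u gv[OF u(1)]
      using f(3)[OF u(1)] fE[OF u(1)] EE fC[OF u(1)] EC xC
      by (simp add: cinner_linear del: cvec.scale_minus_left)
  qed (simp add: y_def)
  define t where "t = 1 - exp (- r\<^sup>2)"
  have t: "0 < t" "t < 1" "cone_height t = r"
    using cone_height_inverse[of r] r(1) by (simp_all add: t_def)
  have ge: "g e = E" using gv[OF J_objects_zero[OF U], of 1] isometry_zero[OF U V p(2)]
      isometry_zero[OF U W f(1)] by simp
  have gi: "g \<circ> \<iota> = f"
  proof
    fix u show "(g \<circ> \<iota>) u = f u"
    proof (cases "u \<in> U")
      case True
      then show ?thesis using gv[OF True, of 0] by simp
    next
      case False
      then show ?thesis using isometry_outside[OF U V p(2)] isometry_outside[OF U W f(1)]
          isometry_zero[OF V W g] by simp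
    qed
  qed
  have "y i + cscale ((z(n := of_real r)) i) E = x i" for i
  proof -
    consider "i < n" | "i = n" | "i > n" by linarith
    then show ?thesis
    proof cases
      case 2
      then show ?thesis using r by (simp add: y_def E_def)
    qed (auto simp: y_def z_def f(4))
  qed
  then have "\<xi> = jet_comp (Some (g, y)) (cone_jet n \<iota> e t (Some z))"
    unfolding fx jet_comp_cone_jet[OF y W t(2)] t(3) ge gi by simp
  then show ?thesis
    using that[of "Some (g, y)" t "Some z"] y t by (auto simp: Some_in_jets topspace_even_sphere z_def)
qed

end

subsection \<open>Spaces of natural transformations\<close>

lemma E_object:
  assumes "F \<in> E k" "W \<in> J_objects"
  shows "hausdorff_images (fst (ob F W))" "compactly_generated (fst (ob F W))"
    "snd (ob F W) \<in> topspace (fst (ob F W))"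
proof -
  have "ob F W \<in> Top_based" using assms by (simp add: E_def)
  then have "weak_Hausdorff (fst (ob F W)) \<and> compactly_generated (fst (ob F W)) \<and>
    snd (ob F W) \<in> topspace (fst (ob F W))"
    by (simp add: Top_based_def split_beta)
  then show "hausdorff_images (fst (ob F W))" "compactly_generated (fst (ob F W))"
    "snd (ob F W) \<in> topspace (fst (ob F W))"
    by (simp_all add: weak_Hausdorff_hausdorff_images)
qed

lemma E_act:
  assumes F: "F \<in> E k" and UV: "U \<in> J_objects" "V \<in> J_objects"
  shows "continuous_map (fst (J k U V)) (fst (Map_based (ob F U) (ob F V))) (act F U V)"
    "act F U V None = const_map (ob F U) (ob F V)"
    "\<phi> \<in> jets k U V \<Longrightarrow> act F U V \<phi> \<in> cmaps (fst (ob F U)) (fst (ob F V))"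
    "\<phi> \<in> jets k U V \<Longrightarrow> act F U V \<phi> (snd (ob F U)) = snd (ob F V)"
    "\<phi> \<in> jets k U V \<Longrightarrow> a \<in> topspace (fst (ob F U)) \<Longrightarrow> act F U V \<phi> a \<in> topspace (fst (ob F V))"
proof -
  have b: "based_map (J k U V) (Map_based (ob F U) (ob F V)) (act F U V)"
    using assms by (auto simp: E_def)
  then show c: "continuous_map (fst (J k U V)) (fst (Map_based (ob F U) (ob F V))) (act F U V)"
    by (simp add: based_map_def)
  show "act F U V None = const_map (ob F U) (ob F V)"
    using b by (simp add: based_map_def snd_Map_based J_def)
  assume "\<phi> \<in> jets k U V"
  then have "act F U V \<phi> \<in> topspace (fst (Map_based (ob F U) (ob F V)))"
    using c by (auto simp: continuous_map_def)
  then show *: "act F U V \<phi> \<in> cmaps (fst (ob F U)) (fst (ob F V))"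
    and "act F U V \<phi> (snd (ob F U)) = snd (ob F V)"
    by (auto simp: topspace_Map_based)
  then show "act F U V \<phi> a \<in> topspace (fst (ob F V))" if "a \<in> topspace (fst (ob F U))"
    using that by (auto simp: cmaps_def continuous_map_def)
qed

lemma E_comp:
  assumes "F \<in> E k" "U \<in> J_objects" "V \<in> J_objects" "W \<in> J_objects"
    "\<phi> \<in> jets k U V" "\<psi> \<in> jets k V W" "a \<in> topspace (fst (ob F U))"
  shows "act F U W (jet_comp \<psi> \<phi>) a = act F V W \<psi> (act F U V \<phi> a)"
  using assms by (auto simp: E_def)

lemma E_id:
  assumes "F \<in> E k" "U \<in> J_objects" "a \<in> topspace (fst (ob F U))"
  shows "act F U U (jet_id U) a = a"
  using assms by (auto simp: E_def)

text \<open>Maps from compact spaces to a Hausdorff space are closed, so the preimage of a closed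
  set under \<open>G\<close> is a union of two closed images. This stands in for the universal
  property of the mapping cone.\<close>

lemma continuous_map_from_two_compact:
  assumes Q: "compact_space Q1" "compact_space Q2" and X: "Hausdorff_space X"
    and q: "continuous_map Q1 X q1" "continuous_map Q2 X q2"
    and cover: "topspace X \<subseteq> q1 ` topspace Q1 \<union> q2 ` topspace Q2"
    and G: "continuous_map Q1 Y (\<lambda>x. G (q1 x))" "continuous_map Q2 Y (\<lambda>x. G (q2 x))"
  shows "continuous_map X Y G"
  unfolding continuous_map_closedin
proof (intro conjI allI impI)
  show "G \<in> topspace X \<rightarrow> topspace Y"
  proof
    fix x assume "x \<in> topspace X"
    then consider y where "y \<in> topspace Q1" "x = q1 y" | y where "y \<in> topspace Q2" "x = q2 y"
      using cover by blast
    then show "G x \<in> topspace Y"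
      using G by cases (auto simp: continuous_map_def)
  qed
  fix C assume C: "closedin Y C"
  have "closedin X (q1 ` {x \<in> topspace Q1. G (q1 x) \<in> C})"
    using continuous_imp_closed_map[OF q(1) Q(1) X] closedin_continuous_map_preimage[OF G(1) C]
    by (simp add: closed_map_def)
  moreover have "closedin X (q2 ` {x \<in> topspace Q2. G (q2 x) \<in> C})"
    using continuous_imp_closed_map[OF q(2) Q(2) X] closedin_continuous_map_preimage[OF G(2) C]
    by (simp add: closed_map_def)
  ultimately have "closedin X (q1 ` {x \<in> topspace Q1. G (q1 x) \<in> C} \<union> q2 ` {x \<in> topspace Q2. G (q2 x) \<in> C})"
    by (rule closedin_Un)
  moreover have "{x \<in> topspace X. G x \<in> C} =
    q1 ` {x \<in> topspace Q1. G (q1 x) \<in> C} \<union> q2 ` {x \<in> topspace Q2. G (q2 x) \<in> C}"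
    using cover continuous_map_image_subset_topspace[OF q(1)] continuous_map_image_subset_topspace[OF q(2)]
    by blast
  ultimately show "closedin X {x \<in> topspace X. G x \<in> C}" by simp
qed

text \<open>By definition the value of \<open>ind k n F\<close> at \<open>V\<close>. Keeping
  \<open>k\<close> and \<open>n\<close> apart covers the Yoneda case k = n, the derivative k = 0 and
  the source of the fibre sequence at once.\<close>

definition jet_Nat :: "nat \<Rightarrow> nat \<Rightarrow> cvec set \<Rightarrow> 'a jet_functor \<Rightarrow> (cvec set \<Rightarrow> jet \<Rightarrow> 'a) based"
  where "jet_Nat k n V F = Nat k (res k (representable n V)) F"

lemma topspace_jet_Nat_eq:
  "topspace (fst (jet_Nat k n V F)) = natural_transformations k (res k (representable n V)) F"
proof -
  have "natural_transformations k (res k (representable n V)) F \<subseteq>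
    topspace (product_topology (\<lambda>W. fst (Map_based (ob (res k (representable n V)) W) (ob F W))) J_objects)"
    by (auto simp: natural_transformations_def)
  then show ?thesis by (auto simp: jet_Nat_def Nat_def)
qed

lemma in_jet_Nat_iff:
  assumes kn: "k \<le> n"
  shows "\<beta> \<in> topspace (fst (jet_Nat k n V F)) \<longleftrightarrow>
    \<beta> \<in> extensional J_objects \<and>
    (\<forall>W\<in>J_objects. \<beta> W \<in> cmaps (fst (J n V W)) (fst (ob F W)) \<and> \<beta> W None = snd (ob F W)) \<and>
    (\<forall>W\<in>J_objects. \<forall>X\<in>J_objects. \<forall>\<phi>\<in>jets k W X. \<forall>\<psi>\<in>jets n V W.
      \<beta> X (jet_comp \<phi> \<psi>) = act F W X \<phi> (\<beta> W \<psi>))"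
proof -
  have "act (res k (representable n V)) W X \<phi> \<psi> = jet_comp \<phi> \<psi>"
    if "\<phi> \<in> jets k W X" "\<psi> \<in> jets n V W" for W X \<phi> \<psi>
    using that by (simp add: res_def representable_def jet_incl_id)
  moreover have "ob (res k (representable n V)) = J n V" by (simp add: res_def representable_def)
  moreover have "snd (J n V W) = None" for W by (simp add: J_def)
  ultimately show ?thesis
    unfolding topspace_jet_Nat_eq natural_transformations_def
    by (auto simp: PiE_iff topspace_Map_based)
qed

lemma snd_jet_Nat: "snd (jet_Nat k n V F) = (\<lambda>W\<in>J_objects. \<lambda>\<psi>\<in>jets n V W. snd (ob F W))"
  by (simp add: jet_Nat_def Nat_def res_def representable_def const_map_def)

lemma hausdorff_images_jet_Nat:
  assumes "F \<in> E k"
  shows "hausdorff_images (fst (jet_Nat k n V F))"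
  unfolding jet_Nat_def Nat_def fst_conv
  by (intro hausdorff_images_kify hausdorff_images_subtopology hausdorff_images_product
      hausdorff_images_Map_based E_object(1)[OF assms])

lemma compactly_generated_jet_Nat: "compactly_generated (fst (jet_Nat k n V F))"
  by (simp add: jet_Nat_def Nat_def)

text \<open>Currying at each object; compactness of \<open>K\<close> allows passage to the k-ified
  topologies, first of the mapping spaces and then of the end.\<close>

lemma continuous_map_into_jet_Nat:
  assumes F: "F \<in> E k" and K: "compact_space K" "Hausdorff_space K"
    and \<beta>: "\<And>x. x \<in> topspace K \<Longrightarrow> \<beta> x \<in> topspace (fst (jet_Nat k n V F))"
    and c: "\<And>W. W \<in> J_objects \<Longrightarrow>
      continuous_map (prod_topology K (fst (J n V W))) (fst (ob F W)) (\<lambda>(x, \<psi>). \<beta> x W \<psi>)"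
  shows "continuous_map K (fst (jet_Nat k n V F)) \<beta>"
proof -
  let ?G = "res k (representable n V)"
  let ?Y = "subtopology (product_topology (\<lambda>W. fst (Map_based (ob ?G W) (ob F W))) J_objects)
    (natural_transformations k ?G F)"
  have G: "ob ?G = J n V" by (simp add: res_def representable_def)
  have \<beta>': "\<beta> x \<in> natural_transformations k ?G F" if "x \<in> topspace K" for x
    using \<beta>[OF that] by (simp add: topspace_jet_Nat_eq)
  have \<beta>e: "\<beta> x \<in> (\<Pi>\<^sub>E W\<in>J_objects. topspace (fst (Map_based (J n V W) (ob F W))))" if "x \<in> topspace K" for x
    using \<beta>'[OF that] by (simp add: natural_transformations_def G)
  have comp: "continuous_map K (fst (Map_based (J n V W) (ob F W))) (\<lambda>x. \<beta> x W)"
    if W: "W \<in> J_objects" for W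
  proof (rule continuous_map_into_Map_based)
    have *: "\<beta> x W \<in> topspace (fst (Map_based (J n V W) (ob F W)))" if "x \<in> topspace K" for x
      using \<beta>e[OF that] W by (rule PiE_mem)
    then show "\<beta> x W \<in> extensional (jets n V W)" "\<beta> x W (snd (J n V W)) = snd (ob F W)"
      if "x \<in> topspace K" for x
      using that by (auto simp: topspace_Map_based cmaps_def)
  qed (use c[OF W] K E_object[OF F W] in auto)
  show ?thesis
    unfolding jet_Nat_def Nat_def fst_conv
  proof (rule continuous_map_into_kify[OF _ K])
    show "hausdorff_images ?Y"
      by (intro hausdorff_images_subtopology hausdorff_images_product
          hausdorff_images_Map_based E_object(1)[OF F])
    show "continuous_map K ?Y \<beta>"
      unfolding continuous_map_in_subtopology continuous_map_componentwise G
      using comp \<beta>' \<beta>e by (auto simp: PiE_iff)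
  qed
qed

text \<open>Thom spaces are compact Hausdorff, so evaluation of a transformation at a jet is jointly
  continuous.\<close>

lemma continuous_map_jet_Nat_eval:
  assumes V: "V \<in> J_objects" and W: "W \<in> J_objects"
    and \<alpha>: "continuous_map T (fst (jet_Nat k n V F)) \<alpha>" and \<psi>: "continuous_map T (fst (J n V W)) \<psi>"
  shows "continuous_map T (fst (ob F W)) (\<lambda>t. \<alpha> t W (\<psi> t))"
proof (rule continuous_map_eval_compact[OF _ \<psi> compact_space_J Hausdorff_space_J[OF V W]])
  let ?G = "res k (representable n V)"
  have G: "ob ?G = J n V" by (simp add: res_def representable_def)
  have "continuous_map T (product_topology (\<lambda>W. fst (Map_based (J n V W) (ob F W))) J_objects) \<alpha>"
    using \<alpha> continuous_map_kifyD continuous_map_into_fulltopology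
    unfolding jet_Nat_def Nat_def fst_conv G by blast
  then have "continuous_map T (fst (Map_based (J n V W) (ob F W))) (\<lambda>t. \<alpha> t W)"
    using W by (simp add: continuous_map_componentwise)
  then show "continuous_map T (compact_open (fst (J n V W)) (fst (ob F W))) (\<lambda>t. \<alpha> t W)"
    by (rule continuous_map_from_Map_based)
qed

text \<open>Here \<open>\<alpha>\<close> is a transformation from \<open>J m U -\<close> to \<open>F\<close> for some \<open>m \<ge> n\<close>, and \<open>\<xi>\<close> is a jet in \<open>jets m U V\<close>.\<close>

definition precomp :: "nat \<Rightarrow> cvec set \<Rightarrow> (cvec set \<Rightarrow> jet \<Rightarrow> 'a) \<Rightarrow> jet \<Rightarrow> (cvec set \<Rightarrow> jet \<Rightarrow> 'a)"
  where "precomp n V \<alpha> \<xi> = (\<lambda>W\<in>J_objects. \<lambda>\<psi>\<in>jets n V W. \<alpha> W (jet_comp \<psi> \<xi>))"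

lemma precomp_apply:
  "W \<in> J_objects \<Longrightarrow> \<psi> \<in> jets n V W \<Longrightarrow> precomp n V \<alpha> \<xi> W \<psi> = \<alpha> W (jet_comp \<psi> \<xi>)"
  by (simp add: precomp_def)

lemma continuous_map_jet_precomp:
  assumes "n \<le> m" "U \<in> J_objects" "V \<in> J_objects" "W \<in> J_objects"
    "continuous_map T (fst (J n V W)) \<psi>" "continuous_map T (fst (J m U V)) \<xi>"
  shows "continuous_map T (fst (J m U W)) (\<lambda>t. jet_comp (\<psi> t) (\<xi> t))"
  using continuous_map_jet_comp[OF assms(2-4) continuous_map_jets_mono[OF assms(1,3,4,5)] assms(6)] .

text \<open>Naturality is associativity of composition. The main case is m = n + 1: a cone jet
  belongs to the larger category, yet precomposition with it yields a transformation out of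
  \<open>J n V -\<close>.\<close>

lemma precomp_in_jet_Nat:
  assumes k: "k \<le> n" "n \<le> m" and U: "U \<in> J_objects" and V: "V \<in> J_objects"
    and \<alpha>: "\<alpha> \<in> topspace (fst (jet_Nat k m U F))" and \<xi>: "\<xi> \<in> jets m U V"
  shows "precomp n V \<alpha> \<xi> \<in> topspace (fst (jet_Nat k n V F))"
  unfolding in_jet_Nat_iff[OF k(1)]
proof (intro conjI ballI)
  have km: "k \<le> m" using k by simp
  note a = \<alpha>[unfolded in_jet_Nat_iff[OF km]]
  show "precomp n V \<alpha> \<xi> \<in> extensional J_objects" by (simp add: precomp_def)
  fix W assume W: "W \<in> J_objects"
  have "continuous_map (fst (J n V W)) (fst (J m U W)) (\<lambda>\<psi>. jet_comp \<psi> \<xi>)"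
    using \<xi> by (intro continuous_map_jet_precomp[OF k(2) U V W]) (auto simp: continuous_map_id[unfolded id_def])
  moreover have aW: "continuous_map (fst (J m U W)) (fst (ob F W)) (\<alpha> W)" "\<alpha> W None = snd (ob F W)"
    using a W by (auto simp: cmaps_def)
  ultimately have "continuous_map (fst (J n V W)) (fst (ob F W)) (\<lambda>\<psi>. \<alpha> W (jet_comp \<psi> \<xi>))"
    using continuous_map_compose by (fastforce simp: o_def)
  then have "continuous_map (fst (J n V W)) (fst (ob F W)) (precomp n V \<alpha> \<xi> W)"
    by (rule continuous_map_eq) (simp add: precomp_apply W)
  then show "precomp n V \<alpha> \<xi> W \<in> cmaps (fst (J n V W)) (fst (ob F W))"
    using W by (simp add: cmaps_def precomp_def)
  show "precomp n V \<alpha> \<xi> W None = snd (ob F W)"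
    using aW W by (simp add: precomp_apply)
  fix X \<phi> \<psi> assume X: "X \<in> J_objects" and \<phi>: "\<phi> \<in> jets k W X" and \<psi>: "\<psi> \<in> jets n V W"
  have \<phi>n: "\<phi> \<in> jets n W X" and \<phi>m: "\<phi> \<in> jets m W X" and \<psi>m: "\<psi> \<in> jets m V W"
    using \<phi> \<psi> jets_mono X W k km by blast+
  have "jet_comp \<phi> \<psi> \<in> jets n V X" using jet_comp_in_jets[OF V W X \<phi>n \<psi>] .
  then have "precomp n V \<alpha> \<xi> X (jet_comp \<phi> \<psi>) = \<alpha> X (jet_comp \<phi> (jet_comp \<psi> \<xi>))"
    using X jet_comp_assoc[OF U V W X \<phi>m \<psi>m \<xi>] by (simp add: precomp_apply)
  also have "\<dots> = act F W X \<phi> (\<alpha> W (jet_comp \<psi> \<xi>))"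
    using a W X \<phi> jet_comp_in_jets[OF U V W \<psi>m \<xi>] by blast
  finally show "precomp n V \<alpha> \<xi> X (jet_comp \<phi> \<psi>) = act F W X \<phi> (precomp n V \<alpha> \<xi> W \<psi>)"
    using W \<psi> by (simp add: precomp_apply)
qed

lemma continuous_map_precomp:
  assumes F: "F \<in> E k" and k: "k \<le> n" "n \<le> m" and U: "U \<in> J_objects" and V: "V \<in> J_objects"
    and K: "compact_space K" "Hausdorff_space K"
    and \<alpha>: "continuous_map K (fst (jet_Nat k m U F)) \<alpha>" and \<xi>: "continuous_map K (fst (J m U V)) \<xi>"
  shows "continuous_map K (fst (jet_Nat k n V F)) (\<lambda>x. precomp n V (\<alpha> x) (\<xi> x))"
proof (rule continuous_map_into_jet_Nat[OF F K])
  show "precomp n V (\<alpha> x) (\<xi> x) \<in> topspace (fst (jet_Nat k n V F))" if "x \<in> topspace K" for x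
    using \<alpha> \<xi> that by (intro precomp_in_jet_Nat[OF k U V]) (auto simp: continuous_map_def)
  fix W assume W: "W \<in> J_objects"
  let ?P = "prod_topology K (fst (J n V W))"
  have \<alpha>': "continuous_map ?P (fst (jet_Nat k m U F)) (\<alpha> \<circ> fst)"
    and \<xi>': "continuous_map ?P (fst (J m U V)) (\<xi> \<circ> fst)"
    using continuous_map_compose[OF continuous_map_fst \<alpha>] continuous_map_compose[OF continuous_map_fst \<xi>] .
  have "continuous_map ?P (fst (ob F W)) (\<lambda>p. (\<alpha> \<circ> fst) p W (jet_comp (snd p) ((\<xi> \<circ> fst) p)))"
    by (rule continuous_map_jet_Nat_eval[OF U W \<alpha>' continuous_map_jet_precomp[OF k(2) U V W continuous_map_snd \<xi>']])
  then show "continuous_map ?P (fst (ob F W)) (\<lambda>(x, \<psi>). precomp n V (\<alpha> x) (\<xi> x) W \<psi>)"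
    by (rule continuous_map_eq) (auto simp: precomp_apply W)
qed

lemmas compact_Hausdorff_simps = compact_space_prod_topology Hausdorff_space_prod_topology
  compact_space_subtopology Hausdorff_space_subtopology

text \<open>Based spaces \<open>B V\<close> that are homeomorphic, through \<open>R V\<close>, to the spaces of transformations
  \<open>J n V - \<rightarrow> F\<close> of functors on \<open>J k\<close>, where \<open>T V W \<psi> b\<close> is the value at \<open>\<psi>\<close> of the transformation
  corresponding to \<open>b\<close>.  For \<open>k = n\<close> the values of \<open>F\<close> are of this kind by the Yoneda lemma, and for
  \<open>k = 0\<close> so are those of the \<open>n\<close>-th derivative by definition.\<close>

locale jet_module =
  fixes k n :: nat and F :: "'a jet_functor" and B :: "cvec set \<Rightarrow> 'b based"
    and T :: "cvec set \<Rightarrow> cvec set \<Rightarrow> jet \<Rightarrow> 'b \<Rightarrow> 'a" and R :: "cvec set \<Rightarrow> (cvec set \<Rightarrow> jet \<Rightarrow> 'a) \<Rightarrow> 'b"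
  assumes kn: "k \<le> n" and F: "F \<in> E k"
    and B_hausdorff_images: "V \<in> J_objects \<Longrightarrow> hausdorff_images (fst (B V))"
    and B_compactly_generated: "V \<in> J_objects \<Longrightarrow> compactly_generated (fst (B V))"
    and B_base: "V \<in> J_objects \<Longrightarrow> snd (B V) \<in> topspace (fst (B V))"
    and T_continuous_on_compact: "V \<in> J_objects \<Longrightarrow> W \<in> J_objects \<Longrightarrow> compact_Hausdorff_in (fst (B V)) L \<Longrightarrow>
      continuous_map (prod_topology (fst (J n V W)) (subtopology (fst (B V)) L)) (fst (ob F W)) (\<lambda>(\<psi>, b). T V W \<psi> b)"
    and T_None: "V \<in> J_objects \<Longrightarrow> W \<in> J_objects \<Longrightarrow> b \<in> topspace (fst (B V)) \<Longrightarrow> T V W None b = snd (ob F W)"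
    and T_base: "V \<in> J_objects \<Longrightarrow> W \<in> J_objects \<Longrightarrow> \<psi> \<in> jets n V W \<Longrightarrow> T V W \<psi> (snd (B V)) = snd (ob F W)"
    and T_natural: "V \<in> J_objects \<Longrightarrow> W \<in> J_objects \<Longrightarrow> X \<in> J_objects \<Longrightarrow> \<phi> \<in> jets k W X \<Longrightarrow> \<psi> \<in> jets n V W \<Longrightarrow>
      b \<in> topspace (fst (B V)) \<Longrightarrow> T V X (jet_comp \<phi> \<psi>) b = act F W X \<phi> (T V W \<psi> b)"
    and R_continuous: "V \<in> J_objects \<Longrightarrow> continuous_map (fst (jet_Nat k n V F)) (fst (B V)) (R V)"
    and T_R: "V \<in> J_objects \<Longrightarrow> W \<in> J_objects \<Longrightarrow> \<beta> \<in> topspace (fst (jet_Nat k n V F)) \<Longrightarrow> \<psi> \<in> jets n V W \<Longrightarrow>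
      T V W \<psi> (R V \<beta>) = \<beta> W \<psi>"
    and R_T: "V \<in> J_objects \<Longrightarrow> b \<in> topspace (fst (B V)) \<Longrightarrow>
      R V (\<lambda>W\<in>J_objects. \<lambda>\<psi>\<in>jets n V W. T V W \<psi> b) = b"
begin

definition trans where "trans V b = (\<lambda>W\<in>J_objects. \<lambda>\<psi>\<in>jets n V W. T V W \<psi> b)"

text \<open>The locale asks for continuity of \<open>T\<close> over compact Hausdorff parts of
  \<open>B V\<close> only, and the image of \<open>K\<close> under \<open>b\<close> is such a
  part.\<close>

lemma T_continuous:
  assumes V: "V \<in> J_objects" and W: "W \<in> J_objects" and K: "compact_space K" "Hausdorff_space K"
    and \<psi>: "continuous_map K (fst (J n V W)) \<psi>" and b: "continuous_map K (fst (B V)) b"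
  shows "continuous_map K (fst (ob F W)) (\<lambda>x. T V W (\<psi> x) (b x))"
proof -
  let ?L = "b ` topspace K"
  have L: "compact_Hausdorff_in (fst (B V)) ?L"
    using hausdorff_images_compact[OF B_hausdorff_images[OF V] K b] .
  have "continuous_map K (subtopology (fst (B V)) ?L) b"
    using b by (simp add: continuous_map_in_subtopology)
  then have "continuous_map K (prod_topology (fst (J n V W)) (subtopology (fst (B V)) ?L)) (\<lambda>x. (\<psi> x, b x))"
    using \<psi> by (intro continuous_map_pairedI)
  from continuous_map_compose[OF this T_continuous_on_compact[OF V W L]]
  show ?thesis by (simp add: o_def)
qed

lemma trans_in_jet_Nat:
  assumes V: "V \<in> J_objects" and b: "b \<in> topspace (fst (B V))"
  shows "trans V b \<in> topspace (fst (jet_Nat k n V F))"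
  unfolding in_jet_Nat_iff[OF kn]
proof (intro conjI ballI)
  show "trans V b \<in> extensional J_objects" by (simp add: trans_def)
  fix W assume W: "W \<in> J_objects"
  have "continuous_map (fst (J n V W)) (fst (ob F W)) (\<lambda>\<psi>. T V W \<psi> b)"
    by (rule T_continuous[OF V W compact_space_J Hausdorff_space_J[OF V W]])
      (use b in \<open>auto simp: continuous_map_id[unfolded id_def]\<close>)
  then have "continuous_map (fst (J n V W)) (fst (ob F W)) (trans V b W)"
    by (rule continuous_map_eq) (simp add: trans_def W)
  then show "trans V b W \<in> cmaps (fst (J n V W)) (fst (ob F W))"
    using W by (simp add: cmaps_def trans_def)
  show "trans V b W None = snd (ob F W)" using T_None[OF V W b] W by (simp add: trans_def)
  fix X \<phi> \<psi> assume X: "X \<in> J_objects" and \<phi>: "\<phi> \<in> jets k W X" and \<psi>: "\<psi> \<in> jets n V W"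
  have "\<phi> \<in> jets n W X" using \<phi> jets_mono[OF kn X] by blast
  then have "jet_comp \<phi> \<psi> \<in> jets n V X" using jet_comp_in_jets[OF V W X _ \<psi>] by blast
  then show "trans V b X (jet_comp \<phi> \<psi>) = act F W X \<phi> (trans V b W \<psi>)"
    using T_natural[OF V W X \<phi> \<psi> b] W X \<psi> by (simp add: trans_def)
qed

lemma continuous_map_trans:
  assumes V: "V \<in> J_objects" and K: "compact_space K" "Hausdorff_space K"
    and b: "continuous_map K (fst (B V)) b"
  shows "continuous_map K (fst (jet_Nat k n V F)) (\<lambda>x. trans V (b x))"
proof (rule continuous_map_into_jet_Nat[OF F K])
  show "trans V (b x) \<in> topspace (fst (jet_Nat k n V F))" if "x \<in> topspace K" for x
    using b that by (intro trans_in_jet_Nat[OF V]) (auto simp: continuous_map_def)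
  fix W assume W: "W \<in> J_objects"
  let ?P = "prod_topology K (fst (J n V W))"
  have P: "compact_space ?P" "Hausdorff_space ?P"
    using K compact_space_J Hausdorff_space_J[OF V W]
    by (simp_all add: compact_Hausdorff_simps)
  have "continuous_map ?P (fst (ob F W)) (\<lambda>p. T V W (snd p) ((b \<circ> fst) p))"
    by (intro T_continuous[OF V W P] continuous_map_snd continuous_map_compose[OF continuous_map_fst b])
  then show "continuous_map ?P (fst (ob F W)) (\<lambda>(x, \<psi>). trans V (b x) W \<psi>)"
    by (rule continuous_map_eq) (auto simp: trans_def W)
qed

text \<open>Identities between points of \<open>B V\<close> are proved through this lemma, by
  comparing the values of the corresponding transformations.\<close>

lemma T_inject:
  assumes V: "V \<in> J_objects" and b: "b \<in> topspace (fst (B V))" "b' \<in> topspace (fst (B V))"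
    and eq: "\<And>W \<psi>. W \<in> J_objects \<Longrightarrow> \<psi> \<in> jets n V W \<Longrightarrow> T V W \<psi> b = T V W \<psi> b'"
  shows "b = b'"
proof -
  have "(\<lambda>W\<in>J_objects. \<lambda>\<psi>\<in>jets n V W. T V W \<psi> b) = (\<lambda>W\<in>J_objects. \<lambda>\<psi>\<in>jets n V W. T V W \<psi> b')"
    by (intro restrict_ext) (rule eq)
  from arg_cong[OF this, of "R V"] show ?thesis
    unfolding R_T[OF V b(1)] R_T[OF V b(2)] .
qed

lemma R_in: "V \<in> J_objects \<Longrightarrow> \<beta> \<in> topspace (fst (jet_Nat k n V F)) \<Longrightarrow> R V \<beta> \<in> topspace (fst (B V))"
  using R_continuous[of V] by (auto simp: continuous_map_def)

context
  fixes U V \<iota> e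
  assumes U: "U \<in> J_objects" and VU: "is_plus_C U V \<iota> e"
begin

text \<open>For \<alpha> = \<open>trans U b\<close> this is the action of the jet \<xi> on
  \<open>b\<close>, expressed without an action on \<open>B\<close>. For transformations out of
  \<open>J (n + 1) U -\<close> it accepts jets of the larger category as well, in particular cone
  jets.\<close>

definition along where "along X \<alpha> \<xi> = R X (precomp n X \<alpha> \<xi>)"

lemma V: "V \<in> J_objects"
  using plus_C_facts(1)[OF U VU] .

lemma along_in:
  assumes "n \<le> m" "X \<in> J_objects" "\<alpha> \<in> topspace (fst (jet_Nat k m U F))" "\<xi> \<in> jets m U X"
  shows "along X \<alpha> \<xi> \<in> topspace (fst (B X))"
  unfolding along_def by (intro R_in precomp_in_jet_Nat[OF kn assms(1) U assms(2-4)] assms(2))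

lemma T_along:
  assumes "n \<le> m" "X \<in> J_objects" "W \<in> J_objects" "\<alpha> \<in> topspace (fst (jet_Nat k m U F))" "\<xi> \<in> jets m U X"
    "\<psi> \<in> jets n X W"
  shows "T X W \<psi> (along X \<alpha> \<xi>) = \<alpha> W (jet_comp \<psi> \<xi>)"
  unfolding along_def
  using T_R[OF assms(2,3) precomp_in_jet_Nat[OF kn assms(1) U assms(2,4,5)] assms(6)] assms
  by (simp add: precomp_apply)

lemma continuous_map_along:
  assumes "n \<le> m" "X \<in> J_objects" "compact_space K" "Hausdorff_space K"
    "continuous_map K (fst (jet_Nat k m U F)) \<alpha>" "continuous_map K (fst (J m U X)) \<xi>"
  shows "continuous_map K (fst (B X)) (\<lambda>x. along X (\<alpha> x) (\<xi> x))"
  unfolding along_def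
  using continuous_map_compose[OF continuous_map_precomp[OF F kn assms(1) U assms(2-6)] R_continuous[OF assms(2)]]
  by (simp add: o_def)

lemma along_base:
  assumes "n \<le> m" "X \<in> J_objects" "\<alpha> \<in> topspace (fst (jet_Nat k m U F))" "\<xi> \<in> jets m U X"
    and base: "\<And>W \<psi>. W \<in> J_objects \<Longrightarrow> \<psi> \<in> jets n X W \<Longrightarrow> \<alpha> W (jet_comp \<psi> \<xi>) = snd (ob F W)"
  shows "along X \<alpha> \<xi> = snd (B X)"
  by (rule T_inject[OF assms(2) along_in[OF assms(1-4)] B_base[OF assms(2)]])
    (simp add: T_along[OF assms(1,2) _ assms(3,4)] base T_base[OF assms(2)])

lemma along_None:
  assumes "n \<le> m" "X \<in> J_objects" "\<alpha> \<in> topspace (fst (jet_Nat k m U F))"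
  shows "along X \<alpha> None = snd (B X)"
proof (rule along_base[OF assms])
  have "k \<le> m" using kn assms(1) by simp
  then show "\<alpha> W (jet_comp \<psi> None) = snd (ob F W)" if "W \<in> J_objects" for W \<psi>
    using assms(3) that by (simp add: in_jet_Nat_iff)
qed simp

section \<open>The maps of the fibre sequence and the null-homotopy\<close>

abbreviation "S \<equiv> even_sphere n"
abbreviation "I \<equiv> top_of_set {0..1::real}"
abbreviation "\<Omega> \<equiv> even_loops n (B V)"
abbreviation "A \<equiv> jet_Nat k (n + 1) U F"

definition structure_map where "structure_map b = (\<lambda>s\<in>sphere_points n. along V (trans U b) (fibre_incl \<iota> e s))"
definition restriction where "restriction \<alpha> = along U \<alpha> (jet_id U)"
text \<open>Moves up the cone: the cone jet is the fibre inclusion at t = 0 and the base point at t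
  = 1.\<close>

definition nullhomotopy where "nullhomotopy \<alpha> t = (\<lambda>s\<in>sphere_points n. along V \<alpha> (cone_jet n \<iota> e t s))"

lemma topspace_even_loops: "topspace (fst \<Omega>) = {f \<in> cmaps (fst S) (fst (B V)). f None = snd (B V)}"
  by (simp add: even_loops_def topspace_Map_based even_sphere_def)

lemma snd_even_loops: "snd \<Omega> = (\<lambda>s\<in>sphere_points n. snd (B V))"
  by (simp add: even_loops_def snd_Map_based const_map_def)

lemma None_in_sphere: "None \<in> sphere_points n"
  by (simp add: topspace_even_sphere)

lemma continuous_map_structure_map: "continuous_map (fst (B U)) (fst \<Omega>) structure_map"
proof (rule continuous_map_compactly_generated[OF B_compactly_generated[OF U]])
  fix L assume L: "compact_Hausdorff_in (fst (B U)) L"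
  show "continuous_map (subtopology (fst (B U)) L) (fst \<Omega>) structure_map"
    unfolding even_loops_def
  proof (rule continuous_map_into_Map_based[OF B_hausdorff_images[OF V]])
    let ?K = "subtopology (fst (B U)) L"
    note K = compact_Hausdorff_in_subtopology[OF L]
    show "compact_space ?K" "Hausdorff_space ?K" using K by simp_all
    let ?P = "prod_topology ?K (fst S)"
    have P: "compact_space ?P" "Hausdorff_space ?P"
      using K compact_space_even_sphere Hausdorff_space_even_sphere
      by (simp_all add: compact_Hausdorff_simps del: topspace_subtopology)
    have "continuous_map ?P (fst (B U)) fst"
      using continuous_map_fst continuous_map_into_fulltopology by blast
    then have "continuous_map ?P (fst (B V)) (\<lambda>p. along V (trans U (fst p)) ((fibre_incl \<iota> e \<circ> snd) p))"
      by (intro continuous_map_along[OF order_refl V P] continuous_map_trans[OF U P]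
          continuous_map_compose[OF continuous_map_snd continuous_map_fibre_incl[OF U VU]])
    then show "continuous_map ?P (fst (B V)) (\<lambda>(b, s). structure_map b s)"
      by (rule continuous_map_eq) (auto simp: structure_map_def)
    show "structure_map b \<in> extensional (sphere_points n)" for b by (simp add: structure_map_def)
    show "structure_map b (snd S) = snd (B V)" if "b \<in> topspace ?K" for b
      using along_None[OF order_refl V trans_in_jet_Nat[OF U]] that None_in_sphere
      by (simp add: structure_map_def even_sphere_def fibre_incl_def)
  qed
qed

lemma structure_map_base: "structure_map (snd (B U)) = snd \<Omega>"
  unfolding structure_map_def snd_even_loops
proof (rule restrict_ext)
  fix s assume s: "s \<in> sphere_points n"
  note f = fibre_incl_in_jets[OF U VU s]
  show "along V (trans U (snd (B U))) (fibre_incl \<iota> e s) = snd (B V)"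
    using T_base[OF U] jet_comp_in_jets[OF U V _ _ f]
    by (intro along_base[OF order_refl V trans_in_jet_Nat[OF U B_base[OF U]] f]) (simp add: trans_def)
qed

lemma T_structure_map:
  assumes "b \<in> topspace (fst (B U))" "s \<in> sphere_points n" "W \<in> J_objects" "\<psi> \<in> jets n V W"
  shows "T V W \<psi> (structure_map b s) = T U W (jet_comp \<psi> (fibre_incl \<iota> e s)) b"
  using T_along[OF order_refl V assms(3) trans_in_jet_Nat[OF U assms(1)] fibre_incl_in_jets[OF U VU assms(2)] assms(4)]
    jet_comp_in_jets[OF U V assms(3,4) fibre_incl_in_jets[OF U VU assms(2)]] assms
  by (simp add: structure_map_def trans_def)

lemma base_in_A: "snd A \<in> topspace (fst A)"
proof -
  have 1: "jet_comp \<phi> \<psi> \<in> jets (n + 1) U X"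
    if "W \<in> J_objects" "X \<in> J_objects" "\<phi> \<in> jets k W X" "\<psi> \<in> jets (n + 1) U W" for W X \<phi> \<psi>
    using that jets_mono[of k "n + 1" X W] kn by (intro jet_comp_in_jets[OF U that(1,2)]) auto
  show ?thesis
    using kn E_object(3)[OF F] E_act(4)[OF F] 1
    by (subst in_jet_Nat_iff) (auto simp: snd_jet_Nat cmaps_def)
qed

text \<open>Joint continuity in the point of \<open>K\<close>, the height and the sphere point is
  curried twice; all three factors are compact Hausdorff.\<close>

lemma continuous_map_nullhomotopy_compact:
  assumes K: "compact_space K" "Hausdorff_space K" and \<alpha>: "continuous_map K (fst A) \<alpha>"
  shows "continuous_map K (Map I (fst \<Omega>)) (\<lambda>x. \<lambda>t\<in>{0..1}. nullhomotopy (\<alpha> x) t)"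
proof (rule continuous_map_into_Map[OF _ K])
  show HI: "hausdorff_images (fst \<Omega>)"
    unfolding even_loops_def by (intro hausdorff_images_Map_based B_hausdorff_images V)
  let ?P = "prod_topology K I" and ?Q = "prod_topology (prod_topology K I) (fst S)"
  have P: "compact_space ?P" "Hausdorff_space ?P"
    using K by (simp_all add: compact_Hausdorff_simps)
  then have Q: "compact_space ?Q" "Hausdorff_space ?Q"
    using compact_space_even_sphere Hausdorff_space_even_sphere
    by (simp_all add: compact_space_prod_topology[of _ "fst S"] Hausdorff_space_prod_topology[of _ "fst S"])
  have "continuous_map ?P (fst \<Omega>) (\<lambda>p. nullhomotopy (\<alpha> (fst p)) (snd p))"
    unfolding even_loops_def
  proof (rule continuous_map_into_Map_based[OF B_hausdorff_images[OF V] P])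
    have 1: "continuous_map ?Q K (fst \<circ> fst)"
      by (rule continuous_map_compose[OF continuous_map_fst continuous_map_fst])
    have 2: "continuous_map ?Q I (\<lambda>q. (snd \<circ> fst) q)"
      using continuous_map_compose[OF continuous_map_fst continuous_map_snd] by (simp add: o_def)
    have "continuous_map ?Q (fst (B V)) (\<lambda>q. along V ((\<alpha> \<circ> (fst \<circ> fst)) q) (cone_jet n \<iota> e ((snd \<circ> fst) q) (snd q)))"
      by (rule continuous_map_along[of "n + 1" V, OF _ V Q continuous_map_compose[OF 1 \<alpha>]
          continuous_map_cone_jet[OF U VU 2 continuous_map_snd]]) simp
    then show "continuous_map ?Q (fst (B V)) (\<lambda>(p, s). nullhomotopy (\<alpha> (fst p)) (snd p) s)"
      by (rule continuous_map_eq) (auto simp: nullhomotopy_def)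
    show "nullhomotopy (\<alpha> (fst p)) (snd p) \<in> extensional (sphere_points n)" for p
      by (simp add: nullhomotopy_def)
    show "nullhomotopy (\<alpha> (fst p)) (snd p) (snd S) = snd (B V)" if "p \<in> topspace ?P" for p
    proof -
      have "\<alpha> (fst p) \<in> topspace (fst A)" using \<alpha> that by (auto simp: continuous_map_def)
      then show ?thesis using along_None[of "n + 1", OF _ V] None_in_sphere
        by (simp add: nullhomotopy_def even_sphere_def)
    qed
  qed
  then show "continuous_map ?P (fst \<Omega>) (\<lambda>(x, t). restrict (nullhomotopy (\<alpha> x)) {0..1} t)"
    by (rule continuous_map_eq) auto
qed auto

text \<open>At height zero the cone jet belongs to \<open>jets n U V\<close>, and on composites with
  such jets \<alpha> agrees with the transformation of its restriction.\<close>

lemma nullhomotopy_0: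
  assumes \<alpha>: "\<alpha> \<in> topspace (fst A)"
  shows "nullhomotopy \<alpha> 0 = structure_map (restriction \<alpha>)"
  unfolding nullhomotopy_def structure_map_def
proof (rule restrict_ext)
  fix s assume s: "s \<in> sphere_points n"
  have id: "jet_id U \<in> jets (n + 1) U U" by (rule jet_id_in_jets[OF U])
  have r: "restriction \<alpha> \<in> topspace (fst (B U))"
    unfolding restriction_def by (rule along_in[OF _ U \<alpha> id]) simp
  have f: "fibre_incl \<iota> e s \<in> jets n U V" by (rule fibre_incl_in_jets[OF U VU s])
  have f': "fibre_incl \<iota> e s \<in> jets (n + 1) U V" using f jets_mono[of n "n + 1" V U] V by auto
  have "along V \<alpha> (fibre_incl \<iota> e s) = along V (trans U (restriction \<alpha>)) (fibre_incl \<iota> e s)"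
  proof (rule T_inject[OF V])
    show "along V \<alpha> (fibre_incl \<iota> e s) \<in> topspace (fst (B V))"
      by (rule along_in[OF _ V \<alpha> f']) simp
    show "along V (trans U (restriction \<alpha>)) (fibre_incl \<iota> e s) \<in> topspace (fst (B V))"
      by (rule along_in[OF order_refl V trans_in_jet_Nat[OF U r] f])
    fix W \<psi> assume W: "W \<in> J_objects" and \<psi>: "\<psi> \<in> jets n V W"
    have c: "jet_comp \<psi> (fibre_incl \<iota> e s) \<in> jets n U W" by (rule jet_comp_in_jets[OF U V W \<psi> f])
    have "T V W \<psi> (along V (trans U (restriction \<alpha>)) (fibre_incl \<iota> e s)) =
      T U W (jet_comp \<psi> (fibre_incl \<iota> e s)) (restriction \<alpha>)"
      using T_along[OF order_refl V W trans_in_jet_Nat[OF U r] f \<psi>] c W by (simp add: trans_def)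
    also have "\<dots> = \<alpha> W (jet_comp (jet_comp \<psi> (fibre_incl \<iota> e s)) (jet_id U))"
      unfolding restriction_def by (rule T_along[OF _ U W \<alpha> id c]) simp
    also have "\<dots> = \<alpha> W (jet_comp \<psi> (fibre_incl \<iota> e s))"
      using jet_comp_id_right[OF U W c] by simp
    also have "\<dots> = T V W \<psi> (along V \<alpha> (fibre_incl \<iota> e s))"
      by (rule T_along[OF _ V W \<alpha> f' \<psi>, symmetric]) simp
    finally show "T V W \<psi> (along V \<alpha> (fibre_incl \<iota> e s)) =
      T V W \<psi> (along V (trans U (restriction \<alpha>)) (fibre_incl \<iota> e s))" by simp
  qed
  then show "along V \<alpha> (cone_jet n \<iota> e 0 s) = along V (trans U (restriction \<alpha>)) (fibre_incl \<iota> e s)"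
    by (simp add: cone_jet_0[OF s])
qed

lemma nullhomotopy_1: "\<alpha> \<in> topspace (fst A) \<Longrightarrow> nullhomotopy \<alpha> 1 = snd \<Omega>"
  unfolding nullhomotopy_def snd_even_loops
  by (rule restrict_ext) (simp add: along_None[of "n + 1", OF _ V])

lemma nullhomotopy_base: "nullhomotopy (snd A) t = snd \<Omega>"
  unfolding nullhomotopy_def snd_even_loops
proof (rule restrict_ext)
  fix s assume s: "s \<in> sphere_points n"
  have c: "cone_jet n \<iota> e t s \<in> jets (n + 1) U V" by (rule cone_jet_in_jets[OF U VU s])
  show "along V (snd A) (cone_jet n \<iota> e t s) = snd (B V)"
  proof (rule along_base[OF _ V base_in_A c])
    fix W \<psi> assume W: "W \<in> J_objects" and "\<psi> \<in> jets n V W"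
    then have "\<psi> \<in> jets (n + 1) V W" using jets_mono[of n "n + 1" W V] by auto
    then show "snd A W (jet_comp \<psi> (cone_jet n \<iota> e t s)) = snd (ob F W)"
      using W jet_comp_in_jets[OF U V W _ c] by (simp add: snd_jet_Nat)
  qed simp
qed

lemma restriction_base: "restriction (snd A) = snd (B U)"
  unfolding restriction_def
proof (rule along_base[OF _ U base_in_A jet_id_in_jets[OF U]])
  fix W \<psi> assume W: "W \<in> J_objects" and "\<psi> \<in> jets n U W"
  then have "\<psi> \<in> jets (n + 1) U W" using jets_mono[of n "n + 1" W U] by auto
  then show "snd A W (jet_comp \<psi> (jet_id U)) = snd (ob F W)"
    using W jet_comp_id_right[OF U W] by (simp add: snd_jet_Nat)
qed simp


section \<open>From the homotopy fibre back to transformations\<close>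

definition glue where
  "glue a \<gamma> W \<xi> = (if \<xi> \<in> jets n U W then T U W \<xi> a
    else (case (SOME (\<psi>, t, s). \<psi> \<in> jets n V W \<and> t \<in> {0..1} \<and> s \<in> sphere_points n \<and>
        \<xi> = jet_comp \<psi> (cone_jet n \<iota> e t s)) of (\<psi>, t, s) \<Rightarrow> T V W \<psi> (\<gamma> t s)))"

abbreviation "Fibre \<equiv> homotopy_fibre (B U) \<Omega> structure_map"

lemma in_Fibre:
  "(a, \<gamma>) \<in> topspace Fibre \<longleftrightarrow> a \<in> topspace (fst (B U)) \<and> \<gamma> \<in> cmaps I (fst \<Omega>) \<and>
    \<gamma> 0 = structure_map a \<and> \<gamma> 1 = snd \<Omega>"
  by (auto simp: homotopy_fibre_def)

lemma Fibre_path: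
  assumes "(a, \<gamma>) \<in> topspace Fibre" "t \<in> {0..1}"
  shows "\<gamma> t \<in> topspace (fst \<Omega>)" "\<gamma> t \<in> extensional (sphere_points n)"
    "s \<in> sphere_points n \<Longrightarrow> \<gamma> t s \<in> topspace (fst (B V))" "\<gamma> t None = snd (B V)"
proof -
  show 1: "\<gamma> t \<in> topspace (fst \<Omega>)"
    using assms by (auto simp: in_Fibre cmaps_def continuous_map_def)
  then show "\<gamma> t \<in> extensional (sphere_points n)" "\<gamma> t None = snd (B V)"
    "s \<in> sphere_points n \<Longrightarrow> \<gamma> t s \<in> topspace (fst (B V))"
    by (auto simp: topspace_even_loops cmaps_def continuous_map_def)
qed

text \<open>The choice in \<open>glue\<close> is harmless. Off \<open>jets n U W\<close> the
  representation as a cone point is unique; on it, the end points of the path and the base points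
  make both descriptions agree, the case t = 0 being the condition that \<gamma> starts at the
  structure map of \<open>a\<close>.\<close>

lemma glue_cone:
  assumes z: "(a, \<gamma>) \<in> topspace Fibre" and W: "W \<in> J_objects" and \<psi>: "\<psi> \<in> jets n V W"
    and t: "t \<in> {0..1}" and s: "s \<in> sphere_points n"
  shows "glue a \<gamma> W (jet_comp \<psi> (cone_jet n \<iota> e t s)) = T V W \<psi> (\<gamma> t s)"
proof (cases "jet_comp \<psi> (cone_jet n \<iota> e t s) \<in> jets n U W")
  case True
  have a: "a \<in> topspace (fst (B U))" and 0: "\<gamma> 0 = structure_map a" and 1: "\<gamma> 1 = snd \<Omega>"
    using z by (auto simp: in_Fibre)
  note path = Fibre_path[OF z t]
  have g: "glue a \<gamma> W (jet_comp \<psi> (cone_jet n \<iota> e t s)) = T U W (jet_comp \<psi> (cone_jet n \<iota> e t s)) a"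
    using True by (simp add: glue_def)
  consider "\<psi> = None" | "s = None" | "t = 1" | "t = 0"
    using jet_comp_cone_jet_in_jets[OF U VU W \<psi> t s True] by blast
  then show ?thesis
  proof cases
    case 4
    then show ?thesis
      unfolding g using T_structure_map[OF a s W \<psi>] by (simp add: 0 cone_jet_0[OF s])
  next
    case 3
    then show ?thesis unfolding g using s T_None[OF U W a] T_base[OF V W \<psi>]
      by (simp add: 1 snd_even_loops)
  next
    case 2
    then show ?thesis unfolding g using path(4) T_None[OF U W a] T_base[OF V W \<psi>] by simp
  next
    case 1
    then show ?thesis unfolding g using T_None[OF U W a] T_None[OF V W path(3)[OF s]] by simp
  qed
next
  case False
  let ?\<xi> = "jet_comp \<psi> (cone_jet n \<iota> e t s)"
  let ?P = "\<lambda>(\<psi>', t', s'). \<psi>' \<in> jets n V W \<and> t' \<in> {0..1} \<and> s' \<in> sphere_points n \<and>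
    ?\<xi> = jet_comp \<psi>' (cone_jet n \<iota> e t' s')"
  have "(SOME p. ?P p) = (\<psi>, t, s)"
  proof (rule some_equality)
    show "?P (\<psi>, t, s)" using \<psi> t s by simp
    fix p assume p: "?P p"
    obtain \<psi>' t' s' where p': "p = (\<psi>', t', s')" by (cases p)
    show "p = (\<psi>, t, s)"
      using jet_comp_cone_jet_inject[OF U VU W \<psi> _ t _ s _ False, of \<psi>' t' s'] p unfolding p' by auto
  qed
  then show ?thesis using False by (simp add: glue_def)
qed

lemma jets_cases:
  assumes "W \<in> J_objects" "\<xi> \<in> jets (n + 1) U W"
  obtains "\<xi> \<in> jets n U W"
  | \<psi> t s where "\<psi> \<in> jets n V W" "t \<in> {0..1}" "s \<in> sphere_points n" "\<xi> = jet_comp \<psi> (cone_jet n \<iota> e t s)"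
  using jet_comp_cone_jet_surj[OF U VU assms] by metis

text \<open>The product of \<open>K\<close> with the Thom space is covered by two compact spaces:
  one carries the jets of the n-th category, the other the cone. On the first the glued map is
  \<open>T U W\<close> applied to \<open>a\<close>, on the second \<open>T V W\<close> applied to
  the path.\<close>

lemma continuous_map_glue:
  assumes K: "compact_space K" "Hausdorff_space K" and W: "W \<in> J_objects"
    and a: "continuous_map K (fst (B U)) a" and g: "continuous_map K (Map I (fst \<Omega>)) g"
    and z: "\<And>x. x \<in> topspace K \<Longrightarrow> (a x, g x) \<in> topspace Fibre"
  shows "continuous_map (prod_topology K (fst (J (n + 1) U W))) (fst (ob F W)) (\<lambda>p. glue (a (fst p)) (g (fst p)) W (snd p))"
proof -
  let ?X = "prod_topology K (fst (J (n + 1) U W))"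
  let ?Q1 = "prod_topology K (fst (J n U W))"
  let ?C = "prod_topology I (fst S)"
  let ?Q2 = "prod_topology K (prod_topology (fst (J n V W)) ?C)"
  have C: "compact_space ?C" "Hausdorff_space ?C"
    using compact_space_even_sphere Hausdorff_space_even_sphere
    by (simp_all add: compact_Hausdorff_simps)
  have Q1: "compact_space ?Q1" "Hausdorff_space ?Q1" "Hausdorff_space ?X"
    using K compact_space_J Hausdorff_space_J[OF U W]
    by (simp_all add: compact_Hausdorff_simps)
  have Q2: "compact_space ?Q2" "Hausdorff_space ?Q2"
    using K C compact_space_J Hausdorff_space_J[OF V W]
    by (simp_all add: compact_space_prod_topology[of K] compact_space_prod_topology[of "fst (J n V W)"]
        Hausdorff_space_prod_topology[of K] Hausdorff_space_prod_topology[of "fst (J n V W)"])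
  have p1: "continuous_map ?Q2 K fst"
    and p2: "continuous_map ?Q2 (fst (J n V W)) (\<lambda>q. fst (snd q))"
    and p3: "continuous_map ?Q2 I (\<lambda>q. fst (snd (snd q)))"
    and p4: "continuous_map ?Q2 (fst S) (\<lambda>q. snd (snd (snd q)))"
    by (rule continuous_map_fst)
      (use continuous_map_compose[OF continuous_map_snd continuous_map_fst]
         continuous_map_compose[OF continuous_map_compose[OF continuous_map_snd continuous_map_snd] continuous_map_fst]
         continuous_map_compose[OF continuous_map_compose[OF continuous_map_snd continuous_map_snd] continuous_map_snd]
       in \<open>simp_all add: o_def\<close>)
  define q2 where "q2 q = (fst q, jet_comp (fst (snd q)) (cone_jet n \<iota> e (fst (snd (snd q))) (snd (snd (snd q)))))"
    for q :: "'c \<times> jet \<times> real \<times> cvec option"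
  show ?thesis
  proof (rule continuous_map_from_two_compact[OF Q1(1) Q2(1) Q1(3)])
    have "continuous_map ?Q1 ?X (\<lambda>q. (fst q, snd q))"
      by (intro continuous_map_pairedI continuous_map_fst
          continuous_map_jets_mono[of n "n + 1", OF _ U W continuous_map_snd]) simp
    then show "continuous_map ?Q1 ?X id" by (simp add: id_def)
    show "continuous_map ?Q2 ?X q2"
      unfolding q2_def
      by (intro continuous_map_pairedI p1 continuous_map_jet_precomp[OF _ U V W p2]
          continuous_map_cone_jet[OF U VU p3 p4]) simp
    show "topspace ?X \<subseteq> id ` topspace ?Q1 \<union> q2 ` topspace ?Q2"
    proof
      fix p assume p: "p \<in> topspace ?X"
      then have pj: "fst p \<in> topspace K" "snd p \<in> jets (n + 1) U W" by auto
      show "p \<in> id ` topspace ?Q1 \<union> q2 ` topspace ?Q2"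
        using W pj(2)
      proof (cases rule: jets_cases)
        case 1
        then show ?thesis using pj by (cases p) auto
      next
        case (2 \<psi> t s)
        then have "p = q2 (fst p, \<psi>, t, s)" "(fst p, \<psi>, t, s) \<in> topspace ?Q2"
          using pj by (auto simp: q2_def intro: prod_eqI)
        then show ?thesis by blast
      qed
    qed
    have "continuous_map ?Q1 (fst (ob F W)) (\<lambda>q. T U W (snd q) ((a \<circ> fst) q))"
      by (rule T_continuous[OF U W Q1(1,2) continuous_map_snd continuous_map_compose[OF continuous_map_fst a]])
    then show "continuous_map ?Q1 (fst (ob F W)) (\<lambda>x. glue (a (fst (id x))) (g (fst (id x))) W (snd (id x)))"
      by (rule continuous_map_eq) (auto simp: glue_def)
    \<comment> \<open>Two evaluations in succession, at the height and then at the sphere point,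
      both over compact Hausdorff spaces.\<close>
    have "continuous_map ?Q2 (compact_open I (fst \<Omega>)) (g \<circ> fst)"
      using continuous_map_compose[OF p1 g] by (rule continuous_map_from_Map)
    then have "continuous_map ?Q2 (fst \<Omega>) (\<lambda>q. (g \<circ> fst) q (fst (snd (snd q))))"
      by (rule continuous_map_eval_compact[OF _ p3])
        (simp_all add: compact_Hausdorff_simps)
    then have "continuous_map ?Q2 (compact_open (fst S) (fst (B V))) (\<lambda>q. (g \<circ> fst) q (fst (snd (snd q))))"
      unfolding even_loops_def by (rule continuous_map_from_Map_based)
    then have "continuous_map ?Q2 (fst (B V)) (\<lambda>q. (g \<circ> fst) q (fst (snd (snd q))) (snd (snd (snd q))))"
      by (rule continuous_map_eval_compact[OF _ p4 compact_space_even_sphere Hausdorff_space_even_sphere])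
    then have "continuous_map ?Q2 (fst (ob F W))
      (\<lambda>q. T V W (fst (snd q)) ((g \<circ> fst) q (fst (snd (snd q))) (snd (snd (snd q)))))"
      by (rule T_continuous[OF V W Q2 p2])
    then show "continuous_map ?Q2 (fst (ob F W)) (\<lambda>x. glue (a (fst (q2 x))) (g (fst (q2 x))) W (snd (q2 x)))"
      by (rule continuous_map_eq) (use z in \<open>auto simp: q2_def glue_cone[OF _ W]\<close>)
  qed
qed

definition unfibre where
  "unfibre z = (\<lambda>W\<in>J_objects. \<lambda>\<xi>\<in>jets (n + 1) U W. glue (fst z) (snd z) W \<xi>)"

lemma unfibre_in:
  assumes z: "z \<in> topspace Fibre"
  shows "unfibre z \<in> topspace (fst A)"
proof -
  have k: "k \<le> n + 1" using kn by simp
  obtain a \<gamma> where ag: "z = (a, \<gamma>)" by (cases z)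
  have a: "a \<in> topspace (fst (B U))" using z ag by (simp add: in_Fibre)
  have \<gamma>: "\<gamma> \<in> topspace (Map I (fst \<Omega>))" using z ag by (simp add: in_Fibre)
  show ?thesis
    unfolding in_jet_Nat_iff[OF k]
  proof (intro conjI ballI)
    show "unfibre z \<in> extensional J_objects" by (simp add: unfibre_def)
    fix W assume W: "W \<in> J_objects"
    \<comment> \<open>A one-point parameter space extracts continuity for a single point of the
      fibre from the parametrised statement.\<close>
    let ?K = "discrete_topology {()}"
    let ?J = "fst (J (n + 1) U W)"
    have "continuous_map (prod_topology ?K ?J) (fst (ob F W)) (\<lambda>p. glue a \<gamma> W (snd p))"
      by (rule continuous_map_glue[OF _ _ W, of ?K "\<lambda>_. a" "\<lambda>_. \<gamma>"])
        (use a \<gamma> z ag in \<open>auto simp: compact_space_discrete_topology Hausdorff_space_discrete_topology\<close>)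
    moreover have "continuous_map ?J (prod_topology ?K ?J) (\<lambda>\<xi>. ((), \<xi>))"
      by (intro continuous_map_pairedI) auto
    ultimately have "continuous_map ?J (fst (ob F W)) ((\<lambda>p. glue a \<gamma> W (snd p)) \<circ> (\<lambda>\<xi>. ((), \<xi>)))"
      by (intro continuous_map_compose)
    then have "continuous_map (fst (J (n + 1) U W)) (fst (ob F W)) (unfibre z W)"
      by (rule continuous_map_eq) (simp add: unfibre_def W ag)
    then show "unfibre z W \<in> cmaps (fst (J (n + 1) U W)) (fst (ob F W))"
      using W by (simp add: cmaps_def unfibre_def)
    show "unfibre z W None = snd (ob F W)"
      using W T_None[OF U W a] by (simp add: unfibre_def glue_def ag)
    fix X \<phi> \<xi> assume X: "X \<in> J_objects" and \<phi>: "\<phi> \<in> jets k W X" and \<xi>: "\<xi> \<in> jets (n + 1) U W"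
    have \<phi>n: "\<phi> \<in> jets n W X" and \<phi>m: "\<phi> \<in> jets (n + 1) W X"
      using \<phi> jets_mono[OF kn X] jets_mono[OF k X] by auto
    have c: "jet_comp \<phi> \<xi> \<in> jets (n + 1) U X" by (rule jet_comp_in_jets[OF U W X \<phi>m \<xi>])
    \<comment> \<open>Postcomposition with \<phi> preserves jets of the n-th category, and on a cone
      point it changes \<psi> alone, leaving height and sphere point fixed. Either way naturality of
      \<open>T\<close> applies.\<close>
    have "glue a \<gamma> X (jet_comp \<phi> \<xi>) = act F W X \<phi> (glue a \<gamma> W \<xi>)"
      using W \<xi>
    proof (cases rule: jets_cases)
      case 1
      then show ?thesis
        using jet_comp_in_jets[OF U W X \<phi>n 1] T_natural[OF U W X \<phi> 1 a] by (simp add: glue_def)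
    next
      case (2 \<psi> t s)
      have cc: "cone_jet n \<iota> e t s \<in> jets (n + 1) U V" by (rule cone_jet_in_jets[OF U VU 2(3)])
      have "\<psi> \<in> jets (n + 1) V W" using 2(1) jets_mono[of n "n + 1" W V] W by auto
      then have "jet_comp \<phi> \<xi> = jet_comp (jet_comp \<phi> \<psi>) (cone_jet n \<iota> e t s)"
        unfolding 2(4) using jet_comp_assoc[OF U V W X \<phi>m _ cc] by simp
      then have "glue a \<gamma> X (jet_comp \<phi> \<xi>) = T V X (jet_comp \<phi> \<psi>) (\<gamma> t s)"
        using glue_cone[OF _ X jet_comp_in_jets[OF V W X \<phi>n 2(1)] 2(2,3)] z ag by simp
      also have "\<dots> = act F W X \<phi> (T V W \<psi> (\<gamma> t s))"
        using T_natural[OF V W X \<phi> 2(1) Fibre_path(3)[OF _ 2(2,3)]] z ag by blast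
      also have "T V W \<psi> (\<gamma> t s) = glue a \<gamma> W \<xi>"
        unfolding 2(4) using glue_cone[OF _ W 2(1-3)] z ag by simp
      finally show ?thesis .
    qed
    then show "unfibre z X (jet_comp \<phi> \<xi>) = act F W X \<phi> (unfibre z W \<xi>)"
      using W X \<xi> c by (simp add: unfibre_def ag)
  qed
qed

lemma T_restriction:
  assumes "\<alpha> \<in> topspace (fst A)" "W \<in> J_objects" "\<psi> \<in> jets n U W"
  shows "T U W \<psi> (restriction \<alpha>) = \<alpha> W \<psi>"
  unfolding restriction_def
  using T_along[of "n + 1", OF _ U assms(2,1) jet_id_in_jets[OF U] assms(3)] jet_comp_id_right[OF U assms(2,3)]
  by simp

lemma restriction_in: "\<alpha> \<in> topspace (fst A) \<Longrightarrow> restriction \<alpha> \<in> topspace (fst (B U))"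
  unfolding restriction_def by (rule along_in[of "n + 1", OF _ U _ jet_id_in_jets[OF U]]) simp_all

lemma T_nullhomotopy:
  assumes "\<alpha> \<in> topspace (fst A)" "W \<in> J_objects" "\<psi> \<in> jets n V W" "s \<in> sphere_points n"
  shows "T V W \<psi> (nullhomotopy \<alpha> t s) = \<alpha> W (jet_comp \<psi> (cone_jet n \<iota> e t s))"
  unfolding nullhomotopy_def
  using T_along[of "n + 1", OF _ V assms(2,1) cone_jet_in_jets[OF U VU assms(4)] assms(3)] assms(4)
  by simp

lemma nullhomotopy_in:
  assumes "\<alpha> \<in> topspace (fst A)" "s \<in> sphere_points n"
  shows "nullhomotopy \<alpha> t s \<in> topspace (fst (B V))"
  unfolding nullhomotopy_def
  using along_in[of "n + 1", OF _ V assms(1) cone_jet_in_jets[OF U VU assms(2)]] assms(2) by simp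

definition into_fibre where "into_fibre \<alpha> = (restriction \<alpha>, \<lambda>t\<in>{0..1}. nullhomotopy \<alpha> t)"

lemma unfibre_into_fibre:
  assumes \<alpha>: "\<alpha> \<in> topspace (fst A)" and f: "into_fibre \<alpha> \<in> topspace Fibre"
  shows "unfibre (into_fibre \<alpha>) = \<alpha>"
proof -
  have k: "k \<le> n + 1" using kn by simp
  note ext = \<alpha>[unfolded in_jet_Nat_iff[OF k]]
  show ?thesis
  proof (rule extensionalityI[of _ J_objects])
    show "unfibre (into_fibre \<alpha>) \<in> extensional J_objects" by (simp add: unfibre_def)
    show "\<alpha> \<in> extensional J_objects" using ext by simp
    fix W assume W: "W \<in> J_objects"
    show "unfibre (into_fibre \<alpha>) W = \<alpha> W"
    proof (rule extensionalityI[of _ "jets (n + 1) U W"])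
      show "unfibre (into_fibre \<alpha>) W \<in> extensional (jets (n + 1) U W)" using W by (simp add: unfibre_def)
      show "\<alpha> W \<in> extensional (jets (n + 1) U W)" using ext W by (simp add: cmaps_def)
      fix \<xi> assume \<xi>: "\<xi> \<in> jets (n + 1) U W"
      have "glue (fst (into_fibre \<alpha>)) (snd (into_fibre \<alpha>)) W \<xi> = \<alpha> W \<xi>"
        using W \<xi>
      proof (cases rule: jets_cases)
        case 1
        then show ?thesis using T_restriction[OF \<alpha> W 1] by (simp add: glue_def into_fibre_def)
      next
        case (2 \<psi> t s)
        then show ?thesis
          using glue_cone[OF _ W 2(1-3)] f T_nullhomotopy[OF \<alpha> W 2(1,3)] by (simp add: into_fibre_def)
      qed
      then show "unfibre (into_fibre \<alpha>) W \<xi> = \<alpha> W \<xi>" using W \<xi> by (simp add: unfibre_def)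
    qed
  qed
qed

text \<open>Both components are compared through \<open>T\<close>: on jets of the n-th category the
  glued transformation returns \<open>a\<close>, on cone points it returns \<gamma> by
  \<open>glue_cone\<close>.\<close>

lemma into_fibre_unfibre:
  assumes z: "z \<in> topspace Fibre"
  shows "into_fibre (unfibre z) = z"
proof -
  obtain a \<gamma> where ag: "z = (a, \<gamma>)" by (cases z)
  have ag': "(a, \<gamma>) \<in> topspace Fibre" using z ag by simp
  have a: "a \<in> topspace (fst (B U))" using ag' by (simp add: in_Fibre)
  note u = unfibre_in[OF z]
  have "restriction (unfibre z) = a"
  proof (rule T_inject[OF U restriction_in[OF u] a])
    fix W \<psi> assume W: "W \<in> J_objects" and \<psi>: "\<psi> \<in> jets n U W"
    have "\<psi> \<in> jets (n + 1) U W" using \<psi> jets_mono[of n "n + 1" W U] W by auto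
    then show "T U W \<psi> (restriction (unfibre z)) = T U W \<psi> a"
      using T_restriction[OF u W \<psi>] W \<psi> by (simp add: unfibre_def glue_def ag)
  qed
  moreover have "(\<lambda>t\<in>{0..1}. nullhomotopy (unfibre z) t) = \<gamma>"
  proof (rule extensionalityI[of _ "{0..1}"])
    show "\<gamma> \<in> extensional {0..1}" using ag' by (simp add: in_Fibre cmaps_def)
    fix t :: real assume t: "t \<in> {0..1}"
    have "nullhomotopy (unfibre z) t = \<gamma> t"
    proof (rule extensionalityI[of _ "sphere_points n"])
      show "nullhomotopy (unfibre z) t \<in> extensional (sphere_points n)" by (simp add: nullhomotopy_def)
      show "\<gamma> t \<in> extensional (sphere_points n)" by (rule Fibre_path(2)[OF ag' t])
      fix s assume s: "s \<in> sphere_points n"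
      show "nullhomotopy (unfibre z) t s = \<gamma> t s"
      proof (rule T_inject[OF V nullhomotopy_in[OF u s] Fibre_path(3)[OF ag' t s]])
        fix W \<psi> assume W: "W \<in> J_objects" and \<psi>: "\<psi> \<in> jets n V W"
        have "\<psi> \<in> jets (n + 1) V W" using \<psi> jets_mono[of n "n + 1" W V] W by auto
        then have "jet_comp \<psi> (cone_jet n \<iota> e t s) \<in> jets (n + 1) U W"
          using jet_comp_in_jets[OF U V W _ cone_jet_in_jets[OF U VU s]] by blast
        then show "T V W \<psi> (nullhomotopy (unfibre z) t s) = T V W \<psi> (\<gamma> t s)"
          using T_nullhomotopy[OF u W \<psi> s] glue_cone[OF ag' W \<psi> t s] W by (simp add: unfibre_def ag)
      qed
    qed
    then show "(\<lambda>t\<in>{0..1}. nullhomotopy (unfibre z) t) t = \<gamma> t" using t by simp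
  qed simp
  ultimately show ?thesis by (simp add: into_fibre_def ag)
qed

lemma continuous_map_into_fibre: "continuous_map (fst A) Fibre into_fibre"
proof (rule continuous_map_compactly_generated[OF compactly_generated_jet_Nat])
  fix L assume L: "compact_Hausdorff_in (fst A) L"
  let ?K = "subtopology (fst A) L"
  let ?Y = "subtopology (prod_topology (fst (B U)) (Map I (fst \<Omega>)))
    {(y, \<gamma>). \<gamma> 0 = structure_map y \<and> \<gamma> 1 = snd \<Omega>}"
  note K = compact_Hausdorff_in_subtopology(1,2)[OF L]
  have id: "continuous_map ?K (fst A) (\<lambda>\<alpha>. \<alpha>)"
    using continuous_map_from_subtopology[OF continuous_map_id] by (simp add: id_def)
  have HI: "hausdorff_images (fst \<Omega>)"
    unfolding even_loops_def by (intro hausdorff_images_Map_based B_hausdorff_images V)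
  have "continuous_map ?K (fst (B U)) restriction"
    unfolding restriction_def
    by (rule continuous_map_along[of "n + 1", OF _ U K id]) (auto simp: jet_id_in_jets[OF U])
  then have c: "continuous_map ?K (prod_topology (fst (B U)) (Map I (fst \<Omega>))) into_fibre"
    unfolding into_fibre_def
    by (intro continuous_map_pairedI continuous_map_nullhomotopy_compact K id)
  show "continuous_map ?K Fibre into_fibre"
    unfolding homotopy_fibre_def
  proof (rule continuous_map_into_kify[OF _ K])
    show "hausdorff_images ?Y"
      by (intro hausdorff_images_subtopology hausdorff_images_prod hausdorff_images_Map HI
          B_hausdorff_images U)
    show "continuous_map ?K ?Y into_fibre"
      unfolding continuous_map_in_subtopology
      using c by (auto simp: into_fibre_def nullhomotopy_0 nullhomotopy_1)
  qed
qed

lemma continuous_map_unfibre: "continuous_map Fibre (fst A) unfibre"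
proof (rule continuous_map_compactly_generated)
  show "compactly_generated Fibre" by (simp add: homotopy_fibre_def)
  fix L assume L: "compact_Hausdorff_in Fibre L"
  let ?K = "subtopology Fibre L"
  note K = compact_Hausdorff_in_subtopology(1,2)[OF L]
  have "continuous_map ?K Fibre id"
    by (rule continuous_map_from_subtopology[OF continuous_map_id])
  then have "continuous_map ?K (prod_topology (fst (B U)) (Map I (fst \<Omega>))) id"
    unfolding homotopy_fibre_def using continuous_map_kifyD continuous_map_into_fulltopology by blast
  then have c: "continuous_map ?K (fst (B U)) fst" "continuous_map ?K (Map I (fst \<Omega>)) snd"
    using continuous_map_compose[OF _ continuous_map_fst] continuous_map_compose[OF _ continuous_map_snd]
    by fastforce+
  show "continuous_map ?K (fst A) unfibre"
  proof (rule continuous_map_into_jet_Nat[OF F K])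
    show "unfibre z \<in> topspace (fst A)" if "z \<in> topspace ?K" for z
      using that by (intro unfibre_in) simp
    fix W assume W: "W \<in> J_objects"
    have "continuous_map (prod_topology ?K (fst (J (n + 1) U W))) (fst (ob F W))
      (\<lambda>p. glue (fst (fst p)) (snd (fst p)) W (snd p))"
      by (rule continuous_map_glue[OF K W c]) simp
    then show "continuous_map (prod_topology ?K (fst (J (n + 1) U W))) (fst (ob F W)) (\<lambda>(z, \<xi>). unfibre z W \<xi>)"
      by (rule continuous_map_eq) (auto simp: unfibre_def W)
  qed
qed

text \<open>The product with the interval carries the ordinary product topology. Instead of testing
  on its compact subsets, the map into the path space is tested on those of \<open>A\<close> and
  then evaluated on the compact interval.\<close>

lemma continuous_map_nullhomotopy:
  "continuous_map (prod_topology (fst A) I) (fst \<Omega>) (\<lambda>(\<alpha>, t). nullhomotopy \<alpha> t)"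
proof -
  let ?P = "prod_topology (fst A) I"
  have "continuous_map (fst A) (Map I (fst \<Omega>)) (\<lambda>\<alpha>. \<lambda>t\<in>{0..1}. nullhomotopy \<alpha> t)"
  proof (rule continuous_map_compactly_generated[OF compactly_generated_jet_Nat])
    fix L assume L: "compact_Hausdorff_in (fst A) L"
    show "continuous_map (subtopology (fst A) L) (Map I (fst \<Omega>)) (\<lambda>\<alpha>. \<lambda>t\<in>{0..1}. nullhomotopy \<alpha> t)"
      by (rule continuous_map_nullhomotopy_compact[OF compact_Hausdorff_in_subtopology(1,2)[OF L]])
        (use continuous_map_from_subtopology[OF continuous_map_id] in \<open>simp add: id_def\<close>)
  qed
  from continuous_map_from_Map[OF continuous_map_compose[OF continuous_map_fst this]]
  have "continuous_map ?P (compact_open I (fst \<Omega>)) ((\<lambda>\<alpha>. \<lambda>t\<in>{0..1}. nullhomotopy \<alpha> t) \<circ> fst)" .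
  then have "continuous_map ?P (fst \<Omega>) (\<lambda>p. ((\<lambda>\<alpha>. \<lambda>t\<in>{0..1}. nullhomotopy \<alpha> t) \<circ> fst) p (snd p))"
    by (rule continuous_map_eval_compact[OF _ continuous_map_snd])
      (simp_all add: compact_Hausdorff_simps)
  then show ?thesis by (rule continuous_map_eq) auto
qed

text \<open>The maps \<open>i\<close> and \<open>p\<close> are compared with the abstract ones on
  points of the spaces only, since the concrete maps may take other values elsewhere. The comparison
  with the homotopy fibre is a homeomorphism, with inverse \<open>unfibre\<close>.\<close>

theorem fibre_sequence:
  assumes i: "\<And>\<alpha>. \<alpha> \<in> topspace (fst A) \<Longrightarrow> i \<alpha> = restriction \<alpha>"
    and p: "\<And>b. b \<in> topspace (fst (B U)) \<Longrightarrow> p b = structure_map b"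
  shows "homotopy_fibre_sequence A (B U) \<Omega> i p"
proof -
  \<comment> \<open>The homotopy fibre depends on \<open>p\<close> only through its values on points
    of \<open>B U\<close>.\<close>
  have fib: "homotopy_fibre (B U) \<Omega> p = Fibre"
  proof -
    let ?X = "prod_topology (fst (B U)) (Map I (fst \<Omega>))"
    have "topspace ?X \<inter> {(y, \<gamma>). \<gamma> 0 = p y \<and> \<gamma> 1 = snd \<Omega>} =
      topspace ?X \<inter> {(y, \<gamma>). \<gamma> 0 = structure_map y \<and> \<gamma> 1 = snd \<Omega>}"
      using p by auto
    from arg_cong[OF this, of "subtopology ?X"] show ?thesis
      unfolding homotopy_fibre_def subtopology_restrict by (rule arg_cong)
  qed
  have "continuous_map (fst A) (prod_topology (fst (B U)) (Map I (fst \<Omega>))) into_fibre"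
    using continuous_map_into_fibre continuous_map_kifyD continuous_map_into_fulltopology
    unfolding homotopy_fibre_def by blast
  from continuous_map_compose[OF this continuous_map_fst]
  have "continuous_map (fst A) (fst (B U)) restriction" by (simp add: o_def into_fibre_def)
  then have ib: "based_map A (B U) i"
    unfolding based_map_def using i[OF base_in_A] restriction_base i
    by (auto intro: continuous_map_eq)
  have pb: "based_map (B U) \<Omega> p"
    unfolding based_map_def using p[OF B_base[OF U]] structure_map_base p
    by (auto intro: continuous_map_eq[OF continuous_map_structure_map])
  have eq: "into_fibre \<alpha> = (i \<alpha>, \<lambda>t\<in>{0..1}. case (\<alpha>, t) of (\<alpha>, t) \<Rightarrow> nullhomotopy \<alpha> t)"
    if "\<alpha> \<in> topspace (fst A)" for \<alpha>
    using i[OF that] by (simp add: into_fibre_def)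
  have "weak_homotopy_equivalence (fst A) Fibre (\<lambda>\<alpha>. (i \<alpha>, \<lambda>t\<in>{0..1}. case (\<alpha>, t) of (\<alpha>, t) \<Rightarrow> nullhomotopy \<alpha> t))"
  proof (rule homeomorphic_maps_weak_homotopy_equivalence)
    show "continuous_map (fst A) Fibre (\<lambda>\<alpha>. (i \<alpha>, \<lambda>t\<in>{0..1}. case (\<alpha>, t) of (\<alpha>, t) \<Rightarrow> nullhomotopy \<alpha> t))"
      by (rule continuous_map_eq[OF continuous_map_into_fibre eq])
    show "continuous_map Fibre (fst A) unfibre" by (rule continuous_map_unfibre)
    fix \<alpha> assume \<alpha>: "\<alpha> \<in> topspace (fst A)"
    have "into_fibre \<alpha> \<in> topspace Fibre"
      using continuous_map_into_fibre \<alpha> by (auto simp: continuous_map_def)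
    then show "unfibre (i \<alpha>, \<lambda>t\<in>{0..1}. case (\<alpha>, t) of (\<alpha>, t) \<Rightarrow> nullhomotopy \<alpha> t) = \<alpha>"
      using unfibre_into_fibre[OF \<alpha>] eq[OF \<alpha>] by simp
  next
    fix z assume z: "z \<in> topspace Fibre"
    show "(i (unfibre z), \<lambda>t\<in>{0..1}. case (unfibre z, t) of (\<alpha>, t) \<Rightarrow> nullhomotopy \<alpha> t) = z"
      using into_fibre_unfibre[OF z] eq[OF unfibre_in[OF z]] by simp
  qed
  then show ?thesis
    unfolding homotopy_fibre_sequence_def fib
    using ib pb continuous_map_nullhomotopy nullhomotopy_0 nullhomotopy_1 nullhomotopy_base i p restriction_in
    by (intro conjI exI[of _ "\<lambda>(\<alpha>, t). nullhomotopy \<alpha> t"]) auto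
qed

end

end

section \<open>The values of a functor and the derivatives as jet modules\<close>

lemma jet_module_values:
  assumes F: "F \<in> E n"
  shows "jet_module n n F (ob F) (act F) yoneda"
proof
  show "n \<le> n" "F \<in> E n" using F by simp_all
  fix V assume V: "V \<in> J_objects"
  show "hausdorff_images (fst (ob F V))" "compactly_generated (fst (ob F V))"
    "snd (ob F V) \<in> topspace (fst (ob F V))"
    using E_object[OF F V] by simp_all
  show "continuous_map (fst (jet_Nat n n V F)) (fst (ob F V)) (yoneda V)"
    unfolding yoneda_def
    by (rule continuous_map_jet_Nat_eval[OF V V continuous_map_id[unfolded id_def]])
      (simp add: jet_id_in_jets[OF V])
  show "yoneda V (\<lambda>W\<in>J_objects. \<lambda>\<psi>\<in>jets n V W. act F V W \<psi> b) = b"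
    if "b \<in> topspace (fst (ob F V))" for b
    using E_id[OF F V that] V jet_id_in_jets[OF V, of n] by (simp add: yoneda_def)
  fix W assume W: "W \<in> J_objects"
  show "act F V W None b = snd (ob F W)" if "b \<in> topspace (fst (ob F V))" for b
    using that by (simp add: E_act(2)[OF F V W] const_map_def)
  show "continuous_map (prod_topology (fst (J n V W)) (subtopology (fst (ob F V)) L)) (fst (ob F W)) (\<lambda>(\<psi>, b). act F V W \<psi> b)"
    if L: "compact_Hausdorff_in (fst (ob F V)) L" for L
  proof -
    let ?P = "prod_topology (fst (J n V W)) (subtopology (fst (ob F V)) L)"
    have 1: "continuous_map ?P (compact_open (fst (ob F V)) (fst (ob F W))) (act F V W \<circ> fst)"
      by (rule continuous_map_from_Map_based[OF continuous_map_compose[OF continuous_map_fst E_act(1)[OF F V W]]])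
    have 2: "continuous_map ?P (fst (ob F V)) snd"
      using continuous_map_snd continuous_map_into_fulltopology by blast
    \<comment> \<open>Here \<open>b\<close> ranges over a value of \<open>F\<close>, where joint
      evaluation is available over the compact Hausdorff set \<open>L\<close>; this case dictates
      the form of the continuity assumption in the locale.\<close>
    have "continuous_map ?P (fst (ob F W)) (\<lambda>p. (act F V W \<circ> fst) p (snd p))"
      by (rule continuous_map_eval[OF 1 2 L]) auto
    then show ?thesis by (rule continuous_map_eq) auto
  qed
  fix \<psi> assume \<psi>: "\<psi> \<in> jets n V W"
  show "act F V W \<psi> (snd (ob F V)) = snd (ob F W)" by (rule E_act(4)[OF F V W \<psi>])
  show "act F V W \<psi> (yoneda V \<beta>) = \<beta> W \<psi>" if "\<beta> \<in> topspace (fst (jet_Nat n n V F))" for \<beta>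
  proof -
    have "\<beta> W (jet_comp \<psi> (jet_id V)) = act F V W \<psi> (\<beta> V (jet_id V))"
      using that V W \<psi> jet_id_in_jets[OF V, of n] by (simp add: in_jet_Nat_iff)
    then show ?thesis using jet_comp_id_right[OF V W \<psi>] by (simp add: yoneda_def)
  qed
  show "act F V X (jet_comp \<phi> \<psi>) b = act F W X \<phi> (act F V W \<psi> b)"
    if "X \<in> J_objects" "\<phi> \<in> jets n W X" "b \<in> topspace (fst (ob F V))" for X \<phi> b
    by (rule E_comp[OF F V W that(1) \<psi> that(2,3)])
qed

text \<open>The points of the derivative are transformations already, so \<open>R\<close> is the
  identity and \<open>T\<close> is evaluation, jointly continuous because Thom spaces are compact
  Hausdorff.\<close>

lemma jet_module_derivative:
  assumes F: "F \<in> E 0"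
  shows "jet_module 0 n F (\<lambda>V. jet_Nat 0 n V F) (\<lambda>V W \<psi> b. b W \<psi>) (\<lambda>V \<beta>. \<beta>)"
proof
  show "0 \<le> n" "F \<in> E 0" using F by simp_all
  fix V assume V: "V \<in> J_objects"
  show "hausdorff_images (fst (jet_Nat 0 n V F))" "compactly_generated (fst (jet_Nat 0 n V F))"
    using hausdorff_images_jet_Nat[OF F] compactly_generated_jet_Nat by auto
  have c: "jet_comp \<phi> \<psi> \<in> jets n V X"
    if "W \<in> J_objects" "X \<in> J_objects" "\<phi> \<in> jets 0 W X" "\<psi> \<in> jets n V W" for W X \<phi> \<psi>
    using that jets_mono[of 0 n X W] by (intro jet_comp_in_jets[OF V that(1,2)]) auto
  show "snd (jet_Nat 0 n V F) \<in> topspace (fst (jet_Nat 0 n V F))"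
    using E_object(3)[OF F] E_act(4)[OF F] c
    by (subst in_jet_Nat_iff) (auto simp: snd_jet_Nat cmaps_def)
  show "continuous_map (fst (jet_Nat 0 n V F)) (fst (jet_Nat 0 n V F)) (\<lambda>\<beta>. \<beta>)"
    using continuous_map_id by (simp add: id_def)
  show "(\<lambda>W\<in>J_objects. \<lambda>\<psi>\<in>jets n V W. b W \<psi>) = b"
    if "b \<in> topspace (fst (jet_Nat 0 n V F))" for b
  proof -
    have b: "b \<in> extensional J_objects" "\<And>W. W \<in> J_objects \<Longrightarrow> b W \<in> extensional (jets n V W)"
      using that by (auto simp: in_jet_Nat_iff cmaps_def)
    then have "(\<lambda>W\<in>J_objects. \<lambda>\<psi>\<in>jets n V W. b W \<psi>) = (\<lambda>W\<in>J_objects. b W)"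
      by (intro restrict_ext) (simp add: extensional_restrict)
    then show ?thesis using extensional_restrict[OF b(1)] by simp
  qed
  fix W assume W: "W \<in> J_objects"
  show "b W None = snd (ob F W)" if "b \<in> topspace (fst (jet_Nat 0 n V F))" for b
    using that W by (simp add: in_jet_Nat_iff)
  show "continuous_map (prod_topology (fst (J n V W)) (subtopology (fst (jet_Nat 0 n V F)) L)) (fst (ob F W)) (\<lambda>(\<psi>, b). b W \<psi>)"
    for L
  proof -
    let ?P = "prod_topology (fst (J n V W)) (subtopology (fst (jet_Nat 0 n V F)) L)"
    have "continuous_map ?P (fst (jet_Nat 0 n V F)) snd"
      using continuous_map_snd continuous_map_into_fulltopology by blast
    from continuous_map_jet_Nat_eval[OF V W this continuous_map_fst]
    show ?thesis by (rule continuous_map_eq) auto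
  qed
  fix \<psi> assume \<psi>: "\<psi> \<in> jets n V W"
  show "snd (jet_Nat 0 n V F) W \<psi> = snd (ob F W)" using W \<psi> by (simp add: snd_jet_Nat)
  show "b X (jet_comp \<phi> \<psi>) = act F W X \<phi> (b W \<psi>)"
    if "X \<in> J_objects" "\<phi> \<in> jets 0 W X" "b \<in> topspace (fst (jet_Nat 0 n V F))" for X \<phi> b
    using that W \<psi> by (simp add: in_jet_Nat_iff)
qed (rule refl)

lemma fibre_sequence_values:
  assumes F: "F \<in> E n" and U: "U \<in> J_objects" and VU: "is_plus_C U V \<iota> e"
  shows "homotopy_fibre_sequence (jet_Nat n (n + 1) U F) (ob F U) (even_loops n (ob F V))
    (\<lambda>\<alpha>. yoneda U (restrict_jets n U \<alpha>)) (adjoint_structure_map n F U V \<iota> e)"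
proof -
  interpret M: jet_module n n F "ob F" "act F" yoneda by (rule jet_module_values[OF F])
  have V: "V \<in> J_objects" using plus_C_facts(1)[OF U VU] .
  have id: "jet_id U \<in> jets n U U" by (rule jet_id_in_jets[OF U])
  show ?thesis
  proof (rule M.fibre_sequence[OF U VU])
    \<comment> \<open>Both sides are the value of \<alpha> at the identity jet.\<close>
    show "yoneda U (restrict_jets n U \<alpha>) = M.restriction U \<alpha>" for \<alpha>
      using U id jet_comp_id_right[OF U U id]
      by (simp add: M.restriction_def[OF U VU] M.along_def[OF U VU] yoneda_def restrict_jets_def
          precomp_apply jet_incl_id)
    fix b
    have "act F U V (fibre_incl \<iota> e s) b = M.along V (M.trans U b) (fibre_incl \<iota> e s)"
      if s: "s \<in> sphere_points n" for s
    proof -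
      note f = fibre_incl_in_jets[OF U VU s]
      show ?thesis
        using f V jet_id_in_jets[OF V, of n] jet_comp_id_left[OF U V f]
        by (simp add: M.along_def[OF U VU] yoneda_def precomp_apply M.trans_def)
    qed
    then show "adjoint_structure_map n F U V \<iota> e b = M.structure_map U V \<iota> e b"
      unfolding adjoint_structure_map_def M.structure_map_def[OF U VU]
      by (intro restrict_ext)
  qed
qed

lemma fibre_sequence_derivative:
  assumes F: "F \<in> E 0" and U: "U \<in> J_objects" and VU: "is_plus_C U V \<iota> e"
  shows "homotopy_fibre_sequence (jet_Nat 0 (n + 1) U F) (jet_Nat 0 n U F) (even_loops n (jet_Nat 0 n V F))
    (restrict_jets n U) (adjoint_structure_map n (derivative n F) U V \<iota> e)"
proof -
  interpret M: jet_module 0 n F "\<lambda>V. jet_Nat 0 n V F" "\<lambda>V W \<psi> b. b W \<psi>" "\<lambda>V \<beta>. \<beta>"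
    by (rule jet_module_derivative[OF F])
  have V: "V \<in> J_objects" using plus_C_facts(1)[OF U VU] .
  show ?thesis
  proof (rule M.fibre_sequence[OF U VU])
    show "restrict_jets n U \<alpha> = M.restriction U \<alpha>" for \<alpha>
      unfolding restrict_jets_def M.restriction_def[OF U VU] M.along_def[OF U VU] precomp_def
      by (intro restrict_ext) (simp add: jet_incl_id jet_comp_id_right[OF U])
    fix b assume b: "b \<in> topspace (fst (jet_Nat 0 n U F))"
    have "act (derivative n F) U V (fibre_incl \<iota> e s) b = M.along V (M.trans U b) (fibre_incl \<iota> e s)"
      if s: "s \<in> sphere_points n" for s
    proof -
      note f = fibre_incl_in_jets[OF U VU s]
      have "act (derivative n F) U V (fibre_incl \<iota> e s) b =
        (\<lambda>X\<in>J_objects. \<lambda>\<psi>\<in>jets n V X. b X (jet_comp \<psi> (fibre_incl \<iota> e s)))"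
        using b by (simp add: ind_def topspace_jet_Nat_eq)
      also have "\<dots> = M.along V (M.trans U b) (fibre_incl \<iota> e s)"
        unfolding M.along_def[OF U VU] precomp_def M.trans_def
        by (intro restrict_ext) (simp add: jet_comp_in_jets[OF U V _ _ f])
      finally show ?thesis .
    qed
    then show "adjoint_structure_map n (derivative n F) U V \<iota> e b = M.structure_map U V \<iota> e b"
      unfolding adjoint_structure_map_def M.structure_map_def[OF U VU]
      by (intro restrict_ext)
  qed
qed

theorem propositionB:
  "(\<forall>n. \<forall>F :: 'a jet_functor. F \<in> E n \<longrightarrow>
      (\<forall>U V \<iota> e. U \<in> J_objects \<and> is_plus_C U V \<iota> e \<longrightarrow>
        homotopy_fibre_sequence
          (ob (res n (ind n (n + 1) F)) U) (ob F U) (even_loops n (ob F V))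
          (\<lambda>\<alpha>. yoneda U (restrict_jets n U \<alpha>)) (adjoint_structure_map n F U V \<iota> e)))
   \<and>
   (\<forall>F :: 'a jet_functor. F \<in> E 0 \<longrightarrow>
      (\<forall>U V \<iota> e. U \<in> J_objects \<and> is_plus_C U V \<iota> e \<longrightarrow>
        homotopy_fibre_sequence
          (ob (derivative 1 F) U) (ob F U) (even_loops 0 (ob F V))
          (\<lambda>\<alpha>. yoneda U (restrict_jets 0 U \<alpha>)) (adjoint_structure_map 0 F U V \<iota> e)
        \<and>
        (\<forall>n\<ge>2. homotopy_fibre_sequence
          (ob (derivative n F) U) (ob (derivative (n - 1) F) U)
          (even_loops (n - 1) (ob (derivative (n - 1) F) V))
          (restrict_jets (n - 1) U)
          (adjoint_structure_map (n - 1) (derivative (n - 1) F) U V \<iota> e))))"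
proof (intro conjI allI impI; elim conjE)
  have ob_ind: "ob (ind m n F) X = jet_Nat m n X F" for m n X and F :: "'a jet_functor"
    by (simp add: ind_def jet_Nat_def)
  fix F :: "'a jet_functor" and U V \<iota> e
  assume U: "U \<in> J_objects" and VU: "is_plus_C U V \<iota> e"
  show "homotopy_fibre_sequence (ob (res n (ind n (n + 1) F)) U) (ob F U) (even_loops n (ob F V))
    (\<lambda>\<alpha>. yoneda U (restrict_jets n U \<alpha>)) (adjoint_structure_map n F U V \<iota> e)" if "F \<in> E n" for n
    using fibre_sequence_values[OF that U VU] by (simp add: res_def ob_ind)
  assume F: "F \<in> E 0"
  \<comment> \<open>The zeroth derivative is \<open>F\<close> itself rather than
    \<open>ind 0 0 F\<close>, so this case is the sequence for functors in \<open>E n\<close> at n =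
    0, with its Yoneda identification.\<close>
  show "homotopy_fibre_sequence (ob (derivative 1 F) U) (ob F U) (even_loops 0 (ob F V))
    (\<lambda>\<alpha>. yoneda U (restrict_jets 0 U \<alpha>)) (adjoint_structure_map 0 F U V \<iota> e)"
    using fibre_sequence_values[OF F U VU] by (simp add: ob_ind)
  \<comment> \<open>From n = 2 on the middle term is a space of transformations, and restriction
    along the inclusion of jets lands in it directly.\<close>
  show "homotopy_fibre_sequence (ob (derivative n F) U) (ob (derivative (n - 1) F) U)
    (even_loops (n - 1) (ob (derivative (n - 1) F) V)) (restrict_jets (n - 1) U)
    (adjoint_structure_map (n - 1) (derivative (n - 1) F) U V \<iota> e)" if "n \<ge> 2" for n
    using fibre_sequence_derivative[OF F U VU, of "n - 1"] that by (simp add: ob_ind)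
qed

end
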